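(* Let $\mu,\nu\in\mathcal{P}(\mathbb{R})$ be as in the context, satisfying Assumptions A and B. Then the problem $\inf_{\pi\in\mathcal{M}(\mu,\nu)}H(\pi|\mu\otimes\nu)$ has a unique optimizer $\pi^*\in\mathcal{M}(\mu,\nu)$, and there exist Borel functions $f\in L^1(\mu)$, $g\in L^1(\nu)$ and $h:\mathbb{R}\to\mathbb{R}$ (measurable) such that $h(x)(y-x)\in L^1(\pi)$ for every $\pi\in\mathcal{M}_{\mathrm{fin}}(\mu,\nu)$ and $$\frac{d\pi^*}{d(\mu\otimes\nu)}(x,y)=e^{f(x)+g(y)-h(x)(y-x)}.$$ Any such triplet $(f,g,h)$ is called a triplet of potentials. The potentials are unique up to an affine shift: if $(f,g,h)$ are potentials, then $(f',g',h')$ (with $f'\in L^1(\mu)$, $g'\in L^1(\nu)$, $h'$ measurable) are potentials if and only if there are constants $\alpha,\beta\in\mathbb{R}$ with $$f'(x)-f(x)=\alpha x+\beta\ \ \mu\text{-a.s.},\qquad g(y)-g'(y)=\alpha y+\beta\ \ \nu\text{-a.s.},\qquad h-h'=\alpha\ \ \mu\text{-a.s.}$$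
   Context: Standing setting: $\mu,\nu$ are Borel probability measures on $\mathbb{R}$ with finite first moments, in convex order ($\int\varphi\,d\mu\le\int\varphi\,d\nu$ for all convex $\varphi:\mathbb{R}\to\mathbb{R}$), centered ($\int x\,\mu(dx)=\int y\,\nu(dy)=0$), and $\mu\neq\delta_0$. $\Pi(\mu,\nu)$ is the set of couplings of $\mu$ and $\nu$; for $\pi\in\Pi(\mu,\nu)$, $(\pi_x)$ denotes its disintegration kernel w.r.t. the first marginal, $\pi(dx,dy)=\mu(dx)\pi_x(dy)$. $\mathcal{M}(\mu,\nu)=\{\pi\in\Pi(\mu,\nu):\int(y-x)\pi_x(dy)=0\ \mu\text{-a.s.}\}$ is the set of martingale couplings. $H(\pi|R)=\int\log(d\pi/dR)\,d\pi$ if $\pi\ll R$ and $+\infty$ otherwise (relative entropy). $\mathcal{M}_{\mathrm{fin}}(\mu,\nu)=\{\pi\in\mathcal{M}(\mu,\nu):H(\pi|\mu\otimes\nu)<\infty\}$. Assumption A: there exists $\bar\pi\in\mathcal{M}(\mu,\nu)$ with $\bar\pi$ equivalent to $\mu\otimes\nu$ (mutually absolutely continuous) and $H(\bar\pi|\mu\otimes\nu)<\infty$. Assumption B: with $s_-=\inf\operatorname{supp}(\mu)$ and $s_+=\sup\operatorname{supp}(\mu)$, one has $\nu((-\infty,s_-])>0$ and $\nu([s_+,\infty))>0$. *)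

theory Defs
  imports "HOL-Probability.Probability"
begin

text \<open>Couplings of two Borel probability measures on the reals, as Borel measures on
  the product (note borel on real*real is the product sigma algebra).\<close>
definition coupling :: "real measure \<Rightarrow> real measure \<Rightarrow> (real \<times> real) measure \<Rightarrow> bool" where
  "coupling \<mu> \<nu> \<pi> \<longleftrightarrow> sets \<pi> = sets borel \<and>
     distr \<pi> borel fst = \<mu> \<and> distr \<pi> borel snd = \<nu>"

definition disintegration :: "real measure \<Rightarrow> (real \<times> real) measure \<Rightarrow> (real \<Rightarrow> real measure) \<Rightarrow> bool" where
  "disintegration \<mu> \<pi> K \<longleftrightarrow> K \<in> borel \<rightarrow>\<^sub>M prob_algebra borel \<and>
     \<pi> = \<mu> \<bind> (\<lambda>x. distr (K x) (borel :: (real \<times> real) measure) (\<lambda>y. (x, y)))"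

definition martingale_coupling :: "real measure \<Rightarrow> real measure \<Rightarrow> (real \<times> real) measure \<Rightarrow> bool" where
  "martingale_coupling \<mu> \<nu> \<pi> \<longleftrightarrow> coupling \<mu> \<nu> \<pi> \<and>
     (\<exists>K. disintegration \<mu> \<pi> K \<and>
        (AE x in \<mu>. integrable (K x) (\<lambda>y. y - x) \<and> (\<integral>y. (y - x) \<partial>K x) = 0))"

text \<open>Relative entropy H(pi|R) in [0,inf]: the integral of log(dpi/dR) w.r.t. pi if
  pi << R (for probability measures the negative part of the integrand is always
  integrable, so the value is +inf exactly when the integrand is not integrable),
  and +inf otherwise.\<close>
definition rel_entropy :: "'a measure \<Rightarrow> 'a measure \<Rightarrow> ereal" where
  "rel_entropy \<pi> R =
     (if absolutely_continuous R \<pi> \<and> integrable \<pi> (\<lambda>z. ln (enn2real (RN_deriv R \<pi> z)))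
      then ereal (\<integral>z. ln (enn2real (RN_deriv R \<pi> z)) \<partial>\<pi>) else \<infinity>)"

definition Mfin :: "real measure \<Rightarrow> real measure \<Rightarrow> (real \<times> real) measure set" where
  "Mfin \<mu> \<nu> = {\<pi>. martingale_coupling \<mu> \<nu> \<pi> \<and> rel_entropy \<pi> (\<mu> \<Otimes>\<^sub>M \<nu>) < \<infinity>}"

text \<open>Convex order: int phi dmu <= int phi dnu in (-inf, inf] for every convex phi.
  Under finite first moments the negative parts are integrable, so this says:
  whenever phi is nu-integrable it is mu-integrable with smaller integral.\<close>
definition convex_order :: "real measure \<Rightarrow> real measure \<Rightarrow> bool" where
  "convex_order \<mu> \<nu> \<longleftrightarrow> (\<forall>\<phi>::real \<Rightarrow> real. convex_on UNIV \<phi> \<longrightarrow>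
     integrable \<nu> \<phi> \<longrightarrow> integrable \<mu> \<phi> \<and> integral\<^sup>L \<mu> \<phi> \<le> integral\<^sup>L \<nu> \<phi>)"

definition measure_support :: "real measure \<Rightarrow> real set" where
  "measure_support \<mu> = {x. \<forall>e>0. emeasure \<mu> (ball x e) > 0}"

definition assumptionA :: "real measure \<Rightarrow> real measure \<Rightarrow> bool" where
  "assumptionA \<mu> \<nu> \<longleftrightarrow> (\<exists>\<pi>. martingale_coupling \<mu> \<nu> \<pi> \<and>
      absolutely_continuous (\<mu> \<Otimes>\<^sub>M \<nu>) \<pi> \<and> absolutely_continuous \<pi> (\<mu> \<Otimes>\<^sub>M \<nu>) \<and>
      rel_entropy \<pi> (\<mu> \<Otimes>\<^sub>M \<nu>) < \<infinity>)"

definition assumptionB :: "real measure \<Rightarrow> real measure \<Rightarrow> bool" where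
  "assumptionB \<mu> \<nu> \<longleftrightarrow>
     (let sm = Inf (ereal ` measure_support \<mu>); sp = Sup (ereal ` measure_support \<mu>) in
      emeasure \<nu> {y. ereal y \<le> sm} > 0 \<and> emeasure \<nu> {y. sp \<le> ereal y} > 0)"

definition optimizer :: "real measure \<Rightarrow> real measure \<Rightarrow> (real \<times> real) measure \<Rightarrow> bool" where
  "optimizer \<mu> \<nu> \<pi> \<longleftrightarrow> martingale_coupling \<mu> \<nu> \<pi> \<and>
     (\<forall>\<pi>'. martingale_coupling \<mu> \<nu> \<pi>' \<longrightarrow> rel_entropy \<pi> (\<mu> \<Otimes>\<^sub>M \<nu>) \<le> rel_entropy \<pi>' (\<mu> \<Otimes>\<^sub>M \<nu>))"

definition potentials :: "real measure \<Rightarrow> real measure \<Rightarrow> (real \<times> real) measure \<Rightarrow>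
    (real \<Rightarrow> real) \<Rightarrow> (real \<Rightarrow> real) \<Rightarrow> (real \<Rightarrow> real) \<Rightarrow> bool" where
  "potentials \<mu> \<nu> \<pi> f g h \<longleftrightarrow>
     f \<in> borel_measurable borel \<and> integrable \<mu> f \<and>
     g \<in> borel_measurable borel \<and> integrable \<nu> g \<and>
     h \<in> borel_measurable borel \<and>
     (\<forall>\<pi>'\<in>Mfin \<mu> \<nu>. integrable \<pi>' (\<lambda>(x, y). h x * (y - x))) \<and>
     \<pi> = density (\<mu> \<Otimes>\<^sub>M \<nu>) (\<lambda>(x, y). ennreal (exp (f x + g y - h x * (y - x))))"

end

(* Write R for the product of mu and nu. Existence: by the parallelogram identity for the entropy a
   minimizing sequence of densities is Cauchy in L1(R); the martingale constraint survives the limit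
   by Scheffe's lemma, because the second marginal is fixed. Comparison with the density from
   Assumption A shows that the optimal density Z is positive R-a.e.

   Potentials: put L = ln Z. Moving mass between (x0,yi) and (x,yi), i = 1,2,3, with weights lambda_i
   such that sum lambda_i = 0 and sum lambda_i yi = 0 respects all constraints, so optimality forces
   sum lambda_i (L(x,yi) - L(x0,yi)) = 0 almost everywhere. Hence L(x,y) - L(x0,y) is affine in y with
   coefficients depending on x, which is the claimed form with g = L(x0,.).

   Integrability: the second marginal constraint bounds g above by a function of linear growth, and
   Assumption B bounds f above. Conditionally on x the martingale part integrates to zero, so the
   finite entropy turns the upper bound on each of f and g into a lower bound on the other. *)
theory Submission
  imports Defs
begin

section \<open>Couplings with a density\<close>

text \<open>A move between finitely many points is invisible to a measure, so the perturbation is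
  randomized: two x-points, three y-points and a bounded weight function of them are used, and the
  resulting signed mass is pushed forward to a density against R. Three y-points are the least
  number, because for two distinct points the two conditions on the lambda_i force zero weights. The
  obstacle is admissibility: the perturbed density has to stay nonnegative and of finite entropy.
  Confining all six corners to a region where Z lies between 1/n and n makes the perturbation at
  most a multiple of Z; letting n grow then recovers almost every configuration. Limits along the
  segment from Z to a competitor q are taken by Fatou's lemma: convexity of u ln u bounds the
  difference quotients from one side and minimality controls their integrals. This yields
  integrability of q ln Z for every competitor q of finite entropy, and from it the integrability of
  h(x)(y - x) under all these couplings.\<close>

lemma sets_borel_pair:
  "sets (borel \<Otimes>\<^sub>M borel) = sets (borel :: (real \<times> real) measure)"
  by (rule arg_cong[OF borel_prod])

lemma measurable_borel_pair:
  "borel_measurable (borel \<Otimes>\<^sub>M borel) = borel_measurable (borel :: (real \<times> real) measure)"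
  by (rule measurable_cong_sets[OF sets_borel_pair refl])

section \<open>The two marginals and their product as reference measure\<close>

locale marginals =
  fixes \<mu> \<nu> :: "real measure"
  assumes prob_mu: "prob_space \<mu>" and prob_nu: "prob_space \<nu>"
    and sets_mu [measurable_cong]: "sets \<mu> = sets borel"
    and sets_nu [measurable_cong]: "sets \<nu> = sets borel"
    and integrable_mu: "integrable \<mu> (\<lambda>x. x)"
    and integrable_nu: "integrable \<nu> (\<lambda>y. y)"
begin

abbreviation R :: "(real \<times> real) measure" where "R \<equiv> \<mu> \<Otimes>\<^sub>M \<nu>"

sublocale M: prob_space \<mu> by (rule prob_mu)
sublocale N: prob_space \<nu> by (rule prob_nu)
sublocale pair_sigma_finite \<mu> \<nu> ..
sublocale R: prob_space R
  by (intro prob_space_pair prob_mu prob_nu)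

lemma space_mu [simp]: "space \<mu> = UNIV"
  using sets_eq_imp_space_eq[OF sets_mu] by simp

lemma space_nu [simp]: "space \<nu> = UNIV"
  using sets_eq_imp_space_eq[OF sets_nu] by simp

lemma prob_UNIV [simp]: "measure \<mu> UNIV = 1" "measure \<nu> UNIV = 1" "measure R UNIV = 1"
  using M.prob_space N.prob_space R.prob_space by (simp_all add: space_pair_measure)

lemma sets_R: "sets R = sets borel"
  using sets_pair_measure_cong[OF sets_mu sets_nu] by (simp add: sets_borel_pair)

lemma space_R [simp]: "space R = UNIV"
  by (simp add: space_pair_measure)

text \<open>The kernel conditions are encoded as integrals against indicators, so that each
  constraint is linear in \<open>q\<close>; convex combinations, small perturbations and L1 limits
  can then be checked without choosing a disintegration. Nonnegativity is demanded at every point,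
  so that inequalities for u ln u apply pointwise.\<close>

definition mdens :: "(real \<times> real \<Rightarrow> real) \<Rightarrow> bool" where
  "mdens q \<longleftrightarrow> q \<in> borel_measurable (borel \<Otimes>\<^sub>M borel) \<and> (\<forall>z. 0 \<le> q z) \<and> integrable R q \<and>
     (\<forall>A\<in>sets borel. (\<integral>z. indicator A (fst z) * q z \<partial>R) = measure \<mu> A) \<and>
     (\<forall>B\<in>sets borel. (\<integral>z. indicator B (snd z) * q z \<partial>R) = measure \<nu> B) \<and>
     (\<forall>A\<in>sets borel. (\<integral>z. indicator A (fst z) * ((snd z - fst z) * q z) \<partial>R) = 0)"

lemma mdensD:
  assumes "mdens q"
  shows mdens_measurable: "q \<in> borel_measurable (borel \<Otimes>\<^sub>M borel)"
    and mdens_nonneg: "0 \<le> q z" and mdens_integrable: "integrable R q"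
  using assms unfolding mdens_def by blast+

lemma mdens_indicator:
  assumes "mdens q" "A \<in> sets borel"
  shows mdens_fst_indicator: "(\<integral>z. indicator A (fst z) * q z \<partial>R) = measure \<mu> A"
    and mdens_snd_indicator: "(\<integral>z. indicator A (snd z) * q z \<partial>R) = measure \<nu> A"
    and mdens_martingale_indicator: "(\<integral>z. indicator A (fst z) * ((snd z - fst z) * q z) \<partial>R) = 0"
  using assms unfolding mdens_def by blast+

section \<open>Marginal and conditional integrals of densities\<close>

lemma coupling_density:
  assumes q [measurable]: "q \<in> borel_measurable (borel \<Otimes>\<^sub>M borel)"
    and nn: "\<And>z. 0 \<le> q z" and int: "integrable R q"
    and "\<And>A. A \<in> sets borel \<Longrightarrow> (\<integral>z. indicator A (fst z) * q z \<partial>R) = measure \<mu> A"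
    and "\<And>B. B \<in> sets borel \<Longrightarrow> (\<integral>z. indicator B (snd z) * q z \<partial>R) = measure \<nu> B"
  shows "coupling \<mu> \<nu> (density R (\<lambda>z. ennreal (q z)))"
proof -
  have pair: "emeasure (distr (density R (\<lambda>z. ennreal (q z))) borel T) A
      = ennreal (\<integral>z. indicator A (T z) * q z \<partial>R)"
    if T [measurable]: "T \<in> borel \<Otimes>\<^sub>M borel \<rightarrow>\<^sub>M borel" and A [measurable]: "A \<in> sets borel"
    for T :: "real \<times> real \<Rightarrow> real" and A
  proof -
    have "T -` A \<in> sets R"
      using measurable_sets[OF T A] by (simp add: space_pair_measure sets_R sets_borel_pair)
    then have "emeasure (distr (density R (\<lambda>z. ennreal (q z))) borel T) A
        = (\<integral>\<^sup>+z. ennreal (q z) * indicator (T -` A) z \<partial>R)"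
      by (subst emeasure_distr) (auto simp: emeasure_density)
    also have "\<dots> = (\<integral>\<^sup>+z. ennreal (indicator A (T z) * q z) \<partial>R)"
      by (intro nn_integral_cong) (auto simp: indicator_def)
    also have "\<dots> = ennreal (\<integral>z. indicator A (T z) * q z \<partial>R)"
      by (intro nn_integral_eq_integral Bochner_Integration.integrable_bound[OF int])
        (auto simp: indicator_def nn)
    finally show ?thesis .
  qed
  have "distr (density R (\<lambda>z. ennreal (q z))) borel fst = \<mu>"
    by (rule measure_eqI) (auto simp: pair sets_mu assms M.emeasure_eq_measure)
  moreover have "distr (density R (\<lambda>z. ennreal (q z))) borel snd = \<nu>"
    by (rule measure_eqI) (auto simp: pair sets_nu assms N.emeasure_eq_measure)
  ultimately show ?thesis
    by (simp add: coupling_def sets_R)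
qed

lemma coupling_fst:
  fixes \<phi> :: "real \<Rightarrow> real"
  assumes "coupling \<mu> \<nu> \<pi>" and [measurable]: "\<phi> \<in> borel_measurable borel"
  shows "integrable \<pi> (\<lambda>z. \<phi> (fst z)) \<longleftrightarrow> integrable \<mu> \<phi>"
    and "(\<integral>z. \<phi> (fst z) \<partial>\<pi>) = (\<integral>x. \<phi> x \<partial>\<mu>)"
proof -
  have [measurable_cong]: "sets \<pi> = sets (borel \<Otimes>\<^sub>M borel)" and d: "\<mu> = distr \<pi> borel fst"
    using assms by (auto simp: coupling_def sets_borel_pair)
  have 1: "fst \<in> \<pi> \<rightarrow>\<^sub>M borel" by measurable
  show "integrable \<pi> (\<lambda>z. \<phi> (fst z)) \<longleftrightarrow> integrable \<mu> \<phi>"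
    unfolding d by (subst integrable_distr_eq[OF 1]) auto
  show "(\<integral>z. \<phi> (fst z) \<partial>\<pi>) = (\<integral>x. \<phi> x \<partial>\<mu>)"
    unfolding d by (subst integral_distr[OF 1]) auto
qed

lemma coupling_snd:
  fixes \<phi> :: "real \<Rightarrow> real"
  assumes "coupling \<mu> \<nu> \<pi>" and [measurable]: "\<phi> \<in> borel_measurable borel"
  shows "integrable \<pi> (\<lambda>z. \<phi> (snd z)) \<longleftrightarrow> integrable \<nu> \<phi>"
    and "(\<integral>z. \<phi> (snd z) \<partial>\<pi>) = (\<integral>y. \<phi> y \<partial>\<nu>)"
proof -
  have [measurable_cong]: "sets \<pi> = sets (borel \<Otimes>\<^sub>M borel)" and d: "\<nu> = distr \<pi> borel snd"
    using assms by (auto simp: coupling_def sets_borel_pair)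
  have 1: "snd \<in> \<pi> \<rightarrow>\<^sub>M borel" by measurable
  show "integrable \<pi> (\<lambda>z. \<phi> (snd z)) \<longleftrightarrow> integrable \<nu> \<phi>"
    unfolding d by (subst integrable_distr_eq[OF 1]) auto
  show "(\<integral>z. \<phi> (snd z) \<partial>\<pi>) = (\<integral>y. \<phi> y \<partial>\<nu>)"
    unfolding d by (subst integral_distr[OF 1]) auto
qed

lemma mdens_coupling: "mdens q \<Longrightarrow> coupling \<mu> \<nu> (density R (\<lambda>z. ennreal (q z)))"
  unfolding mdens_def by (intro coupling_density) blast+

lemma integrable_density_R:
  fixes \<phi> :: "_ \<Rightarrow> real"
  assumes [measurable]: "q \<in> borel_measurable (borel \<Otimes>\<^sub>M borel)" "\<phi> \<in> borel_measurable (borel \<Otimes>\<^sub>M borel)"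
    and "\<And>z. 0 \<le> q z"
  shows "integrable (density R (\<lambda>z. ennreal (q z))) \<phi> \<longleftrightarrow> integrable R (\<lambda>z. \<phi> z * q z)"
    and "(\<integral>z. \<phi> z \<partial>density R (\<lambda>z. ennreal (q z))) = (\<integral>z. \<phi> z * q z \<partial>R)"
proof -
  show "integrable (density R (\<lambda>z. ennreal (q z))) \<phi> \<longleftrightarrow> integrable R (\<lambda>z. \<phi> z * q z)"
    by (subst integrable_density) (use assms(3) in \<open>auto simp: mult.commute\<close>)
  show "(\<integral>z. \<phi> z \<partial>density R (\<lambda>z. ennreal (q z))) = (\<integral>z. \<phi> z * q z \<partial>R)"
    by (subst integral_density) (use assms(3) in \<open>auto simp: mult.commute\<close>)
qed

text \<open>Assumes a coupling instead of \<open>mdens\<close>: in \<open>mdens_limit\<close> the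
  moments of the limit density are wanted before its martingale constraint is known.\<close>

lemma coupling_density_fst:
  fixes \<phi> :: "real \<Rightarrow> real"
  assumes [measurable]: "q \<in> borel_measurable (borel \<Otimes>\<^sub>M borel)" and nn: "\<And>z. 0 \<le> q z"
    and cp: "coupling \<mu> \<nu> (density R (\<lambda>z. ennreal (q z)))"
    and \<phi> [measurable]: "\<phi> \<in> borel_measurable borel"
  shows "integrable R (\<lambda>z. \<phi> (fst z) * q z) \<longleftrightarrow> integrable \<mu> \<phi>"
    and "(\<integral>z. \<phi> (fst z) * q z \<partial>R) = (\<integral>x. \<phi> x \<partial>\<mu>)"
proof -
  have D: "integrable (density R (\<lambda>z. ennreal (q z))) (\<lambda>z. \<phi> (fst z)) \<longleftrightarrow> integrable R (\<lambda>z. \<phi> (fst z) * q z)"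
    "(\<integral>z. \<phi> (fst z) \<partial>density R (\<lambda>z. ennreal (q z))) = (\<integral>z. \<phi> (fst z) * q z \<partial>R)"
    by (rule integrable_density_R; use nn in simp)+
  note C = coupling_fst[OF cp \<phi>]
  show "integrable R (\<lambda>z. \<phi> (fst z) * q z) \<longleftrightarrow> integrable \<mu> \<phi>"
    using D(1) C(1) by (rule trans[OF sym])
  show "(\<integral>z. \<phi> (fst z) * q z \<partial>R) = (\<integral>x. \<phi> x \<partial>\<mu>)"
    using D(2) C(2) by (rule trans[OF sym])
qed

lemma mdens_fst:
  fixes \<phi> :: "real \<Rightarrow> real"
  assumes "mdens q" and [measurable]: "\<phi> \<in> borel_measurable borel"
  shows "integrable R (\<lambda>z. \<phi> (fst z) * q z) \<longleftrightarrow> integrable \<mu> \<phi>"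
    and "(\<integral>z. \<phi> (fst z) * q z \<partial>R) = (\<integral>x. \<phi> x \<partial>\<mu>)"
  using coupling_density_fst[OF mdens_measurable[OF assms(1)] mdens_nonneg[OF assms(1)]
      mdens_coupling[OF assms(1)] assms(2)] by blast+

lemma coupling_density_snd:
  fixes \<phi> :: "real \<Rightarrow> real"
  assumes [measurable]: "q \<in> borel_measurable (borel \<Otimes>\<^sub>M borel)" and nn: "\<And>z. 0 \<le> q z"
    and cp: "coupling \<mu> \<nu> (density R (\<lambda>z. ennreal (q z)))"
    and \<phi> [measurable]: "\<phi> \<in> borel_measurable borel"
  shows "integrable R (\<lambda>z. \<phi> (snd z) * q z) \<longleftrightarrow> integrable \<nu> \<phi>"
    and "(\<integral>z. \<phi> (snd z) * q z \<partial>R) = (\<integral>y. \<phi> y \<partial>\<nu>)"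
proof -
  have D: "integrable (density R (\<lambda>z. ennreal (q z))) (\<lambda>z. \<phi> (snd z)) \<longleftrightarrow> integrable R (\<lambda>z. \<phi> (snd z) * q z)"
    "(\<integral>z. \<phi> (snd z) \<partial>density R (\<lambda>z. ennreal (q z))) = (\<integral>z. \<phi> (snd z) * q z \<partial>R)"
    by (rule integrable_density_R; use nn in simp)+
  note C = coupling_snd[OF cp \<phi>]
  show "integrable R (\<lambda>z. \<phi> (snd z) * q z) \<longleftrightarrow> integrable \<nu> \<phi>"
    using D(1) C(1) by (rule trans[OF sym])
  show "(\<integral>z. \<phi> (snd z) * q z \<partial>R) = (\<integral>x. \<phi> x \<partial>\<nu>)"
    using D(2) C(2) by (rule trans[OF sym])
qed

lemma mdens_snd:
  fixes \<phi> :: "real \<Rightarrow> real"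
  assumes "mdens q" and [measurable]: "\<phi> \<in> borel_measurable borel"
  shows "integrable R (\<lambda>z. \<phi> (snd z) * q z) \<longleftrightarrow> integrable \<nu> \<phi>"
    and "(\<integral>z. \<phi> (snd z) * q z \<partial>R) = (\<integral>y. \<phi> y \<partial>\<nu>)"
  using coupling_density_snd[OF mdens_measurable[OF assms(1)] mdens_nonneg[OF assms(1)]
      mdens_coupling[OF assms(1)] assms(2)] by blast+

lemma mdens_total: "mdens q \<Longrightarrow> (\<integral>z. q z \<partial>R) = 1"
  using mdens_fst(2)[of q "\<lambda>_. 1"] by simp

lemma mdens_integrable_increment:
  assumes "mdens q" shows "integrable R (\<lambda>z. (snd z - fst z) * q z)"
proof -
  have idm: "(\<lambda>x :: real. x) \<in> borel_measurable borel" by measurable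
  have "integrable R (\<lambda>z. snd z * q z - fst z * q z)"
    by (intro Bochner_Integration.integrable_diff iffD2[OF mdens_fst(1)[OF assms]]
        iffD2[OF mdens_snd(1)[OF assms]] integrable_mu integrable_nu idm)
  then show ?thesis by (simp add: left_diff_distrib)
qed

text \<open>By Fubini the indicator tests give the conditional integral and the constant 1 the same
  integral over every Borel set, which identifies them almost everywhere. The next two lemmas argue
  in the same way.\<close>

lemma mdens_AE_fst:
  assumes q: "mdens q"
  shows "AE x in \<mu>. integrable \<nu> (\<lambda>y. q (x, y)) \<and> (\<integral>y. q (x, y) \<partial>\<nu>) = 1"
proof -
  note [measurable] = mdens_measurable[OF q]
  have "AE x in \<mu>. (\<integral>y. q (x, y) \<partial>\<nu>) = 1"
  proof (rule density_unique_real)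
    show "integrable \<mu> (\<lambda>x. \<integral>y. q (x, y) \<partial>\<nu>)"
      by (intro integrable_fst' mdens_integrable q)
    fix A assume "A \<in> sets \<mu>" then have [measurable]: "A \<in> sets borel" by (simp add: sets_mu)
    have "integrable R (\<lambda>z. indicator A (fst z) * q z)"
      by (rule Bochner_Integration.integrable_bound[OF mdens_integrable[OF q]])
        (auto simp: indicator_def)
    from integral_fst'[OF this]
    have "(\<integral>x\<in>A. (\<integral>y. q (x, y) \<partial>\<nu>) \<partial>\<mu>) = (\<integral>z. indicator A (fst z) * q z \<partial>R)"
      by (simp add: set_lebesgue_integral_def)
    also have "\<dots> = measure \<mu> A" using q by (auto simp: mdens_def)
    finally show "(\<integral>x\<in>A. (\<integral>y. q (x, y) \<partial>\<nu>) \<partial>\<mu>) = (\<integral>x\<in>A. 1 \<partial>\<mu>)"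
      by (simp add: set_lebesgue_integral_def)
  qed simp
  with AE_integrable_fst'[OF mdens_integrable[OF q]] show ?thesis by auto
qed

lemma mdens_AE_snd:
  assumes q: "mdens q"
  shows "AE y in \<nu>. integrable \<mu> (\<lambda>x. q (x, y)) \<and> (\<integral>x. q (x, y) \<partial>\<mu>) = 1"
proof -
  note [measurable] = mdens_measurable[OF q]
  have i: "integrable R (case_prod (\<lambda>x y. q (x, y)))"
    using mdens_integrable[OF q] by simp
  have "AE y in \<nu>. (\<integral>x. q (x, y) \<partial>\<mu>) = 1"
  proof (rule density_unique_real)
    show "integrable \<nu> (\<lambda>y. \<integral>x. q (x, y) \<partial>\<mu>)"
      by (rule integrable_snd[OF i])
    fix A assume "A \<in> sets \<nu>" then have [measurable]: "A \<in> sets borel" by (simp add: sets_nu)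
    have "integrable R (case_prod (\<lambda>x y. indicator A y * q (x, y)))"
      by (rule Bochner_Integration.integrable_bound[OF mdens_integrable[OF q]])
        (auto simp: indicator_def split: prod.splits)
    from integral_snd[OF this]
    have "(\<integral>y\<in>A. (\<integral>x. q (x, y) \<partial>\<mu>) \<partial>\<nu>) = (\<integral>z. indicator A (snd z) * q z \<partial>R)"
      by (simp add: set_lebesgue_integral_def case_prod_unfold)
    also have "\<dots> = measure \<nu> A" using q by (auto simp: mdens_def)
    finally show "(\<integral>y\<in>A. (\<integral>x. q (x, y) \<partial>\<mu>) \<partial>\<nu>) = (\<integral>y\<in>A. 1 \<partial>\<nu>)"
      by (simp add: set_lebesgue_integral_def)
  qed simp
  with AE_integrable_snd[OF i] show ?thesis by auto
qed

lemma mdens_AE_martingale: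
  assumes q: "mdens q"
  shows "AE x in \<mu>. integrable \<nu> (\<lambda>y. (y - x) * q (x, y)) \<and> (\<integral>y. (y - x) * q (x, y) \<partial>\<nu>) = 0"
proof -
  note [measurable] = mdens_measurable[OF q]
  note i = mdens_integrable_increment[OF q]
  have "AE x in \<mu>. (\<integral>y. (y - x) * q (x, y) \<partial>\<nu>) = 0"
  proof (rule M.density_zero)
    show "integrable \<mu> (\<lambda>x. \<integral>y. (y - x) * q (x, y) \<partial>\<nu>)"
      using integrable_fst'[OF i] by simp
    fix A assume "A \<in> sets \<mu>" then have [measurable]: "A \<in> sets borel" by (simp add: sets_mu)
    have "integrable R (\<lambda>z. indicator A (fst z) * ((snd z - fst z) * q z))"
      by (rule Bochner_Integration.integrable_bound[OF i])
        (auto simp: indicator_def)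
    from integral_fst'[OF this]
    have "(\<integral>x\<in>A. (\<integral>y. (y - x) * q (x, y) \<partial>\<nu>) \<partial>\<mu>)
        = (\<integral>z. indicator A (fst z) * ((snd z - fst z) * q z) \<partial>R)"
      by (simp add: set_lebesgue_integral_def)
    also have "\<dots> = 0" using q by (auto simp: mdens_def)
    finally show "(\<integral>x\<in>A. (\<integral>y. (y - x) * q (x, y) \<partial>\<nu>) \<partial>\<mu>) = 0" .
  qed
  with AE_integrable_fst'[OF i] show ?thesis by auto
qed

section \<open>Passing between densities and martingale kernels\<close>

lemma mdens_martingale_coupling:
  assumes q: "mdens q"
  shows "martingale_coupling \<mu> \<nu> (density R (\<lambda>z. ennreal (q z)))"
proof -
  note [measurable] = mdens_measurable[OF q]
  \<comment> \<open>A disintegration needs a probability measure at every x, whereas q (x, .)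
    integrates to 1 only almost everywhere; outside \<open>G\<close> the kernel is set to
    \<nu>.\<close>
  define G where "G = {x. (\<integral>\<^sup>+y. ennreal (q (x, y)) \<partial>\<nu>) = 1}"
  define K where "K x = (if x \<in> G then density \<nu> (\<lambda>y. ennreal (q (x, y))) else \<nu>)" for x
  have G [measurable]: "G \<in> sets borel" unfolding G_def by measurable
  have sK: "sets (K x) = sets borel" for x by (simp add: K_def sets_nu)
  have Pair_K: "(\<lambda>y. (x, y)) \<in> K x \<rightarrow>\<^sub>M (borel :: (real \<times> real) measure)" for x
    unfolding borel_prod[symmetric] measurable_cong_sets[OF sK refl] by measurable
  have pK: "prob_space (K x)" for x
    by (auto simp: K_def prob_nu G_def emeasure_density intro!: prob_spaceI)
  have AEG: "AE x in \<mu>. x \<in> G"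
    using mdens_AE_fst[OF q]
    by eventually_elim (auto simp: G_def nn_integral_eq_integral mdens_nonneg[OF q])
  have Kprob: "K \<in> borel \<rightarrow>\<^sub>M prob_algebra borel"
  proof (intro measurable_prob_algebraI measurable_subprob_algebra)
    fix A :: "real set" assume [measurable]: "A \<in> sets borel"
    have "emeasure (K x) A = (if x \<in> G then \<integral>\<^sup>+y. ennreal (q (x, y)) * indicator A y \<partial>\<nu> else emeasure \<nu> A)" for x
      by (simp add: K_def emeasure_density)
    then show "(\<lambda>x. emeasure (K x) A) \<in> borel_measurable borel" by simp
  qed (auto simp: pK sK intro: prob_space_imp_subprob_space)
  have bind_measurable: "(\<lambda>x. distr (K x) (borel :: (real \<times> real) measure) (\<lambda>y. (x, y)))
      \<in> borel \<rightarrow>\<^sub>M subprob_algebra borel"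
    unfolding borel_prod[symmetric]
    by (intro measurable_distr2[where M=borel] measurable_prob_algebraD Kprob) measurable
  have "density R (\<lambda>z. ennreal (q z)) = \<mu> \<bind> (\<lambda>x. distr (K x) borel (\<lambda>y. (x, y)))" (is "?L = ?R")
  proof (rule measure_eqI)
    have bm: "(\<lambda>x. distr (K x) (borel :: (real \<times> real) measure) (\<lambda>y. (x, y))) \<in> \<mu> \<rightarrow>\<^sub>M subprob_algebra borel"
      using bind_measurable by (simp cong: measurable_cong_sets add: sets_mu)
    show "sets ?L = sets ?R"
      using sets_bind_measurable[OF bm] by (simp add: sets_R)
    fix A assume "A \<in> sets ?L"
    then have [measurable]: "A \<in> sets (borel \<Otimes>\<^sub>M borel)" and A: "A \<in> sets borel"
      by (simp_all add: sets_R sets_borel_pair)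
    have "emeasure ?L A = (\<integral>\<^sup>+z. ennreal (q z) * indicator A z \<partial>R)"
      by (rule emeasure_density) (auto simp: sets_R A)
    also have "\<dots> = (\<integral>\<^sup>+x. \<integral>\<^sup>+y. ennreal (q (x, y)) * indicator A (x, y) \<partial>\<nu> \<partial>\<mu>)"
      by (subst N.nn_integral_fst[symmetric]) auto
    also have "\<dots> = (\<integral>\<^sup>+x. emeasure (distr (K x) borel (\<lambda>y. (x, y))) A \<partial>\<mu>)"
    proof (rule nn_integral_cong_AE)
      show "AE x in \<mu>. (\<integral>\<^sup>+y. ennreal (q (x, y)) * indicator A (x, y) \<partial>\<nu>)
          = emeasure (distr (K x) borel (\<lambda>y. (x, y))) A"
        using AEG
      proof eventually_elim
        fix x assume x: "x \<in> G"
        have "emeasure (distr (K x) borel (\<lambda>y. (x, y))) A = emeasure (K x) ((\<lambda>y. (x, y)) -` A)"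
          using sets_eq_imp_space_eq[OF sK[of x]]
          by (subst emeasure_distr[OF Pair_K A]) simp
        also have "\<dots> = (\<integral>\<^sup>+y. ennreal (q (x, y)) * indicator A (x, y) \<partial>\<nu>)"
        proof -
          have "(\<lambda>y. (x, y)) -` A \<in> sets \<nu>"
            using sets_Pair1[OF \<open>A \<in> sets (borel \<Otimes>\<^sub>M borel)\<close>, of x] by (simp only: sets_nu)
          then have "emeasure (density \<nu> (\<lambda>y. ennreal (q (x, y)))) ((\<lambda>y. (x, y)) -` A)
              = (\<integral>\<^sup>+y. ennreal (q (x, y)) * indicator ((\<lambda>y. (x, y)) -` A) y \<partial>\<nu>)"
            by (intro emeasure_density) measurable
          moreover have "indicator ((\<lambda>y. (x, y)) -` A) y = (indicator A (x, y) :: ennreal)" for y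
            by (simp add: indicator_def)
          ultimately show ?thesis by (simp only: K_def if_P[OF x])
        qed
        finally show "(\<integral>\<^sup>+y. ennreal (q (x, y)) * indicator A (x, y) \<partial>\<nu>)
          = emeasure (distr (K x) borel (\<lambda>y. (x, y))) A" ..
      qed
    qed
    also have "\<dots> = emeasure ?R A"
      by (rule emeasure_bind[OF _ bm A, symmetric]) simp
    finally show "emeasure ?L A = emeasure ?R A" .
  qed
  moreover have "AE x in \<mu>. integrable (K x) (\<lambda>y. y - x) \<and> (\<integral>y. (y - x) \<partial>K x) = 0"
    using AEG mdens_AE_martingale[OF q]
    by eventually_elim
      (auto simp: K_def integrable_density integral_density mdens_nonneg[OF q] mult.commute)
  ultimately show ?thesis
    unfolding martingale_coupling_def disintegration_def
    using mdens_coupling[OF q] Kprob by blast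
qed

lemma martingale_coupling_mdens:
  assumes mc: "martingale_coupling \<mu> \<nu> \<pi>" and ac: "absolutely_continuous R \<pi>"
  obtains q where "mdens q" "\<pi> = density R (\<lambda>z. ennreal (q z))"
proof -
  have cp: "coupling \<mu> \<nu> \<pi>" using mc by (simp add: martingale_coupling_def)
  then have s\<pi>: "sets \<pi> = sets R" by (simp add: coupling_def sets_R)
  have [measurable_cong]: "sets \<pi> = sets (borel \<Otimes>\<^sub>M borel)"
    by (simp add: s\<pi> sets_R sets_borel_pair)
  have "prob_space \<pi>"
  proof (rule prob_space_distrD)
    show "fst \<in> \<pi> \<rightarrow>\<^sub>M borel" by measurable
    show "prob_space (distr \<pi> borel fst)" using cp prob_mu by (simp add: coupling_def)
  qed
  then interpret Q: prob_space \<pi> .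
  obtain q where q [measurable]: "q \<in> borel_measurable R" and nn: "\<And>z. 0 \<le> q z"
    and dens: "density R (\<lambda>z. ennreal (q z)) = \<pi>"
  proof -
    \<comment> \<open>\<pi> is finite, so its Radon-Nikodym derivative is finite almost everywhere
      and can be replaced by a real-valued version.\<close>
    have "AE z in R. RN_deriv R \<pi> z \<noteq> \<infinity>"
      by (rule P.RN_deriv_finite[OF _ ac s\<pi>]) unfold_locales
    moreover have "density R (RN_deriv R \<pi>) = \<pi>" by (rule P.density_RN_deriv[OF ac s\<pi>])
    ultimately have "density R (\<lambda>z. ennreal (enn2real (RN_deriv R \<pi> z))) = \<pi>"
      by (subst density_cong[of _ _ "RN_deriv R \<pi>"]) (auto simp: less_top)
    then show ?thesis by (intro that[of "\<lambda>z. enn2real (RN_deriv R \<pi> z)"]) auto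
  qed
  have q' [measurable]: "q \<in> borel_measurable (borel \<Otimes>\<^sub>M borel)"
    using q by (simp cong: measurable_cong_sets add: sets_R sets_borel_pair)
  note D = integrable_density_R[OF q' _ nn, unfolded dens]
  obtain K where K: "K \<in> borel \<rightarrow>\<^sub>M prob_algebra borel"
    and \<pi>: "\<pi> = \<mu> \<bind> (\<lambda>x. distr (K x) (borel :: (real \<times> real) measure) (\<lambda>y. (x, y)))"
    and Kae: "AE x in \<mu>. integrable (K x) (\<lambda>y. y - x) \<and> (\<integral>y. (y - x) \<partial>K x) = 0"
    using mc unfolding martingale_coupling_def disintegration_def by blast
  have "(\<lambda>x. distr (K x) (borel :: (real \<times> real) measure) (\<lambda>y. (x, y)))
      \<in> borel \<rightarrow>\<^sub>M subprob_algebra borel"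
    unfolding borel_prod[symmetric]
    by (intro measurable_distr2[where M=borel] measurable_prob_algebraD K) measurable
  then have bm: "(\<lambda>x. distr (K x) (borel :: (real \<times> real) measure) (\<lambda>y. (x, y))) \<in> \<mu> \<rightarrow>\<^sub>M subprob_algebra borel"
    by (simp cong: measurable_cong_sets add: sets_mu)
  have sK: "sets (K x) = sets borel" for x
    using measurable_space[OF K, of x] by (simp add: space_prob_algebra)
  have nn_bind: "(\<integral>\<^sup>+z. F z \<partial>\<pi>) = (\<integral>\<^sup>+x. \<integral>\<^sup>+y. F (x, y) \<partial>K x \<partial>\<mu>)"
    if F [measurable]: "F \<in> borel_measurable (borel \<Otimes>\<^sub>M borel)" for F
  proof -
    have Pair_K: "(\<lambda>y. (x, y)) \<in> K x \<rightarrow>\<^sub>M (borel :: (real \<times> real) measure)" for x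
      unfolding borel_prod[symmetric] measurable_cong_sets[OF sK refl] by measurable
    have F': "F \<in> borel_measurable borel" using F by (simp add: measurable_borel_pair)
    show ?thesis unfolding \<pi>
      by (subst nn_integral_bind[OF F' bm], intro nn_integral_cong)
        (simp add: nn_integral_distr[OF Pair_K] F')
  qed
  have idm: "(\<lambda>x :: real. x) \<in> borel_measurable borel" by measurable
  have i: "integrable \<pi> (\<lambda>z. snd z - fst z)"
    by (intro Bochner_Integration.integrable_diff iffD2[OF coupling_fst(1)[OF cp]]
        iffD2[OF coupling_snd(1)[OF cp]] integrable_mu integrable_nu idm)
  have "mdens q"
    unfolding mdens_def
  proof (intro conjI ballI allI)
    have "integrable \<pi> (\<lambda>z. 1 :: real)" by simp
    then show "integrable R q" using D(1)[of "\<lambda>_. 1"] by simp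
    fix A :: "real set" assume [measurable]: "A \<in> sets borel"
    show "(\<integral>z. indicator A (fst z) * q z \<partial>R) = measure \<mu> A"
      using coupling_fst(2)[OF cp, of "indicator A"] D(2)[of "\<lambda>z. indicator A (fst z)"] by simp
    show "(\<integral>z. indicator A (snd z) * q z \<partial>R) = measure \<nu> A"
      using coupling_snd(2)[OF cp, of "indicator A"] D(2)[of "\<lambda>z. indicator A (snd z)"] by simp
    let ?F = "\<lambda>z. indicator A (fst z) * (snd z - fst z) :: real"
    have iA: "integrable \<pi> ?F"
      by (rule Bochner_Integration.integrable_bound[OF i]) (auto simp: indicator_def)
    have "(\<integral>\<^sup>+z. ennreal (?F z) \<partial>\<pi>) = (\<integral>\<^sup>+z. ennreal (- ?F z) \<partial>\<pi>)"
    \<comment> \<open>Positive and negative parts are compared separately, because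
      \<open>nn_bind\<close> disintegrates nonnegative integrands; conditionally on x the two parts
      agree, as the conditional increment has mean zero.\<close>
    proof (subst (1 2) nn_bind, simp, simp, rule nn_integral_cong_AE)
      show "AE x in \<mu>. (\<integral>\<^sup>+y. ennreal (?F (x, y)) \<partial>K x) = (\<integral>\<^sup>+y. ennreal (- ?F (x, y)) \<partial>K x)"
        using Kae
      proof eventually_elim
        fix x assume x: "integrable (K x) (\<lambda>y. y - x) \<and> (\<integral>y. (y - x) \<partial>K x) = 0"
        then have "(\<integral>\<^sup>+y. ennreal (y - x) \<partial>K x) = (\<integral>\<^sup>+y. ennreal (- (y - x)) \<partial>K x)"
          (is "?a = ?b")
        proof -
          have "?a \<noteq> \<infinity>" "?b \<noteq> \<infinity>" "enn2real ?a = enn2real ?b"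
            using x real_lebesgue_integral_def[of "K x" "\<lambda>y. y - x"]
            unfolding real_integrable_def by (blast, blast, linarith)
          then show ?thesis
            by (metis ennreal_enn2real infinity_ennreal_def less_top)
        qed
        then show "(\<integral>\<^sup>+y. ennreal (?F (x, y)) \<partial>K x) = (\<integral>\<^sup>+y. ennreal (- ?F (x, y)) \<partial>K x)"
          by (cases "x \<in> A") auto
      qed
    qed
    then have "(\<integral>z. ?F z \<partial>\<pi>) = 0"
      using real_lebesgue_integral_def[OF iA] by simp
    then show "(\<integral>z. indicator A (fst z) * ((snd z - fst z) * q z) \<partial>R) = 0"
      using D(2)[of ?F] by (simp add: mult.assoc)
  qed (use nn in auto)
  with dens show thesis by (intro that) auto
qed

section \<open>Relative entropy as a functional of densities\<close>

definition Ent :: "(real \<times> real \<Rightarrow> real) \<Rightarrow> real" where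
  "Ent q = (\<integral>z. q z * ln (q z) \<partial>R)"

definition fin_ent :: "(real \<times> real \<Rightarrow> real) \<Rightarrow> bool" where
  "fin_ent q \<longleftrightarrow> mdens q \<and> integrable R (\<lambda>z. q z * ln (q z))"

text \<open>\<open>rel_entropy\<close> integrates the logarithm against the coupling itself.
  Absorbing \<open>q\<close> into the integrand gives an integral of u ln u against the fixed
  measure \<open>R\<close>, where convexity can be used.\<close>

lemma rel_entropy_density:
  assumes q: "mdens q"
  shows "rel_entropy (density R (\<lambda>z. ennreal (q z))) R = (if fin_ent q then ereal (Ent q) else \<infinity>)"
proof -
  note [measurable] = mdens_measurable[OF q]
  let ?P = "density R (\<lambda>z. ennreal (q z))"
  have "AE z in R. ennreal (q z) = RN_deriv R ?P z"
    by (rule P.RN_deriv_unique) auto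
  then have RN: "AE z in R. q z = enn2real (RN_deriv R ?P z)"
    by eventually_elim (metis enn2real_ennreal mdens_nonneg[OF q])
  have RNP: "AE z in ?P. q z = enn2real (RN_deriv R ?P z)"
    by (subst AE_density) (use RN in auto)
  have ac: "absolutely_continuous R ?P"
    by (auto intro!: absolutely_continuousI_density)
  have meas: "RN_deriv R ?P \<in> borel_measurable ?P"
    using borel_measurable_RN_deriv[of R ?P] by simp
  have 1: "integrable ?P (\<lambda>z. ln (enn2real (RN_deriv R ?P z))) \<longleftrightarrow> integrable ?P (\<lambda>z. ln (q z))"
    by (rule integrable_cong_AE) (use RNP meas in auto)
  have 2: "(\<integral>z. ln (enn2real (RN_deriv R ?P z)) \<partial>?P) = (\<integral>z. ln (q z) \<partial>?P)"
    by (rule integral_cong_AE) (use RNP meas in auto)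
  have 3: "integrable ?P (\<lambda>z. ln (q z)) \<longleftrightarrow> integrable R (\<lambda>z. q z * ln (q z))"
    "(\<integral>z. ln (q z) \<partial>?P) = Ent q"
    using integrable_density_R[of q "\<lambda>z. ln (q z)"] mdens_nonneg[OF q]
    by (auto simp: Ent_def mult.commute)
  show ?thesis
    unfolding rel_entropy_def 1 2 3 fin_ent_def using ac q by simp
qed

lemma finite_entropy_mdens:
  assumes "martingale_coupling \<mu> \<nu> \<pi>" "rel_entropy \<pi> R < \<infinity>"
  obtains q where "fin_ent q" "\<pi> = density R (\<lambda>z. ennreal (q z))" "rel_entropy \<pi> R = ereal (Ent q)"
proof -
  have "absolutely_continuous R \<pi>"
    using assms(2) by (auto simp: rel_entropy_def split: if_splits)
  with assms(1) obtain q where q: "mdens q" "\<pi> = density R (\<lambda>z. ennreal (q z))"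
    by (rule martingale_coupling_mdens)
  with assms(2) show thesis
    by (intro that[of q]) (auto simp: rel_entropy_density split: if_splits)
qed

end

section \<open>Entropy and its convexity\<close>

text \<open>The left side is the tangent at c, since c ln c + (ln c + 1)(a - c) = a ln c + a - c.
  For a > 0 the claim is ln t \<le> t - 1 at t = c / a, multiplied by a.\<close>

lemma x_ln_x_tangent:
  fixes a c :: real
  assumes "0 \<le> a" "0 < c"
  shows "a * ln c + a - c \<le> a * ln a"
proof (cases "a = 0")
  case False
  then have a: "0 < a" using assms by simp
  have "ln (c / a) \<le> c / a - 1" using a assms by (intro ln_le_minus_one) simp
  then have "a * ln (c / a) \<le> a * (c / a - 1)" using a by (intro mult_left_mono) auto
  moreover have "a * ln (c / a) = a * ln c - a * ln a"
    using a assms by (simp add: ln_div algebra_simps)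
  moreover have "a * (c / a - 1) = c - a" using a by (simp add: field_simps)
  ultimately show ?thesis by linarith
qed (use assms in simp)

lemma x_ln_x_ge: "0 \<le> u \<Longrightarrow> -1 \<le> u * ln u" for u :: real
  using x_ln_x_tangent[of u 1] by simp

text \<open>Taking ln t \<le> t - 1 at t = sqrt (c / a) sharpens the tangent bound by (sqrt a - sqrt
  c)^2. This surplus makes the convexity of the entropy quantitative.\<close>

lemma x_ln_x_tangent_sqrt:
  fixes a c :: real
  assumes "0 \<le> a" "0 < c"
  shows "a * ln c + 2 * a - 2 * (sqrt a * sqrt c) \<le> a * ln a"
proof (cases "a = 0")
  case False
  then have a: "0 < a" using assms by simp
  have "ln (sqrt c / sqrt a) \<le> sqrt c / sqrt a - 1"
    using a assms by (intro ln_le_minus_one) simp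
  then have "(2 * a) * ln (sqrt c / sqrt a) \<le> (2 * a) * (sqrt c / sqrt a - 1)"
    using a by (intro mult_left_mono) auto
  moreover have "(2 * a) * (sqrt c / sqrt a - 1) = 2 * (sqrt a * sqrt c) - 2 * a"
    using a by (simp add: field_simps)
  moreover have "(2 * a) * ln (sqrt c / sqrt a) = a * ln c - a * ln a"
    using a assms by (simp add: ln_div ln_sqrt field_simps)
  ultimately show ?thesis by linarith
qed (use assms in simp)

text \<open>The tangent at c = (1 - t) a + t b lies below the function at a and at b, and the
  weighted sum of its two values is c ln c. If c = 0, both products vanish.\<close>

lemma x_ln_x_convex:
  fixes a b t :: real
  assumes "0 \<le> a" "0 \<le> b" "0 \<le> t" "t \<le> 1"
  shows "((1 - t) * a + t * b) * ln ((1 - t) * a + t * b) \<le> (1 - t) * (a * ln a) + t * (b * ln b)"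
proof (cases "(1 - t) * a + t * b = 0")
  case True
  then have "(1 - t) * a = 0" "t * b = 0"
    using assms by (metis add_nonneg_eq_0_iff diff_ge_0_iff_ge mult_nonneg_nonneg)+
  then show ?thesis using True by auto
next
  case False
  define c where "c = (1 - t) * a + t * b"
  have c: "0 < c" using False assms by (simp add: c_def order_less_le)
  have "(1 - t) * (a * ln c + a - c) + t * (b * ln c + b - c) \<le> (1 - t) * (a * ln a) + t * (b * ln b)"
    using assms c by (intro add_mono mult_left_mono x_ln_x_tangent) auto
  moreover have "(1 - t) * (a * ln c + a - c) + t * (b * ln c + b - c) = c * ln c"
    by (simp add: c_def algebra_simps)
  ultimately show ?thesis by (simp add: c_def)
qed

text \<open>With m = (a + b) / 2 and a, b positive this is a ln (a / m) + b ln (b / m), the defect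
  in the parallelogram identity; for probability densities its integral is twice the Jensen-Shannon
  divergence.\<close>

definition ent_gap :: "real \<Rightarrow> real \<Rightarrow> real" where
  "ent_gap a b = a * ln a + b * ln b - 2 * (((a + b) / 2) * ln ((a + b) / 2))"

text \<open>The sharpened tangents at the midpoint m leave (sqrt a - sqrt m)^2 + (sqrt b - sqrt
  m)^2. The squared distances of two reals to a third one sum to at least half the squared distance
  between the two.\<close>

lemma ent_gap_sqrt:
  assumes "0 \<le> a" "0 \<le> b"
  shows "(sqrt a - sqrt b)\<^sup>2 / 2 \<le> ent_gap a b"
proof (cases "a + b = 0")
  case True
  then have "a = 0" "b = 0" using assms by auto
  then show ?thesis by (simp add: ent_gap_def)
next
  case False
  define m where "m = (a + b) / 2"
  have m: "0 < m" using False assms by (simp add: m_def)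
  define x y w where "x = sqrt a" "y = sqrt b" "w = sqrt m"
  have sq: "x * x = a" "y * y = b" "w * w = m"
    using assms m by (auto simp: x_y_w_def)
  have "(a * ln m + 2 * a - 2 * (x * w)) + (b * ln m + 2 * b - 2 * (y * w)) \<le> a * ln a + b * ln b"
    unfolding x_y_w_def using assms m by (intro add_mono x_ln_x_tangent_sqrt)
  moreover have "ent_gap a b = a * ln a + b * ln b - (a * ln m + b * ln m)"
    by (simp add: ent_gap_def m_def[symmetric]) (simp add: m_def field_simps)
  ultimately have "2 * a + 2 * b - 2 * (x * w) - 2 * (y * w) \<le> ent_gap a b" by linarith
  moreover have "2 * a + 2 * b - 2 * (x * w) - 2 * (y * w) = (x - w)\<^sup>2 + (y - w)\<^sup>2"
    using sq by (simp add: power2_eq_square algebra_simps m_def)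
  moreover have "(x - y)\<^sup>2 / 2 \<le> (x - w)\<^sup>2 + (y - w)\<^sup>2"
  proof -
    have "(x - w)\<^sup>2 + (y - w)\<^sup>2 = (x - y)\<^sup>2 / 2 + (x + y - 2 * w)\<^sup>2 / 2"
      by (simp add: power2_eq_square field_simps)
    then show ?thesis by simp
  qed
  ultimately show ?thesis by (simp add: x_y_w_def)
qed

lemma ent_gap_nonneg: "0 \<le> a \<Longrightarrow> 0 \<le> b \<Longrightarrow> 0 \<le> ent_gap a b"
  using ent_gap_sqrt[of a b] by (smt (verit) zero_le_power2 divide_nonneg_pos)

text \<open>A pointwise counterpart of Pinsker's inequality: factor a - b through square roots and
  apply Young's inequality with weight k. For probability densities the last term integrates to 2 k,
  so a small gap and a suitable k give a small L1 distance.\<close>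

lemma ent_gap_abs:
  assumes "0 \<le> a" "0 \<le> b" "0 < k"
  shows "\<bar>a - b\<bar> \<le> ent_gap a b / k + k * (a + b)"
proof -
  define x y where "x = sqrt a" "y = sqrt b"
  have sq: "a = x * x" "b = y * y" and pos: "0 \<le> x" "0 \<le> y"
    using assms by (auto simp: x_y_def)
  have "\<bar>a - b\<bar> = \<bar>x - y\<bar> * (x + y)"
    using pos by (simp add: sq square_diff_square_factored abs_mult mult.commute)
  also have "\<dots> \<le> (x - y)\<^sup>2 / (2 * k) + k * (x + y)\<^sup>2 / 2"
  proof -
    have "2 * k * (d * s) \<le> d\<^sup>2 + k\<^sup>2 * s\<^sup>2" for d s :: real
      using zero_le_power2[of "d - k * s"] by (simp add: power2_diff power_mult_distrib algebra_simps)
    from this[of "\<bar>x - y\<bar>" "x + y"]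
    have "2 * k * (\<bar>x - y\<bar> * (x + y)) \<le> (x - y)\<^sup>2 + k\<^sup>2 * (x + y)\<^sup>2" by simp
    then show ?thesis using assms(3) by (simp add: field_simps power2_eq_square)
  qed
  also have "(x - y)\<^sup>2 / (2 * k) \<le> ent_gap a b / k"
    using ent_gap_sqrt[OF assms(1,2)] assms(3) by (simp add: x_y_def field_simps)
  also have "k * (x + y)\<^sup>2 / 2 \<le> k * (a + b)"
  proof -
    have "(x + y)\<^sup>2 \<le> 2 * (a + b)"
      using zero_le_power2[of "x - y"] by (simp add: sq power2_eq_square algebra_simps)
    from mult_left_mono[OF this, of k] show ?thesis using assms(3) by (simp add: algebra_simps)
  qed
  finally show ?thesis by simp
qed

lemma ent_gap_eq_0:
  assumes "0 \<le> a" "0 \<le> b" "ent_gap a b = 0"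
  shows "a = b"
proof -
  have "(sqrt a - sqrt b)\<^sup>2 \<le> 0" using ent_gap_sqrt[OF assms(1,2)] assms(3) by simp
  then show ?thesis by simp
qed

lemma tendsto_x_ln_x:
  fixes X :: "nat \<Rightarrow> real"
  assumes "\<And>n. 0 \<le> X n" "X \<longlonglongrightarrow> l"
  shows "(\<lambda>n. X n * ln (X n)) \<longlonglongrightarrow> l * ln l"
proof (cases "l = 0")
  case True
  then have X0: "X \<longlonglongrightarrow> 0" using assms by simp
  \<comment> \<open>For the lower bound in the squeeze the plain tangent at 1 would give only -1 in
    the limit; the sharpened one tends to 0 with \<open>X n\<close>.\<close>
  have "(\<lambda>n. X n * ln (X n)) \<longlonglongrightarrow> 0"
  proof (rule tendsto_sandwich)
    show "\<forall>\<^sub>F n in sequentially. 2 * X n - 2 * sqrt (X n) \<le> X n * ln (X n)"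
      using x_ln_x_tangent_sqrt[OF assms(1), of 1] by simp
    show "\<forall>\<^sub>F n in sequentially. X n * ln (X n) \<le> 0"
    proof -
      have "\<forall>\<^sub>F n in sequentially. X n < 1" using order_tendstoD(2)[OF X0, of 1] by simp
      then show ?thesis
      proof eventually_elim
        fix n assume "X n < 1"
        then show "X n * ln (X n) \<le> 0"
          using assms(1)[of n] ln_less_zero[of "X n"]
          by (cases "X n = 0") (auto simp: mult_le_0_iff)
      qed
    qed
    have "(\<lambda>n. 2 * X n - 2 * sqrt (X n)) \<longlonglongrightarrow> 2 * 0 - 2 * sqrt 0"
      by (intro tendsto_intros X0)
    then show "(\<lambda>n. 2 * X n - 2 * sqrt (X n)) \<longlonglongrightarrow> 0" by simp
  qed simp
  then show ?thesis using True by simp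
qed (auto intro!: tendsto_intros assms)

context marginals
begin

section \<open>Convexity of the constraints and of the entropy; uniqueness of the minimizer\<close>

lemma mdens_convex:
  assumes p: "mdens p" and q: "mdens q" and t: "0 \<le> t" "t \<le> 1"
  shows "mdens (\<lambda>z. (1 - t) * p z + t * q z)"
proof -
  note [measurable] = mdens_measurable[OF p] mdens_measurable[OF q]
  note ip = mdens_integrable[OF p] and iq = mdens_integrable[OF q]
  have lin: "(\<integral>z. w z * ((1 - t) * p z + t * q z) \<partial>R)
      = (1 - t) * (\<integral>z. w z * p z \<partial>R) + t * (\<integral>z. w z * q z \<partial>R)"
    if "integrable R (\<lambda>z. w z * p z)" "integrable R (\<lambda>z. w z * q z)" for w :: "real \<times> real \<Rightarrow> real"
  proof -
    have "(\<integral>z. w z * ((1 - t) * p z + t * q z) \<partial>R)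
        = (\<integral>z. (1 - t) * (w z * p z) + t * (w z * q z) \<partial>R)"
      by (intro Bochner_Integration.integral_cong) (auto simp: algebra_simps)
    then show ?thesis using that by simp
  qed
  have ib: "integrable R (\<lambda>z. indicator A (f z) * u z)"
    if "integrable R u" and [measurable]: "f \<in> borel \<Otimes>\<^sub>M borel \<rightarrow>\<^sub>M borel" "A \<in> sets borel"
    for u :: "real \<times> real \<Rightarrow> real" and f :: "real \<times> real \<Rightarrow> real" and A
    using that(1) by (rule Bochner_Integration.integrable_bound) (use that(1) in \<open>auto simp: indicator_def\<close>)
  show ?thesis
    unfolding mdens_def
  proof (intro conjI ballI allI)
    show "0 \<le> (1 - t) * p z + t * q z" for z
      using t mdens_nonneg[OF p, of z] mdens_nonneg[OF q, of z] by simp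
    show "integrable R (\<lambda>z. (1 - t) * p z + t * q z)" using ip iq by simp
    fix A :: "real set" assume A [measurable]: "A \<in> sets borel"
    have "(\<integral>z. indicator A (fst z) * ((1 - t) * p z + t * q z) \<partial>R)
        = (1 - t) * (\<integral>z. indicator A (fst z) * p z \<partial>R) + t * (\<integral>z. indicator A (fst z) * q z \<partial>R)"
      by (intro lin ib ip iq; measurable)
    then show "(\<integral>z. indicator A (fst z) * ((1 - t) * p z + t * q z) \<partial>R) = measure \<mu> A"
      by (simp add: mdens_fst_indicator[OF p A] mdens_fst_indicator[OF q A] left_diff_distrib)
    have "(\<integral>z. indicator A (snd z) * ((1 - t) * p z + t * q z) \<partial>R)
        = (1 - t) * (\<integral>z. indicator A (snd z) * p z \<partial>R) + t * (\<integral>z. indicator A (snd z) * q z \<partial>R)"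
      by (intro lin ib ip iq; measurable)
    then show "(\<integral>z. indicator A (snd z) * ((1 - t) * p z + t * q z) \<partial>R) = measure \<nu> A"
      by (simp add: mdens_snd_indicator[OF p A] mdens_snd_indicator[OF q A] left_diff_distrib)
    have "integrable R (\<lambda>z. (indicator A (fst z) * (snd z - fst z)) * p z)"
      "integrable R (\<lambda>z. (indicator A (fst z) * (snd z - fst z)) * q z)"
      unfolding mult.assoc by (intro ib mdens_integrable_increment p q; measurable)+
    from lin[OF this] have "(\<integral>z. indicator A (fst z) * (snd z - fst z) * ((1 - t) * p z + t * q z) \<partial>R) = 0"
      by (simp add: mult.assoc mdens_martingale_indicator[OF p A] mdens_martingale_indicator[OF q A])
    then show "(\<integral>z. indicator A (fst z) * ((snd z - fst z) * ((1 - t) * p z + t * q z)) \<partial>R) = 0"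
      by (simp add: mult.assoc)
  qed measurable
qed

text \<open>Integrability follows from two-sided bounds: -1 from below, and the convex combination
  of p ln p and q ln q from above.\<close>

lemma fin_ent_convex:
  assumes p: "fin_ent p" and q: "fin_ent q" and t: "0 \<le> t" "t \<le> 1"
  shows "fin_ent (\<lambda>z. (1 - t) * p z + t * q z)"
proof -
  have mp: "mdens p" and mq: "mdens q"
    and i: "integrable R (\<lambda>z. p z * ln (p z))" "integrable R (\<lambda>z. q z * ln (q z))"
    using p q by (auto simp: fin_ent_def)
  note [measurable] = mdens_measurable[OF mp] mdens_measurable[OF mq]
  let ?r = "\<lambda>z. (1 - t) * p z + t * q z"
  have "integrable R (\<lambda>z. ?r z * ln (?r z))"
  proof (rule Bochner_Integration.integrable_bound)
    show "integrable R (\<lambda>z. 1 + \<bar>(1 - t) * (p z * ln (p z)) + t * (q z * ln (q z))\<bar>)"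
      using i by auto
    show "AE z in R. norm (?r z * ln (?r z)) \<le> norm (1 + \<bar>(1 - t) * (p z * ln (p z)) + t * (q z * ln (q z))\<bar>)"
    proof (rule AE_I2)
      fix z
      have "-1 \<le> ?r z * ln (?r z)"
        using t mdens_nonneg[OF mp, of z] mdens_nonneg[OF mq, of z] by (intro x_ln_x_ge) simp
      moreover have "?r z * ln (?r z) \<le> (1 - t) * (p z * ln (p z)) + t * (q z * ln (q z))"
        using t mdens_nonneg[OF mp, of z] mdens_nonneg[OF mq, of z] by (intro x_ln_x_convex) auto
      ultimately show "norm (?r z * ln (?r z)) \<le> norm (1 + \<bar>(1 - t) * (p z * ln (p z)) + t * (q z * ln (q z))\<bar>)"
        by simp
    qed
  qed simp
  then show ?thesis using mdens_convex[OF mp mq t] by (simp add: fin_ent_def)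
qed

lemma Ent_ge:
  assumes "fin_ent q" shows "-1 \<le> Ent q"
proof -
  have "(\<integral>z. -1 \<partial>R) \<le> (\<integral>z. q z * ln (q z) \<partial>R)"
    using assms by (intro integral_mono) (auto simp: fin_ent_def mdens_nonneg x_ln_x_ge)
  then show ?thesis by (simp add: Ent_def)
qed

lemma integral_ent_gap:
  assumes p: "fin_ent p" and q: "fin_ent q"
  shows "integrable R (\<lambda>z. ent_gap (p z) (q z))"
    and "(\<integral>z. ent_gap (p z) (q z) \<partial>R) = Ent p + Ent q - 2 * Ent (\<lambda>z. (p z + q z) / 2)"
    and "fin_ent (\<lambda>z. (p z + q z) / 2)"
proof -
  have eq: "(\<lambda>z. (1 - 1 / 2) * p z + 1 / 2 * q z) = (\<lambda>z. (p z + q z) / 2)"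
    by (auto simp: field_simps)
  show m: "fin_ent (\<lambda>z. (p z + q z) / 2)"
    using fin_ent_convex[OF p q, of "1 / 2"] unfolding eq by simp
  have i: "integrable R (\<lambda>z. p z * ln (p z))" "integrable R (\<lambda>z. q z * ln (q z))"
    "integrable R (\<lambda>z. ((p z + q z) / 2) * ln ((p z + q z) / 2))"
    using p q m unfolding fin_ent_def by blast+
  show "integrable R (\<lambda>z. ent_gap (p z) (q z))"
    unfolding ent_gap_def
    by (intro Bochner_Integration.integrable_diff Bochner_Integration.integrable_add integrable_mult_right i)
  show "(\<integral>z. ent_gap (p z) (q z) \<partial>R) = Ent p + Ent q - 2 * Ent (\<lambda>z. (p z + q z) / 2)"
    unfolding ent_gap_def Ent_def
    by (subst Bochner_Integration.integral_diff Bochner_Integration.integral_add integral_mult_right,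
        intro Bochner_Integration.integrable_add integrable_mult_right i, (intro integrable_mult_right i)?)+
      simp
qed

definition ent_min :: "(real \<times> real \<Rightarrow> real) \<Rightarrow> bool" where
  "ent_min Z \<longleftrightarrow> fin_ent Z \<and> (\<forall>q. fin_ent q \<longrightarrow> Ent Z \<le> Ent q)"

text \<open>The midpoint of two minimizers is again admissible, so the integral of the nonnegative
  gap is at most 0, and a vanishing gap forces equality.\<close>

lemma ent_min_unique:
  assumes "ent_min p" "ent_min q"
  shows "AE z in R. p z = q z"
proof -
  have p: "fin_ent p" and q: "fin_ent q" using assms by (auto simp: ent_min_def)
  note g = integral_ent_gap[OF p q]
  have nn: "0 \<le> p z" "0 \<le> q z" for z using p q by (auto simp: fin_ent_def mdens_nonneg)
  have "(\<integral>z. ent_gap (p z) (q z) \<partial>R) \<le> 0"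
    unfolding g(2) using assms g(3) p q unfolding ent_min_def
    by (smt (verit, best))
  moreover have "0 \<le> (\<integral>z. ent_gap (p z) (q z) \<partial>R)"
    by (intro integral_nonneg_AE AE_I2 ent_gap_nonneg nn)
  ultimately have "AE z in R. ent_gap (p z) (q z) = 0"
    by (subst integral_nonneg_eq_0_iff_AE[symmetric, OF g(1)]) (auto intro: ent_gap_nonneg nn)
  then show ?thesis
    by eventually_elim (rule ent_gap_eq_0[OF nn])
qed

end

section \<open>Existence of the minimizer\<close>

text \<open>Fatou's lemma for a convergent sequence whose integrals are eventually bounded. It
  serves the L1 limit, the lower semicontinuity of the entropy and the first-order
  conditions.\<close>

lemma nn_integral_limit_le:
  fixes u :: "nat \<Rightarrow> 'a \<Rightarrow> ennreal"
  assumes [measurable]: "\<And>i. u i \<in> borel_measurable M"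
    and lim: "AE z in M. (\<lambda>i. u i z) \<longlonglongrightarrow> v z"
    and le: "\<forall>\<^sub>F i in sequentially. (\<integral>\<^sup>+z. u i z \<partial>M) \<le> c"
  shows "(\<integral>\<^sup>+z. v z \<partial>M) \<le> c"
proof -
  have "(\<integral>\<^sup>+z. v z \<partial>M) = (\<integral>\<^sup>+z. liminf (\<lambda>i. u i z) \<partial>M)"
    using lim by (intro nn_integral_cong_AE, eventually_elim) (simp add: lim_imp_Liminf)
  also have "\<dots> \<le> liminf (\<lambda>i. \<integral>\<^sup>+z. u i z \<partial>M)"
    by (rule nn_integral_liminf) simp
  also have "\<dots> \<le> c"
    using Liminf_le[OF _ le] by simp
  finally show ?thesis .
qed

context marginals
begin

text \<open>Marginal tests have bounded weights and pass to the L1 limit directly. The increment y -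
  x is unbounded; each half of it is handled through the marginal that fixes its law.\<close>

lemma mdens_limit:
  assumes p: "\<And>i. mdens (p i)" and [measurable]: "Z \<in> borel_measurable (borel \<Otimes>\<^sub>M borel)"
    and nn: "\<And>z. 0 \<le> Z z"
    and L1: "(\<lambda>i. \<integral>\<^sup>+z. ennreal \<bar>p i z - Z z\<bar> \<partial>R) \<longlonglongrightarrow> 0"
    and ae: "AE z in R. (\<lambda>i. p i z) \<longlonglongrightarrow> Z z"
  shows "mdens Z"
proof -
  have pm [measurable]: "p i \<in> borel_measurable (borel \<Otimes>\<^sub>M borel)" for i by (rule mdens_measurable[OF p])
  have int: "integrable R Z"
  proof -
    have "\<forall>\<^sub>F i in sequentially. (\<integral>\<^sup>+z. ennreal \<bar>p i z - Z z\<bar> \<partial>R) < 1"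
      using L1 by (rule order_tendstoD) simp
    then obtain i where "(\<integral>\<^sup>+z. ennreal \<bar>p i z - Z z\<bar> \<partial>R) < 1"
      by (auto simp: eventually_sequentially)
    then have "integrable R (\<lambda>z. p i z - Z z)"
      by (intro integrableI_bounded) (auto elim: order_less_trans)
    from Bochner_Integration.integrable_diff[OF mdens_integrable[OF p[of i]] this]
    show ?thesis by simp
  qed
  have conv: "(\<lambda>i. \<integral>z. \<psi> z * p i z \<partial>R) \<longlonglongrightarrow> (\<integral>z. \<psi> z * Z z \<partial>R)"
    if [measurable]: "\<psi> \<in> borel_measurable (borel \<Otimes>\<^sub>M borel)" and b: "\<And>z. \<bar>\<psi> z\<bar> \<le> 1" for \<psi> :: "_ \<Rightarrow> real"
  proof (rule tendsto_L1_int)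
    show "integrable R (\<lambda>z. \<psi> z * p i z)" for i
      by (rule Bochner_Integration.integrable_bound[OF mdens_integrable[OF p[of i]]])
        (auto simp: abs_mult intro!: mult_left_le_one_le b)
    show "integrable R (\<lambda>z. \<psi> z * Z z)"
      by (rule Bochner_Integration.integrable_bound[OF int])
        (auto simp: abs_mult intro!: mult_left_le_one_le b)
    show "(\<lambda>i. \<integral>\<^sup>+z. norm (\<psi> z * p i z - \<psi> z * Z z) \<partial>R) \<longlonglongrightarrow> 0"
    proof (rule tendsto_sandwich[OF _ _ tendsto_const L1])
      show "\<forall>\<^sub>F i in sequentially. (\<integral>\<^sup>+z. norm (\<psi> z * p i z - \<psi> z * Z z) \<partial>R) \<le> (\<integral>\<^sup>+z. \<bar>p i z - Z z\<bar> \<partial>R)"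
        by (auto intro!: always_eventually nn_integral_mono ennreal_leI mult_left_le_one_le b
            simp: right_diff_distrib[symmetric] abs_mult)
    qed simp
  qed
  have mA: "(\<integral>z. indicator A (fst z) * Z z \<partial>R) = measure \<mu> A" if [measurable]: "A \<in> sets borel" for A
  proof -
    have "(\<lambda>i. \<integral>z. indicator A (fst z) * p i z \<partial>R) \<longlonglongrightarrow> (\<integral>z. indicator A (fst z) * Z z \<partial>R)"
      by (rule conv) (auto simp: indicator_def)
    then show ?thesis by (simp add: mdens_fst_indicator[OF p that] LIMSEQ_const_iff)
  qed
  have mB: "(\<integral>z. indicator A (snd z) * Z z \<partial>R) = measure \<nu> A" if [measurable]: "A \<in> sets borel" for A
  proof -
    have "(\<lambda>i. \<integral>z. indicator A (snd z) * p i z \<partial>R) \<longlonglongrightarrow> (\<integral>z. indicator A (snd z) * Z z \<partial>R)"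
      by (rule conv) (auto simp: indicator_def)
    then show ?thesis by (simp add: mdens_snd_indicator[OF p that] LIMSEQ_const_iff)
  qed
  have cp: "coupling \<mu> \<nu> (density R (\<lambda>z. ennreal (Z z)))"
    by (rule coupling_density) (auto simp: nn int mA mB)
  have idm: "(\<lambda>x :: real. x) \<in> borel_measurable borel" "abs \<in> borel_measurable (borel :: real measure)"
    by measurable
  have iy: "integrable R (\<lambda>z. snd z * p i z)" "integrable R (\<lambda>z. snd z * Z z)"
    "integrable R (\<lambda>z. fst z * p i z)" "integrable R (\<lambda>z. fst z * Z z)" for i
    by (intro iffD2[OF mdens_snd(1)[OF p idm(1)]] iffD2[OF mdens_fst(1)[OF p idm(1)]]
        iffD2[OF coupling_density_fst(1)[OF _ nn cp idm(1)]]
        iffD2[OF coupling_density_snd(1)[OF _ nn cp idm(1)]] integrable_mu integrable_nu; measurable)+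
  \<comment> \<open>Both sides are the integral of |y| under \<nu>. With the norms constant,
    Scheffe's lemma upgrades the almost everywhere convergence of y p_i to L1 convergence.\<close>
  have ay: "(\<integral>\<^sup>+z. norm (snd z * p i z) \<partial>R) = (\<integral>\<^sup>+z. norm (snd z * Z z) \<partial>R)" for i
  proof -
    have "(\<integral>\<^sup>+z. norm (snd z * p i z) \<partial>R) = ennreal (\<integral>z. \<bar>snd z\<bar> * p i z \<partial>R)"
      using integrable_norm[OF iy(1)[of i]] mdens_nonneg[OF p]
      by (subst nn_integral_eq_integral) (auto simp: abs_mult)
    also have "(\<integral>z. \<bar>snd z\<bar> * p i z \<partial>R) = (\<integral>z. \<bar>snd z\<bar> * Z z \<partial>R)"
      using mdens_snd(2)[OF p idm(2), of i] coupling_density_snd(2)[OF _ nn cp idm(2)] by simp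
    also have "ennreal \<dots> = (\<integral>\<^sup>+z. norm (snd z * Z z) \<partial>R)"
      using integrable_norm[OF iy(2)] nn
      by (subst nn_integral_eq_integral) (auto simp: abs_mult)
    finally show ?thesis .
  qed
  have L1y: "(\<lambda>i. \<integral>\<^sup>+z. norm (snd z * p i z - snd z * Z z) \<partial>R) \<longlonglongrightarrow> 0"
  proof (rule Scheffe_lemma2)
    show "AE z in R. (\<lambda>i. snd z * p i z) \<longlonglongrightarrow> snd z * Z z"
      using ae by eventually_elim (intro tendsto_intros)
    show "(\<integral>\<^sup>+z. norm (snd z * p i z) \<partial>R) \<le> (\<integral>\<^sup>+z. norm (snd z * Z z) \<partial>R)" for i
      by (rule eq_refl[OF ay])
  qed (auto simp: iy)
  have mM: "(\<integral>z. indicator A (fst z) * ((snd z - fst z) * Z z) \<partial>R) = 0" if A [measurable]: "A \<in> sets borel" for A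
  proof -
    have ib: "integrable R (\<lambda>z. indicator A (fst z) * u z)" if "integrable R u" for u :: "_ \<Rightarrow> real"
      using that by (rule Bochner_Integration.integrable_bound) (use that in \<open>auto simp: indicator_def\<close>)
    have Am: "(\<lambda>x. indicator A x * x) \<in> borel_measurable (borel :: real measure)" by measurable
    have split: "(\<integral>z. indicator A (fst z) * ((snd z - fst z) * u z) \<partial>R)
        = (\<integral>z. indicator A (fst z) * (snd z * u z) \<partial>R) - (\<integral>z. indicator A (fst z) * fst z * u z \<partial>R)"
      if "integrable R (\<lambda>z. snd z * u z)" "integrable R (\<lambda>z. fst z * u z)" for u :: "_ \<Rightarrow> real"
      using Bochner_Integration.integral_diff[OF ib[OF that(1)] ib[OF that(2)]]
      by (simp add: algebra_simps)
    \<comment> \<open>By the first marginal, the x-half of the increment has the same integral for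
      every \<open>p i\<close> and for \<open>Z\<close>.\<close>
    have x: "(\<integral>z. indicator A (fst z) * fst z * p i z \<partial>R) = (\<integral>x. indicator A x * x \<partial>\<mu>)"
      "(\<integral>z. indicator A (fst z) * fst z * Z z \<partial>R) = (\<integral>x. indicator A x * x \<partial>\<mu>)" for i
      using mdens_fst(2)[OF p Am] coupling_density_fst(2)[OF _ nn cp Am] by simp_all
    have "(\<lambda>i. \<integral>z. indicator A (fst z) * (snd z * p i z) \<partial>R) \<longlonglongrightarrow> (\<integral>z. indicator A (fst z) * (snd z * Z z) \<partial>R)"
    proof (rule tendsto_L1_int)
      show "(\<lambda>i. \<integral>\<^sup>+z. norm (indicator A (fst z) * (snd z * p i z) - indicator A (fst z) * (snd z * Z z)) \<partial>R) \<longlonglongrightarrow> 0"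
      proof (rule tendsto_sandwich[OF _ _ tendsto_const L1y])
        show "\<forall>\<^sub>F i in sequentially. (\<integral>\<^sup>+z. norm (indicator A (fst z) * (snd z * p i z) - indicator A (fst z) * (snd z * Z z)) \<partial>R)
            \<le> (\<integral>\<^sup>+z. norm (snd z * p i z - snd z * Z z) \<partial>R)"
          by (auto intro!: always_eventually nn_integral_mono ennreal_leI simp: indicator_def)
      qed simp
    qed (auto intro!: ib iy)
    then have "(\<lambda>i. \<integral>z. indicator A (fst z) * ((snd z - fst z) * p i z) \<partial>R)
        \<longlonglongrightarrow> (\<integral>z. indicator A (fst z) * ((snd z - fst z) * Z z) \<partial>R)"
      by (simp only: split[OF iy(1,3)] split[OF iy(2,4)] x) (intro tendsto_intros)
    then show ?thesis
      by (simp add: mdens_martingale_indicator[OF p A] LIMSEQ_const_iff)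
  qed
  show ?thesis
    unfolding mdens_def using nn int mA mB mM by (auto simp del: split_paired_All)
qed

lemma ent_min_exists:
  assumes q0: "fin_ent q0"
  obtains Z where "ent_min Z"
proof -
  define S where "S = Ent ` {q. fin_ent q}"
  define m where "m = Inf S"
  have S: "S \<noteq> {}" "bdd_below S"
    using q0 Ent_ge by (auto simp: S_def intro!: bdd_belowI2)
  have m_le: "m \<le> Ent q" if "fin_ent q" for q
    unfolding m_def using that S by (intro cInf_lower) (auto simp: S_def)
  have "\<exists>q. fin_ent q \<and> Ent q < m + 1 / (real n + 1)" for n
  proof -
    have "Inf S < m + 1 / (real n + 1)" by (simp add: m_def)
    with cInf_lessD[OF S(1)] show ?thesis by (auto simp: S_def)
  qed
  then obtain q where q: "\<And>n. fin_ent (q n)" and Eq: "\<And>n. Ent (q n) < m + 1 / (real n + 1)"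
    by metis
  have mq: "mdens (q n)" for n using q by (simp add: fin_ent_def)
  have [measurable]: "q n \<in> borel_measurable (borel \<Otimes>\<^sub>M borel)" for n by (rule mdens_measurable[OF mq])
  have cauchy: "\<exists>N. \<forall>i\<ge>N. \<forall>j\<ge>N. (\<integral>z. norm (q i z - q j z) \<partial>R) < e" if e: "0 < e" for e :: real
  proof -
    \<comment> \<open>With k = e / 4 in \<open>ent_gap_abs\<close> and an integrated gap of at most
      2 / N, the bound is 8 / (N e) + e / 2, which is below e once N > 16 / e^2.\<close>
    obtain N :: nat where N: "16 / e\<^sup>2 < real N" using reals_Archimedean2 by blast
    have "(\<integral>z. norm (q i z - q j z) \<partial>R) < e" if ij: "N \<le> i" "N \<le> j" for i j
    proof -
      note g = integral_ent_gap[OF q[of i] q[of j]]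
      have N0: "0 < real N" using N e by (smt (verit) divide_pos_pos zero_less_power)
      have "1 / (real k + 1) < 1 / real N" if "N \<le> k" for k
        using that N0 by (intro divide_strict_left_mono) auto
      from this[OF ij(1)] this[OF ij(2)]
      \<comment> \<open>Both entropies exceed the infimum m by less than 1 / N, while the midpoint
        has entropy at least m.\<close>
      have G: "(\<integral>z. ent_gap (q i z) (q j z) \<partial>R) \<le> 2 / real N"
        unfolding g(2) using Eq[of i] Eq[of j] m_le[OF g(3)] by simp
      have "(\<integral>z. norm (q i z - q j z) \<partial>R) \<le> (\<integral>z. ent_gap (q i z) (q j z) / (e / 4) + (e / 4) * (q i z + q j z) \<partial>R)"
      proof (rule integral_mono)
        show "integrable R (\<lambda>z. norm (q i z - q j z))"
          by (intro integrable_norm Bochner_Integration.integrable_diff mdens_integrable mq)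
        show "integrable R (\<lambda>z. ent_gap (q i z) (q j z) / (e / 4) + (e / 4) * (q i z + q j z))"
          by (intro Bochner_Integration.integrable_add integrable_divide integrable_mult_right g(1) mdens_integrable mq)
        show "norm (q i z - q j z) \<le> ent_gap (q i z) (q j z) / (e / 4) + (e / 4) * (q i z + q j z)" for z
          unfolding real_norm_def by (intro ent_gap_abs mdens_nonneg mq) (use e in simp)
      qed
      also have "\<dots> = (\<integral>z. ent_gap (q i z) (q j z) \<partial>R) / (e / 4) + (e / 4) * 2"
        using Bochner_Integration.integral_add[OF integrable_divide[OF g(1)]
            integrable_mult_right[OF Bochner_Integration.integrable_add[OF mdens_integrable[OF mq[of i]] mdens_integrable[OF mq[of j]]]],
            of "e / 4" "e / 4"]
        by (simp add: Bochner_Integration.integral_add[OF mdens_integrable[OF mq[of i]] mdens_integrable[OF mq[of j]]]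
            mdens_total[OF mq])
      also have "\<dots> \<le> (2 / real N) / (e / 4) + (e / 4) * 2"
        using G e by (intro add_mono divide_right_mono) auto
      also have "\<dots> < e"
        using N N0 e by (simp add: field_simps power2_eq_square)
      finally show ?thesis .
    qed
    then show ?thesis by blast
  qed
  obtain r where r: "strict_mono r" and ae: "AE z in R. Cauchy (\<lambda>i. q (r i) z)"
    using cauchy_L1_AE_cauchy_subseq[of R q] cauchy mdens_integrable[OF mq] by blast
  define p where "p i = q (r i)" for i
  \<comment> \<open>On the null set of divergence \<open>lim\<close> is arbitrary; the maximum with
    0 secures nonnegativity everywhere, as \<open>mdens\<close> requires.\<close>
  define Z where "Z z = max 0 (lim (\<lambda>i. p i z))" for z
  have pm [measurable]: "p i \<in> borel_measurable (borel \<Otimes>\<^sub>M borel)" for i by (simp add: p_def)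
  have mp: "mdens (p i)" and fp: "fin_ent (p i)" for i by (simp_all add: p_def mq q)
  have Zm [measurable]: "Z \<in> borel_measurable (borel \<Otimes>\<^sub>M borel)" unfolding Z_def by measurable
  have Znn: "0 \<le> Z z" for z by (simp add: Z_def)
  have lim: "AE z in R. (\<lambda>i. p i z) \<longlonglongrightarrow> Z z"
    using ae
  proof eventually_elim
    fix z assume "Cauchy (\<lambda>i. q (r i) z)"
    then have L: "(\<lambda>i. p i z) \<longlonglongrightarrow> lim (\<lambda>i. p i z)"
      by (simp add: Cauchy_convergent convergent_LIMSEQ_iff[symmetric] p_def)
    moreover have "0 \<le> lim (\<lambda>i. p i z)"
      using LIMSEQ_le_const[OF L] mdens_nonneg[OF mp] by blast
    ultimately show "(\<lambda>i. p i z) \<longlonglongrightarrow> Z z" by (simp add: Z_def)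
  qed
  \<comment> \<open>Fix i and let j tend to infinity in the Cauchy estimate.\<close>
  have L1: "(\<lambda>i. \<integral>\<^sup>+z. ennreal \<bar>p i z - Z z\<bar> \<partial>R) \<longlonglongrightarrow> 0"
  proof (rule order_tendstoI)
    fix a :: ennreal assume a: "0 < a"
    then obtain e where e: "0 < e" "ennreal e < a"
      by (metis dense ennreal_cases ennreal_less_zero_iff less_top_ennreal order_less_trans)
    then obtain N where N: "\<And>i j. N \<le> i \<Longrightarrow> N \<le> j \<Longrightarrow> (\<integral>z. norm (q i z - q j z) \<partial>R) < e"
      using cauchy by blast
    have "(\<integral>\<^sup>+z. ennreal \<bar>p i z - Z z\<bar> \<partial>R) \<le> ennreal e" if i: "N \<le> i" for i
    proof (rule nn_integral_limit_le)
      show "AE z in R. (\<lambda>j. ennreal \<bar>p i z - p j z\<bar>) \<longlonglongrightarrow> ennreal \<bar>p i z - Z z\<bar>"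
        using lim by eventually_elim (intro tendsto_ennrealI tendsto_rabs tendsto_diff tendsto_const)
      have "(\<integral>\<^sup>+z. ennreal \<bar>p i z - p j z\<bar> \<partial>R) \<le> ennreal e" if j: "N \<le> j" for j
      proof -
        have "(\<integral>\<^sup>+z. ennreal \<bar>p i z - p j z\<bar> \<partial>R) = ennreal (\<integral>z. \<bar>p i z - p j z\<bar> \<partial>R)"
          by (intro nn_integral_eq_integral integrable_abs Bochner_Integration.integrable_diff mdens_integrable mp) auto
        also have "\<dots> \<le> ennreal e"
          using N[of "r i" "r j"] i j seq_suble[OF r, of i] seq_suble[OF r, of j]
          by (intro ennreal_leI) (simp add: p_def)
        finally show ?thesis .
      qed
      then show "\<forall>\<^sub>F j in sequentially. (\<integral>\<^sup>+z. ennreal \<bar>p i z - p j z\<bar> \<partial>R) \<le> ennreal e"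
        by (auto simp: eventually_sequentially)
    qed measurable
    with e(2) show "\<forall>\<^sub>F i in sequentially. (\<integral>\<^sup>+z. ennreal \<bar>p i z - Z z\<bar> \<partial>R) < a"
      by (auto simp: eventually_sequentially intro: le_less_trans)
  qed simp
  have mZ: "mdens Z" by (rule mdens_limit[OF mp Zm Znn L1 lim])
  \<comment> \<open>The summand 1 makes the integrand nonnegative, because u ln u \<ge> -1.\<close>
  have fatou: "(\<integral>\<^sup>+z. ennreal (Z z * ln (Z z) + 1) \<partial>R) \<le> ennreal (m + e + 1)" if e: "0 < e" for e
  proof (rule nn_integral_limit_le)
    show "AE z in R. (\<lambda>i. ennreal (p i z * ln (p i z) + 1)) \<longlonglongrightarrow> ennreal (Z z * ln (Z z) + 1)"
      using lim by eventually_elim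
        (intro tendsto_ennrealI tendsto_add tendsto_x_ln_x tendsto_const mdens_nonneg[OF mp])
    obtain N :: nat where N: "1 / e < real N" using reals_Archimedean2 by blast
    have "(\<integral>\<^sup>+z. ennreal (p i z * ln (p i z) + 1) \<partial>R) \<le> ennreal (m + e + 1)" if i: "N \<le> i" for i
    proof -
      have ii: "integrable R (\<lambda>z. p i z * ln (p i z))" using fp[of i] by (simp add: fin_ent_def)
      have nn: "0 \<le> p i z * ln (p i z) + 1" for z
        using x_ln_x_ge[OF mdens_nonneg[OF mp, of i z]] by simp
      have r_le: "1 / (real (r i) + 1) \<le> e"
      proof -
        have "real N \<le> real (r i)" using i seq_suble[OF r, of i] by simp
        then have "1 / e < real (r i) + 1" using N by linarith
        then show ?thesis using e by (simp add: field_simps)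
      qed
      have "(\<integral>\<^sup>+z. ennreal (p i z * ln (p i z) + 1) \<partial>R) = ennreal (Ent (p i) + 1)"
        by (subst nn_integral_eq_integral) (auto simp: ii nn Ent_def simp del: split_paired_All)
      also have "\<dots> \<le> ennreal (m + e + 1)"
        using Eq[of "r i"] r_le by (intro ennreal_leI) (simp add: p_def)
      finally show ?thesis .
    qed
    then show "\<forall>\<^sub>F i in sequentially. (\<integral>\<^sup>+z. ennreal (p i z * ln (p i z) + 1) \<partial>R) \<le> ennreal (m + e + 1)"
      by (auto simp: eventually_sequentially)
  qed measurable
  have nnZ: "0 \<le> Z z * ln (Z z) + 1" for z using x_ln_x_ge[OF Znn, of z] by simp
  have "integrable R (\<lambda>z. Z z * ln (Z z) + 1)"
    by (rule integrableI_nonneg) (use fatou[of 1] nnZ in \<open>auto simp del: split_paired_All intro: le_less_trans\<close>)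
  then have iZ: "integrable R (\<lambda>z. Z z * ln (Z z))"
    using Bochner_Integration.integrable_diff[of R "\<lambda>z. Z z * ln (Z z) + 1" "\<lambda>_. 1"] by simp
  have "Ent Z \<le> m"
  proof (rule field_le_epsilon)
    fix e :: real assume e: "0 < e"
    have "ennreal (Ent Z + 1) = (\<integral>\<^sup>+z. ennreal (Z z * ln (Z z) + 1) \<partial>R)"
      by (subst nn_integral_eq_integral) (auto simp: iZ nnZ Ent_def simp del: split_paired_All)
    also have "\<dots> \<le> ennreal (m + e + 1)" by (rule fatou[OF e])
    finally have "ennreal (Ent Z + 1) \<le> ennreal (m + e + 1)" .
    moreover have "0 \<le> m + e + 1"
      using Ent_ge e unfolding m_def S_def by (smt (verit) S(1) S_def cINF_greatest image_is_empty mem_Collect_eq)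
    ultimately show "Ent Z \<le> m + e" by simp
  qed
  with mZ iZ m_le show thesis
    by (intro that[of Z]) (auto simp: ent_min_def fin_ent_def simp del: split_paired_All intro: order_trans)
qed

end

section \<open>First-order conditions\<close>

text \<open>The derivative of u ln u at a in direction b - a, sampled at the step sizes 1 / (n +
  1).\<close>

lemma x_ln_x_quotient_tendsto:
  fixes a b :: real
  assumes "0 < a"
  shows "(\<lambda>n. real (Suc n) * ((a + (b - a) / real (Suc n)) * ln (a + (b - a) / real (Suc n)) - a * ln a))
      \<longlonglongrightarrow> (ln a + 1) * (b - a)"
proof -
  have "((\<lambda>t. (a + t * (b - a)) * ln (a + t * (b - a))) has_real_derivative (ln a + 1) * (b - a)) (at 0)"
    using assms by (auto intro!: derivative_eq_intros simp: field_simps)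
  then have "((\<lambda>t. ((a + t * (b - a)) * ln (a + t * (b - a)) - a * ln a) / t) \<longlongrightarrow> (ln a + 1) * (b - a)) (at 0)"
    by (simp add: DERIV_def)
  moreover have "filterlim (\<lambda>n. inverse (real (Suc n))) (at 0) sequentially"
    using LIMSEQ_inverse_real_of_nat by (auto simp: filterlim_at)
  ultimately have "(\<lambda>n. ((a + inverse (real (Suc n)) * (b - a)) * ln (a + inverse (real (Suc n)) * (b - a)) - a * ln a)
      / inverse (real (Suc n))) \<longlonglongrightarrow> (ln a + 1) * (b - a)"
    by (rule filterlim_compose)
  then show ?thesis
    by (simp add: divide_inverse mult.commute[of "inverse _"] mult.commute[of _ "real _"] del: of_nat_Suc)
qed

context marginals
begin

text \<open>\<open>d n\<close> is the full increment of u ln u from Z to q minus its difference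
  quotient at t = 1 / (n + 1). Convexity makes it nonnegative; minimality makes the integrated
  quotient nonnegative, which gives the bound. Fatou's lemma then applies as n grows.\<close>

lemma ent_min_variation:
  assumes Z: "ent_min Z" and q: "fin_ent q"
  defines "d \<equiv> \<lambda>n z. q z * ln (q z) - Z z * ln (Z z)
      - real (Suc n) * ((Z z + (q z - Z z) / real (Suc n)) * ln (Z z + (q z - Z z) / real (Suc n)) - Z z * ln (Z z))"
  shows "(\<integral>\<^sup>+z. ennreal (d n z) \<partial>R) \<le> ennreal (Ent q - Ent Z)" and "0 \<le> d n z"
    and "d n \<in> borel_measurable (borel \<Otimes>\<^sub>M borel)"
proof -
  have fZ: "fin_ent Z" and mZ: "mdens Z" and mq: "mdens q"
    and i: "integrable R (\<lambda>z. q z * ln (q z))" "integrable R (\<lambda>z. Z z * ln (Z z))"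
    using Z q by (auto simp: ent_min_def fin_ent_def)
  note [measurable] = mdens_measurable[OF mZ] mdens_measurable[OF mq]
  note nn = mdens_nonneg[OF mZ] mdens_nonneg[OF mq]
  define t where "t = 1 / real (Suc n)"
  have t: "0 < t" "0 \<le> t" "t \<le> 1" "real (Suc n) * t = 1" by (auto simp: t_def)
  define r where "r z = (1 - t) * Z z + t * q z" for z
  have r: "Z z + (q z - Z z) / real (Suc n) = r z" for z
    by (simp add: r_def t_def algebra_simps diff_divide_distrib)
  have fr: "fin_ent r" unfolding r_def by (rule fin_ent_convex[OF fZ q t(2,3)])
  then have ir: "integrable R (\<lambda>z. r z * ln (r z))" by (simp add: fin_ent_def)
  show "d n \<in> borel_measurable (borel \<Otimes>\<^sub>M borel)" unfolding d_def by measurable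
  have nonneg: "0 \<le> d n z" for z
  proof -
    have "r z * ln (r z) \<le> (1 - t) * (Z z * ln (Z z)) + t * (q z * ln (q z))"
      unfolding r_def by (intro x_ln_x_convex nn t)
    then have "real (Suc n) * (r z * ln (r z) - Z z * ln (Z z)) \<le> real (Suc n) * (t * (q z * ln (q z) - Z z * ln (Z z)))"
      by (intro mult_left_mono) (auto simp: algebra_simps)
    also have "\<dots> = q z * ln (q z) - Z z * ln (Z z)"
      by (simp only: mult.assoc[symmetric] t(4) mult_1_left)
    finally show ?thesis by (simp add: d_def r del: of_nat_Suc)
  qed
  then show "0 \<le> d n z" .
  have id: "integrable R (d n)"
    unfolding d_def r by (intro Bochner_Integration.integrable_diff integrable_mult_right i ir)
  have "(\<integral>z. d n z \<partial>R) = Ent q - Ent Z - real (Suc n) * (Ent r - Ent Z)"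
    unfolding d_def r Ent_def
    by (simp add: i ir Bochner_Integration.integral_diff Bochner_Integration.integrable_diff del: of_nat_Suc)
  also have "\<dots> \<le> Ent q - Ent Z"
    using Z fr by (simp add: ent_min_def)
  finally have le: "(\<integral>z. d n z \<partial>R) \<le> Ent q - Ent Z" .
  have "(\<integral>\<^sup>+z. ennreal (d n z) \<partial>R) = ennreal (\<integral>z. d n z \<partial>R)"
    by (intro nn_integral_eq_integral id AE_I2 nonneg)
  with le show "(\<integral>\<^sup>+z. ennreal (d n z) \<partial>R) \<le> ennreal (Ent q - Ent Z)"
    by (simp add: ennreal_leI)
qed

lemma ent_min_positive:
  assumes Z: "ent_min Z" and q: "fin_ent q"
  shows "AE z in R. 0 < q z \<longrightarrow> 0 < Z z"
proof -
  have mZ: "mdens Z" and mq: "mdens q" using Z q by (auto simp: ent_min_def fin_ent_def)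
  note [measurable] = mdens_measurable[OF mZ] mdens_measurable[OF mq]
  note nn = mdens_nonneg[OF mZ] mdens_nonneg[OF mq]
  let ?d = "\<lambda>n z. q z * ln (q z) - Z z * ln (Z z)
      - real (Suc n) * ((Z z + (q z - Z z) / real (Suc n)) * ln (Z z + (q z - Z z) / real (Suc n)) - Z z * ln (Z z))"
  define B where "B = {z. Z z = 0 \<and> 0 < q z}"
  have B [measurable]: "B \<in> sets (borel \<Otimes>\<^sub>M borel)"
  proof -
    have "{z \<in> space (borel \<Otimes>\<^sub>M borel). Z z = 0 \<and> 0 < q z} \<in> sets (borel \<Otimes>\<^sub>M borel)" by measurable
    then show ?thesis by (simp add: B_def space_pair_measure)
  qed
  \<comment> \<open>Where Z vanishes and q does not, the difference quotients of the entropy tend to minus infinity.\<close>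
  have "(\<integral>\<^sup>+z. \<infinity> * indicator B z \<partial>R) \<le> ennreal (Ent q - Ent Z)"
  proof (rule nn_integral_limit_le)
    show "AE z in R. (\<lambda>n. ennreal (?d n z) * indicator B z) \<longlonglongrightarrow> \<infinity> * indicator B z"
    proof (rule AE_I2)
      fix z
      show "(\<lambda>n. ennreal (?d n z) * indicator B z) \<longlonglongrightarrow> \<infinity> * indicator B z"
      proof (cases "z \<in> B")
        case True
        then have z: "Z z = 0" "0 < q z" by (auto simp: B_def)
        \<comment> \<open>Here the interpolated density is q / (n + 1); the terms q ln q cancel and
          q ln (n + 1) remains.\<close>
        have "?d n z = q z * ln (real (Suc n))" for n
          using z by (simp add: ln_div algebra_simps del: of_nat_Suc)
        moreover have "filterlim (\<lambda>n. q z * ln (real (Suc n))) at_top sequentially"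
          by (intro filterlim_tendsto_pos_mult_at_top[OF tendsto_const z(2)]
              filterlim_compose[OF ln_at_top] filterlim_compose[OF filterlim_real_sequentially] filterlim_Suc)
        ultimately show ?thesis
          using True by (simp add: ennreal_tendsto_top_eq_at_top del: of_nat_Suc)
      qed simp
    qed
    show "\<forall>\<^sub>F n in sequentially. (\<integral>\<^sup>+z. ennreal (?d n z) * indicator B z \<partial>R) \<le> ennreal (Ent q - Ent Z)"
      by (intro always_eventually allI order_trans[OF nn_integral_mono ent_min_variation(1)[OF Z q]])
        (auto simp: indicator_def)
  qed measurable
  then have "emeasure R B = 0"
    by (subst (asm) nn_integral_cmult_indicator) (auto simp: ennreal_top_mult top_unique split: if_splits)
  then have "AE z in R. z \<notin> B" by (intro AE_not_in) (auto simp: null_sets_def)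
  then show ?thesis
    by eventually_elim (use nn(1) in \<open>auto simp: B_def order_less_le\<close>)
qed

text \<open>As n grows, the quantity of \<open>ent_min_variation\<close> tends to the Bregman
  integrand q ln q - q ln Z - q + Z. Its integral is the entropy of q relative to Z and is at most
  \<open>Ent q - Ent Z\<close>, a Pythagorean inequality; solving for the integral of q ln Z gives
  both claims.\<close>

lemma ent_min_log_integral:
  assumes Z: "ent_min Z" and pos: "AE z in R. 0 < Z z" and q: "fin_ent q"
  shows "integrable R (\<lambda>z. q z * ln (Z z))" and "Ent Z \<le> (\<integral>z. q z * ln (Z z) \<partial>R)"
proof -
  have mZ: "mdens Z" and mq: "mdens q" and iq: "integrable R (\<lambda>z. q z * ln (q z))"
    using Z q by (auto simp: ent_min_def fin_ent_def)
  note [measurable] = mdens_measurable[OF mZ] mdens_measurable[OF mq]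
  note nn = mdens_nonneg[OF mZ] mdens_nonneg[OF mq]
  let ?d = "\<lambda>n z. q z * ln (q z) - Z z * ln (Z z)
      - real (Suc n) * ((Z z + (q z - Z z) / real (Suc n)) * ln (Z z + (q z - Z z) / real (Suc n)) - Z z * ln (Z z))"
  define B where "B z = q z * ln (q z) - q z * ln (Z z) - q z + Z z" for z
  have lim: "AE z in R. (\<lambda>n. ?d n z) \<longlonglongrightarrow> B z"
    using pos
  proof eventually_elim
    fix z assume z: "0 < Z z"
    have "(\<lambda>n. ?d n z) \<longlonglongrightarrow> q z * ln (q z) - Z z * ln (Z z) - (ln (Z z) + 1) * (q z - Z z)"
      by (intro tendsto_diff tendsto_const x_ln_x_quotient_tendsto z)
    also have "q z * ln (q z) - Z z * ln (Z z) - (ln (Z z) + 1) * (q z - Z z) = B z"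
      by (simp add: B_def algebra_simps)
    finally show "(\<lambda>n. ?d n z) \<longlonglongrightarrow> B z" .
  qed
  have le: "(\<integral>\<^sup>+z. ennreal (B z) \<partial>R) \<le> ennreal (Ent q - Ent Z)"
  proof (rule nn_integral_limit_le)
    show "AE z in R. (\<lambda>n. ennreal (?d n z)) \<longlonglongrightarrow> ennreal (B z)"
      using lim by eventually_elim (rule tendsto_ennrealI)
    show "\<forall>\<^sub>F n in sequentially. (\<integral>\<^sup>+z. ennreal (?d n z) \<partial>R) \<le> ennreal (Ent q - Ent Z)"
      by (intro always_eventually allI ent_min_variation(1)[OF Z q])
  qed measurable
  have Bnn: "AE z in R. 0 \<le> B z"
    using lim
  proof eventually_elim
    fix z assume L: "(\<lambda>n. ?d n z) \<longlonglongrightarrow> B z"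
    show "0 \<le> B z" by (rule LIMSEQ_le_const[OF L]) (use ent_min_variation(2)[OF Z q] in blast)
  qed
  have Bm [measurable]: "B \<in> borel_measurable (borel \<Otimes>\<^sub>M borel)" unfolding B_def by measurable
  have iB: "integrable R B"
    by (rule integrableI_nonneg) (use le Bnn in \<open>auto intro: le_less_trans\<close>)
  have eq: "(\<lambda>z. q z * ln (Z z)) = (\<lambda>z. q z * ln (q z) - q z + Z z - B z)"
    by (auto simp: B_def)
  note ii = iq mdens_integrable[OF mq] mdens_integrable[OF mZ] iB
  show "integrable R (\<lambda>z. q z * ln (Z z))"
    unfolding eq by (intro Bochner_Integration.integrable_diff Bochner_Integration.integrable_add ii)
  have "(\<integral>z. q z * ln (Z z) \<partial>R) = Ent q - (\<integral>z. q z \<partial>R) + (\<integral>z. Z z \<partial>R) - (\<integral>z. B z \<partial>R)"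
    unfolding eq Ent_def by (simp add: ii)
  moreover have "(\<integral>z. B z \<partial>R) \<le> Ent q - Ent Z"
  proof -
    have "ennreal (\<integral>z. B z \<partial>R) \<le> ennreal (Ent q - Ent Z)"
      using le by (simp add: nn_integral_eq_integral[OF iB Bnn])
    then show ?thesis using Z q by (simp add: ent_min_def)
  qed
  ultimately show "Ent Z \<le> (\<integral>z. q z * ln (Z z) \<partial>R)"
    by (simp add: mdens_total mq mZ)
qed

text \<open>Since s is dominated by a multiple of Z, a small multiple of s can be added to Z with a
  result that is comparable to Z and of finite entropy. The three conditions on s say that all
  constraints persist, so \<open>ent_min_log_integral\<close> applies to Z + e s.\<close>

lemma ent_min_perturbation:
  assumes Z: "ent_min Z" and pos: "AE z in R. 0 < Z z"
    and [measurable]: "s \<in> borel_measurable (borel \<Otimes>\<^sub>M borel)" and C: "0 < C" and bound: "\<And>z. \<bar>s z\<bar> \<le> C * Z z"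
    and s1: "\<And>A. A \<in> sets borel \<Longrightarrow> (\<integral>z. indicator A (fst z) * s z \<partial>R) = 0"
    and s2: "\<And>A. A \<in> sets borel \<Longrightarrow> (\<integral>z. indicator A (snd z) * s z \<partial>R) = 0"
    and s3: "\<And>A. A \<in> sets borel \<Longrightarrow> (\<integral>z. indicator A (fst z) * ((snd z - fst z) * s z) \<partial>R) = 0"
  shows "integrable R (\<lambda>z. s z * ln (Z z))" and "0 \<le> (\<integral>z. s z * ln (Z z) \<partial>R)"
proof -
  have mZ: "mdens Z" and iZ: "integrable R (\<lambda>z. Z z * ln (Z z))"
    using Z by (auto simp: ent_min_def fin_ent_def)
  note [measurable] = mdens_measurable[OF mZ]
  note nn = mdens_nonneg[OF mZ]
  \<comment> \<open>This e gives |e s| \<le> Z / 2, hence Z / 2 \<le> q \<le> 2 Z and logarithms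
    that differ by at most ln 2.\<close>
  define e where "e = 1 / (2 * C)"
  have e: "0 < e" using C by (simp add: e_def)
  define q where "q z = Z z + e * s z" for z
  have eb: "\<bar>e * s z\<bar> \<le> Z z / 2" for z
  proof -
    have "\<bar>e * s z\<bar> \<le> e * (C * Z z)"
      using mult_left_mono[OF bound[of z], of e] e by (simp add: abs_mult)
    also have "\<dots> = Z z / 2" using C by (simp add: e_def)
    finally show ?thesis .
  qed
  have qb: "Z z / 2 \<le> q z" "q z \<le> 2 * Z z" for z
    using eb[of z] nn[of z] by (auto simp: q_def abs_le_iff)
  have qnn: "0 \<le> q z" for z using qb(1)[of z] nn[of z] by simp
  have [measurable]: "q \<in> borel_measurable (borel \<Otimes>\<^sub>M borel)" unfolding q_def by measurable
  have is_: "integrable R (\<lambda>z. w z * s z)"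
    if i: "integrable R (\<lambda>z. w z * Z z)" and [measurable]: "w \<in> borel_measurable (borel \<Otimes>\<^sub>M borel)" for w :: "_ \<Rightarrow> real"
  proof (rule Bochner_Integration.integrable_bound)
    show "integrable R (\<lambda>z. C * (w z * Z z))" using i by simp
    show "AE z in R. norm (w z * s z) \<le> norm (C * (w z * Z z))"
    proof (rule AE_I2)
      fix z
      have "\<bar>w z\<bar> * \<bar>s z\<bar> \<le> \<bar>w z\<bar> * (C * Z z)" by (intro mult_left_mono bound) simp
      then show "norm (w z * s z) \<le> norm (C * (w z * Z z))"
        using C nn[of z] by (simp add: abs_mult mult.left_commute)
    qed
  qed measurable
  have lin: "(\<integral>z. w z * q z \<partial>R) = (\<integral>z. w z * Z z \<partial>R) + e * (\<integral>z. w z * s z \<partial>R)"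
    if "integrable R (\<lambda>z. w z * Z z)" "w \<in> borel_measurable (borel \<Otimes>\<^sub>M borel)" for w :: "_ \<Rightarrow> real"
  proof -
    have "(\<integral>z. w z * q z \<partial>R) = (\<integral>z. w z * Z z + e * (w z * s z) \<partial>R)"
      by (intro Bochner_Integration.integral_cong) (auto simp: q_def algebra_simps)
    then show ?thesis using that(1) is_[OF that] by simp
  qed
  have iqq: "integrable R q"
    unfolding q_def using mdens_integrable[OF mZ] is_[of "\<lambda>_. 1"] by simp
  have ib: "integrable R (\<lambda>z. indicator A (f z) * u z)"
    if "integrable R u" and [measurable]: "f \<in> borel \<Otimes>\<^sub>M borel \<rightarrow>\<^sub>M borel" "A \<in> sets borel"
    for u :: "real \<times> real \<Rightarrow> real" and f :: "real \<times> real \<Rightarrow> real" and A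
    using that(1) by (rule Bochner_Integration.integrable_bound) (use that(1) in \<open>auto simp: indicator_def\<close>)
  have mq: "mdens q"
    unfolding mdens_def
  proof (intro conjI ballI allI)
    fix A :: "real set" assume A [measurable]: "A \<in> sets borel"
    have "(\<integral>z. indicator A (fst z) * q z \<partial>R) = (\<integral>z. indicator A (fst z) * Z z \<partial>R) + e * (\<integral>z. indicator A (fst z) * s z \<partial>R)"
      by (intro lin ib mdens_integrable mZ; measurable)
    then show "(\<integral>z. indicator A (fst z) * q z \<partial>R) = measure \<mu> A"
      by (simp add: s1[OF A] mdens_fst_indicator[OF mZ A])
    have "(\<integral>z. indicator A (snd z) * q z \<partial>R) = (\<integral>z. indicator A (snd z) * Z z \<partial>R) + e * (\<integral>z. indicator A (snd z) * s z \<partial>R)"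
      by (intro lin ib mdens_integrable mZ; measurable)
    then show "(\<integral>z. indicator A (snd z) * q z \<partial>R) = measure \<nu> A"
      by (simp add: s2[OF A] mdens_snd_indicator[OF mZ A])
    have "integrable R (\<lambda>z. (indicator A (fst z) * (snd z - fst z)) * Z z)"
      unfolding mult.assoc by (intro ib mdens_integrable_increment mZ; measurable)
    from lin[OF this] show "(\<integral>z. indicator A (fst z) * ((snd z - fst z) * q z) \<partial>R) = 0"
      by (simp add: mult.assoc s3[OF A] mdens_martingale_indicator[OF mZ A])
  qed (use qnn iqq in \<open>simp_all del: split_paired_All\<close>)
  have fq: "fin_ent q"
    unfolding fin_ent_def
  proof (intro conjI mq)
    have iqZ: "integrable R (\<lambda>z. q z * ln (Z z))"
      using Bochner_Integration.integrable_add[OF iZ integrable_mult_right[OF is_[of "\<lambda>z. ln (Z z)"], of e]] iZ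
      by (simp add: q_def algebra_simps)
    show "integrable R (\<lambda>z. q z * ln (q z))"
    proof (rule Bochner_Integration.integrable_bound)
      show "integrable R (\<lambda>z. \<bar>q z * ln (Z z)\<bar> + q z * ln 2)"
        using iqZ iqq by simp
      show "AE z in R. norm (q z * ln (q z)) \<le> norm (\<bar>q z * ln (Z z)\<bar> + q z * ln 2)"
        using pos
      proof eventually_elim
        fix z assume z: "0 < Z z"
        have q0: "0 < q z" using qb(1)[of z] z by simp
        have "\<bar>ln (q z) - ln (Z z)\<bar> \<le> ln 2"
        proof -
          have "ln (q z) \<le> ln (2 * Z z)" "ln (Z z / 2) \<le> ln (q z)"
            using qb[of z] z q0 by auto
          then show ?thesis using z by (simp add: ln_mult ln_div)
        qed
        then have "q z * \<bar>ln (q z)\<bar> \<le> q z * (\<bar>ln (Z z)\<bar> + ln 2)"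
          using q0 by (intro mult_left_mono) auto
        then show "norm (q z * ln (q z)) \<le> norm (\<bar>q z * ln (Z z)\<bar> + q z * ln 2)"
          using q0 by (simp add: abs_mult distrib_left)
      qed
    qed measurable
  qed
  have il: "integrable R (\<lambda>z. ln (Z z) * Z z)" using iZ by (simp add: mult.commute)
  show "integrable R (\<lambda>z. s z * ln (Z z))"
    using is_[OF il] by (simp add: mult.commute)
  have "Ent Z \<le> (\<integral>z. q z * ln (Z z) \<partial>R)" by (rule ent_min_log_integral(2)[OF Z pos fq])
  also have "\<dots> = Ent Z + e * (\<integral>z. s z * ln (Z z) \<partial>R)"
    using lin[OF il] by (simp add: mult.commute Ent_def)
  finally show "0 \<le> (\<integral>z. s z * ln (Z z) \<partial>R)"
    using e by (simp add: zero_le_mult_iff)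
qed

end

text \<open>The signed measure F dP, pushed through T, is dominated by C times R on S because T
  carries P to R; Radon-Nikodym then yields a density with the same bound. This converts a mass
  shift on a larger sample space into a perturbation on the target space.\<close>

lemma pushforward_density:
  fixes F :: "'a \<Rightarrow> real" and T :: "'a \<Rightarrow> 'b"
  assumes P: "prob_space P" and R: "prob_space R" and T [measurable]: "T \<in> P \<rightarrow>\<^sub>M R" and dT: "distr P R T = R"
    and F [measurable]: "F \<in> borel_measurable P" and S [measurable]: "S \<in> sets R"
    and C: "0 \<le> C" and bound: "\<And>w. w \<in> space P \<Longrightarrow> \<bar>F w\<bar> \<le> C * indicator S (T w)"
  obtains s where "s \<in> borel_measurable R" "\<And>z. \<bar>s z\<bar> \<le> C * indicator S z"
    "\<And>\<phi>. \<phi> \<in> borel_measurable R \<Longrightarrow> integrable R (\<lambda>z. indicator S z * \<phi> z) \<Longrightarrow>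
      integrable R (\<lambda>z. \<phi> z * s z) \<and> integrable P (\<lambda>w. \<phi> (T w) * F w) \<and>
      (\<integral>z. \<phi> z * s z \<partial>R) = (\<integral>w. \<phi> (T w) * F w \<partial>P)"
proof -
  interpret P: prob_space P by fact
  interpret R: prob_space R by fact
  \<comment> \<open>Adding the bound makes the measure nonnegative; the same term is subtracted
    again in the final density.\<close>
  define F1 where "F1 w = F w + C * indicator S (T w)" for w
  have [measurable]: "F1 \<in> borel_measurable P" unfolding F1_def by measurable
  have F1: "0 \<le> F1 w" "F1 w \<le> 2 * C * indicator S (T w)" if "w \<in> space P" for w
    using bound[OF that] by (auto simp: F1_def abs_le_iff)
  define N where "N = distr (density P (\<lambda>w. ennreal (F1 w))) R T"
  have sN: "sets N = sets R" by (simp add: N_def)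
  have NA: "emeasure N A = (\<integral>\<^sup>+w. ennreal (F1 w) * indicator A (T w) \<partial>P)" if [measurable]: "A \<in> sets R" for A
  proof -
    have "emeasure N A = (\<integral>\<^sup>+w. ennreal (F1 w) * indicator (T -` A \<inter> space P) w \<partial>P)"
      unfolding N_def by (subst emeasure_distr) (auto simp: emeasure_density)
    also have "\<dots> = (\<integral>\<^sup>+w. ennreal (F1 w) * indicator A (T w) \<partial>P)"
      by (intro nn_integral_cong) (auto simp: indicator_def)
    finally show ?thesis .
  qed
  have NA_le: "emeasure N A \<le> (\<integral>\<^sup>+z\<in>A. ennreal (2 * C * indicator S z) \<partial>R)" if A [measurable]: "A \<in> sets R" for A
  proof -
    have "emeasure N A \<le> (\<integral>\<^sup>+w. ennreal (2 * C * indicator S (T w)) * indicator A (T w) \<partial>P)"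
      unfolding NA[OF A] by (intro nn_integral_mono mult_right_mono ennreal_leI F1) auto
    also have "\<dots> = (\<integral>\<^sup>+z. ennreal (2 * C * indicator S z) * indicator A z \<partial>distr P R T)"
      by (subst nn_integral_distr) auto
    finally show ?thesis by (simp add: dT)
  qed
  have ac: "absolutely_continuous R N"
    unfolding absolutely_continuous_def
  proof
    fix A assume A: "A \<in> null_sets R"
    then have [measurable]: "A \<in> sets R" by auto
    have "(\<integral>\<^sup>+z\<in>A. ennreal (2 * C * indicator S z) \<partial>R) = 0"
      using A by (rule nn_integral_null_set)
    with NA_le[of A] sN show "A \<in> null_sets N" by (auto simp: null_sets_def)
  qed
  define t where "t = RN_deriv R N"
  have t [measurable]: "t \<in> borel_measurable R" by (simp add: t_def)
  have dt: "density R t = N" unfolding t_def by (rule R.density_RN_deriv[OF ac sN])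
  define u where "u z = enn2real (t z)" for z
  have [measurable]: "u \<in> borel_measurable R" unfolding u_def by measurable
  have unn: "0 \<le> u z" for z by (simp add: u_def)
  have "(\<integral>\<^sup>+z. t z \<partial>R) \<noteq> \<infinity>"
  proof -
    have "(\<integral>\<^sup>+z. t z \<partial>R) = emeasure N (space R)"
      unfolding dt[symmetric] by (subst emeasure_density) (auto intro!: nn_integral_cong)
    also have "\<dots> \<le> (\<integral>\<^sup>+z\<in>space R. ennreal (2 * C * indicator S z) \<partial>R)" by (rule NA_le) simp
    also have "\<dots> \<le> (\<integral>\<^sup>+z. ennreal (2 * C) \<partial>R)"
      using C by (intro nn_integral_mono) (auto simp: indicator_def)
    also have "\<dots> < \<infinity>" by (simp add: R.emeasure_space_1)
    finally show ?thesis by simp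
  qed
  then have "AE z in R. t z \<noteq> \<infinity>" by (intro nn_integral_PInf_AE t)
  then have tu: "AE z in R. ennreal (u z) = t z"
    by eventually_elim (simp add: u_def less_top)
  have iS: "integrable R (\<lambda>z. 2 * C * indicator S z)" by (intro integrable_mult_right) (simp add: R.emeasure_eq_measure)
  have du: "density R (\<lambda>z. ennreal (u z)) = N"
    unfolding dt[symmetric] using tu by (intro density_cong) auto
  have iu: "integrable R u"
  proof (rule integrableI_nonneg)
    have "(\<integral>\<^sup>+z. ennreal (u z) \<partial>R) = (\<integral>\<^sup>+z. t z \<partial>R)" using tu by (rule nn_integral_cong_AE)
    then show "(\<integral>\<^sup>+z. ennreal (u z) \<partial>R) < \<infinity>"
      using \<open>(\<integral>\<^sup>+z. t z \<partial>R) \<noteq> \<infinity>\<close> by (simp add: less_top)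
  qed (auto simp: unn)
  have u_le: "AE z in R. 0 \<le> 2 * C * indicator S z - u z"
  proof (rule R.density_nonneg)
    show "integrable R (\<lambda>z. 2 * C * indicator S z - u z)"
      by (intro Bochner_Integration.integrable_diff iS iu)
    fix A assume A [measurable]: "A \<in> sets R"
    have i1: "integrable R (\<lambda>z. indicator A z * u z)" "integrable R (\<lambda>z. indicator A z * (2 * C * indicator S z))"
      using integrable_mult_indicator[OF A iu] integrable_mult_indicator[OF A iS] by simp_all
    have "ennreal (\<integral>z. indicator A z * u z \<partial>R) = (\<integral>\<^sup>+z. ennreal (u z) * indicator A z \<partial>R)"
      using unn by (subst nn_integral_eq_integral[symmetric, OF i1(1)])
        (auto intro!: nn_integral_cong simp: indicator_def)
    also have "\<dots> = emeasure N A" unfolding du[symmetric] by (subst emeasure_density) auto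
    also have "\<dots> \<le> (\<integral>\<^sup>+z\<in>A. ennreal (2 * C * indicator S z) \<partial>R)" by (rule NA_le[OF A])
    also have "\<dots> = ennreal (\<integral>z. indicator A z * (2 * C * indicator S z) \<partial>R)"
      using C by (subst nn_integral_eq_integral[symmetric, OF i1(2)])
        (auto intro!: nn_integral_cong simp: indicator_def)
    finally have "(\<integral>z. indicator A z * u z \<partial>R) \<le> (\<integral>z. indicator A z * (2 * C * indicator S z) \<partial>R)"
      using C by (subst (asm) ennreal_le_iff) (auto intro!: integral_nonneg_AE AE_I2)
    then show "0 \<le> (LINT z:A|R. 2 * C * indicator S z - u z)"
      using i1 by (simp add: set_lebesgue_integral_def right_diff_distrib)
  qed
  \<comment> \<open>The bound on \<open>u\<close> is known almost everywhere; truncation makes it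
    hold at every point without changing the measure.\<close>
  define v where "v z = min (u z) (2 * C * indicator S z)" for z
  have [measurable]: "v \<in> borel_measurable R" unfolding v_def by measurable
  have v: "0 \<le> v z" "v z \<le> 2 * C * indicator S z" for z using unn C by (auto simp: v_def)
  have dv: "density R (\<lambda>z. ennreal (v z)) = N"
    unfolding du[symmetric] using u_le by (intro density_cong) (auto simp: v_def min_def elim!: eventually_mono)
  show thesis
  proof (rule that)
    show "(\<lambda>z. v z - C * indicator S z) \<in> borel_measurable R" by measurable
    show "\<bar>v z - C * indicator S z\<bar> \<le> C * indicator S z" for z
      using v[of z] by (auto simp: abs_le_iff)
    fix \<phi> :: "'b \<Rightarrow> real" assume \<phi> [measurable]: "\<phi> \<in> borel_measurable R"
      and i: "integrable R (\<lambda>z. indicator S z * \<phi> z)"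
    have iv: "integrable R (\<lambda>z. v z * \<phi> z)"
    proof (rule Bochner_Integration.integrable_bound[OF integrable_mult_right[OF i, of "2 * C"]])
      show "AE z in R. norm (v z * \<phi> z) \<le> norm (2 * C * (indicator S z * \<phi> z))"
      proof (rule AE_I2)
        fix z
        have "v z * \<bar>\<phi> z\<bar> \<le> (2 * C * indicator S z) * \<bar>\<phi> z\<bar>" by (intro mult_right_mono v) simp
        then show "norm (v z * \<phi> z) \<le> norm (2 * C * (indicator S z * \<phi> z))"
          using v(1)[of z] C by (simp add: abs_mult mult.assoc)
      qed
    qed measurable
    have N1: "integrable N \<phi> \<longleftrightarrow> integrable R (\<lambda>z. v z * \<phi> z)" "(\<integral>z. \<phi> z \<partial>N) = (\<integral>z. v z * \<phi> z \<partial>R)"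
      unfolding dv[symmetric] using v(1) by (simp_all add: integrable_density integral_density)
    have N2: "integrable N \<phi> \<longleftrightarrow> integrable P (\<lambda>w. F1 w * \<phi> (T w))" "(\<integral>z. \<phi> z \<partial>N) = (\<integral>w. F1 w * \<phi> (T w) \<partial>P)"
      unfolding N_def using F1(1)
      by (simp_all add: integrable_distr_eq integral_distr integrable_density integral_density)
    have S2: "integrable P (\<lambda>w. indicator S (T w) * \<phi> (T w))"
      "(\<integral>w. indicator S (T w) * \<phi> (T w) \<partial>P) = (\<integral>z. indicator S z * \<phi> z \<partial>R)"
      using i integrable_distr_eq[OF T, of "\<lambda>z. indicator S z * \<phi> z"] integral_distr[OF T, of "\<lambda>z. indicator S z * \<phi> z"]
      by (simp_all add: dT)
    have eq1: "(\<lambda>z. \<phi> z * (v z - C * indicator S z)) = (\<lambda>z. v z * \<phi> z - C * (indicator S z * \<phi> z))"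
      by (auto simp: algebra_simps)
    have eq2: "(\<lambda>w. \<phi> (T w) * F w) = (\<lambda>w. F1 w * \<phi> (T w) - C * (indicator S (T w) * \<phi> (T w)))"
      by (auto simp: algebra_simps F1_def)
    have iP: "integrable P (\<lambda>w. F1 w * \<phi> (T w))" using iv N1(1) N2(1) by simp
    show "integrable R (\<lambda>z. \<phi> z * (v z - C * indicator S z)) \<and> integrable P (\<lambda>w. \<phi> (T w) * F w) \<and>
      (\<integral>z. \<phi> z * (v z - C * indicator S z) \<partial>R) = (\<integral>w. \<phi> (T w) * F w \<partial>P)"
      unfolding eq1 eq2 using iv i iP S2 N1(2) N2(2)
      by (simp add: Bochner_Integration.integrable_diff Bochner_Integration.integral_diff)
  qed
qed

section \<open>The form of the optimal density\<close>

lemma distr_pair_snd: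
  assumes "prob_space M" "sigma_finite_measure N"
  shows "distr (M \<Otimes>\<^sub>M N) N snd = N"
proof (rule measure_eqI)
  interpret M: prob_space M by fact
  interpret N: sigma_finite_measure N by fact
  fix A assume "A \<in> sets (distr (M \<Otimes>\<^sub>M N) N snd)"
  then have A [measurable]: "A \<in> sets N" by simp
  have "emeasure (distr (M \<Otimes>\<^sub>M N) N snd) A = emeasure (M \<Otimes>\<^sub>M N) (space M \<times> A)"
    using sets.sets_into_space[OF A]
    by (subst emeasure_distr) (auto simp: space_pair_measure intro!: arg_cong2[where f=emeasure])
  then show "emeasure (distr (M \<Otimes>\<^sub>M N) N snd) A = emeasure N A"
    by (simp add: N.emeasure_pair_measure_Times M.emeasure_space_1)
qed simp

context marginals
begin

section \<open>Configurations of two independent x-points and three independent y-points\<close>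

abbreviation MM :: "(real \<times> real) measure" where "MM \<equiv> \<mu> \<Otimes>\<^sub>M \<mu>"
abbreviation NN :: "(real \<times> real) measure" where "NN \<equiv> \<nu> \<Otimes>\<^sub>M \<nu>"
abbreviation NNN :: "(real \<times> real \<times> real) measure" where "NNN \<equiv> \<nu> \<Otimes>\<^sub>M NN"
abbreviation PP :: "((real \<times> real) \<times> (real \<times> real \<times> real)) measure" where "PP \<equiv> MM \<Otimes>\<^sub>M NNN"

lemma prob_products: "prob_space MM" "prob_space NN" "prob_space NNN" "prob_space PP"
  by (intro prob_space_pair prob_mu prob_nu)+

lemma space_products [simp]: "space MM = UNIV" "space NN = UNIV" "space NNN = UNIV" "space PP = UNIV"
  by (simp_all add: space_pair_measure)

text \<open>Each of the six corners of a configuration has law \<open>R\<close>, which is what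
  \<open>pushforward_density\<close> asks of T.\<close>

lemma distr_evaluation:
  assumes a: "a \<in> {fst, snd}" and b: "b \<in> {fst, \<lambda>v. fst (snd v), \<lambda>v. snd (snd v)}"
  shows "(\<lambda>w. (a (fst w), b (snd w))) \<in> PP \<rightarrow>\<^sub>M R"
    and "distr PP R (\<lambda>w. (a (fst w), b (snd w))) = R"
proof -
  have sN: "sigma_finite_measure NN" "sigma_finite_measure NNN"
    using prob_products by (auto intro: prob_space_imp_sigma_finite)
  have am [measurable]: "a \<in> MM \<rightarrow>\<^sub>M \<mu>" using a by auto
  have bm [measurable]: "b \<in> NNN \<rightarrow>\<^sub>M \<nu>" using b by auto
  show "(\<lambda>w. (a (fst w), b (snd w))) \<in> PP \<rightarrow>\<^sub>M R" by measurable
  have da: "distr MM \<mu> a = \<mu>"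
    using a M.distr_pair_fst[of \<mu>] distr_pair_snd[OF prob_mu M.sigma_finite_measure_axioms] by auto
  have s: "distr NNN NN snd = NN" by (rule distr_pair_snd[OF prob_nu sN(1)])
  have c: "distr NNN \<nu> (\<lambda>v. f (snd v)) = distr NN \<nu> f" if "f \<in> NN \<rightarrow>\<^sub>M \<nu>" for f
    using distr_distr[OF that, of snd NNN] by (simp add: s comp_def)
  have "distr NNN \<nu> fst = \<nu>"
    using prob_space.distr_pair_fst[OF prob_products(2), of \<nu>] .
  moreover have "distr NN \<nu> fst = \<nu>" by (rule N.distr_pair_fst)
  moreover have "distr NN \<nu> snd = \<nu>" by (rule distr_pair_snd[OF prob_nu N.sigma_finite_measure_axioms])
  ultimately have db: "distr NNN \<nu> b = \<nu>"
    using b c[of fst] c[of snd] by auto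
  have "distr MM \<mu> a \<Otimes>\<^sub>M distr NNN \<nu> b = distr PP R (\<lambda>(x, y). (a x, b y))"
    by (rule pair_measure_distr[OF am bm]) (simp add: db N.sigma_finite_measure_axioms)
  then show "distr PP R (\<lambda>w. (a (fst w), b (snd w))) = R"
    by (simp add: da db case_prod_unfold)
qed

text \<open>The determinant that vanishes identically iff \<open>y \<mapsto> L (x, y) - L (x0, y)\<close> is affine.\<close>

definition affine_defect :: "(real \<times> real \<Rightarrow> real) \<Rightarrow> (real \<times> real) \<times> (real \<times> real \<times> real) \<Rightarrow> real" where
  "affine_defect L = (\<lambda>((x0, x), (y1, y2, y3)).
     (y3 - y2) * (L (x, y1) - L (x0, y1)) + (y1 - y3) * (L (x, y2) - L (x0, y2))
     + (y2 - y1) * (L (x, y3) - L (x0, y3)))"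

text \<open>Here 1 / n \<le> Z \<le> n bounds |ln Z| by ln n and makes the indicator at most n Z;
  the bounds on the coordinates control the weights y_i - y_j and the increment y - x.\<close>

definition good :: "(real \<times> real \<Rightarrow> real) \<Rightarrow> real \<Rightarrow> (real \<times> real) set" where
  "good Z n = {z. 1 \<le> n * Z z \<and> Z z \<le> n \<and> \<bar>fst z\<bar> \<le> n \<and> \<bar>snd z\<bar> \<le> n}"

text \<open>All six corners share one factor, so the weights still cancel after truncation.\<close>

definition cutoff :: "(real \<times> real) set \<Rightarrow> (real \<times> real) \<times> (real \<times> real \<times> real) \<Rightarrow> real" where
  "cutoff S = (\<lambda>((x0, x), (y1, y2, y3)).
     indicator S (x0, y1) * indicator S (x0, y2) * indicator S (x0, y3)
     * indicator S (x, y1) * indicator S (x, y2) * indicator S (x, y3))"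

text \<open>Shifting mass along \<open>affine_defect\<close> changes neither marginal nor the barycenters, because the
  weights satisfy \<open>\<Sum> \<lambda>i = 0\<close> and \<open>\<Sum> \<lambda>i yi = 0\<close>; so the first-order condition applies to it.\<close>

lemma affine_defect_test:
  assumes Z: "ent_min Z" and pos: "AE z in R. 0 < Z z"
    and n: "1 \<le> n"
    and c [measurable]: "c \<in> borel_measurable PP" and c1: "\<And>w. \<bar>c w\<bar> \<le> 1"
  shows "integrable PP (\<lambda>w. c w * cutoff (good Z n) w * affine_defect (\<lambda>z. ln (Z z)) w)"
    and "0 \<le> (\<integral>w. c w * cutoff (good Z n) w * affine_defect (\<lambda>z. ln (Z z)) w \<partial>PP)"
proof -
  define S where "S = good Z n"
  define G where "G = cutoff S"
  note S_eq = S_def[unfolded good_def] and G_eq = G_def[unfolded cutoff_def]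
  have mZ: "mdens Z" using Z by (auto simp: ent_min_def fin_ent_def)
  note [measurable] = mdens_measurable[OF mZ]
  have n0: "0 \<le> n" using n by simp
  define L where "L z = ln (Z z)" for z
  have Lm [measurable]: "L \<in> borel_measurable (borel \<Otimes>\<^sub>M borel)" unfolding L_def by measurable
  have Sm [measurable]: "S \<in> sets (borel \<Otimes>\<^sub>M borel)"
  proof -
    have "{z \<in> space (borel \<Otimes>\<^sub>M borel). 1 \<le> n * Z z \<and> Z z \<le> n \<and> \<bar>fst z\<bar> \<le> n \<and> \<bar>snd z\<bar> \<le> n}
        \<in> sets (borel \<Otimes>\<^sub>M borel)" by measurable
    then show ?thesis by (simp add: S_eq space_pair_measure)
  qed
  have SR: "S \<in> sets R" using Sm by (simp add: sets_R sets_borel_pair)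
  have Gm [measurable]: "G \<in> borel_measurable PP" unfolding G_eq case_prod_unfold by measurable
  define W where "W w = c w * G w" for w
  have Wm [measurable]: "W \<in> borel_measurable PP" unfolding W_def by measurable
  \<comment> \<open>\<open>Q J s\<close> says that s is a bounded density, supported in
    \<open>S\<close>, of the signed measure whose integral of \<phi> is the integral of
    \<open>J \<phi>\<close> over configurations.\<close>
  define Q where "Q J s \<longleftrightarrow> s \<in> borel_measurable (borel \<Otimes>\<^sub>M borel) \<and> (\<forall>z. \<bar>s z\<bar> \<le> 2 * n * indicator S z) \<and>
    (\<forall>\<phi>. \<phi> \<in> borel_measurable (borel \<Otimes>\<^sub>M borel) \<longrightarrow> integrable R (\<lambda>z. indicator S z * \<phi> z) \<longrightarrow>
      integrable R (\<lambda>z. \<phi> z * s z) \<and> integrable PP (J \<phi>) \<and> (\<integral>z. \<phi> z * s z \<partial>R) = (\<integral>w. J \<phi> w \<partial>PP))"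
    for J :: "(real \<times> real \<Rightarrow> real) \<Rightarrow> (real \<times> real) \<times> (real \<times> real \<times> real) \<Rightarrow> real" and s
  have push: "\<exists>s. Q (\<lambda>\<phi> w. \<phi> (a (fst w), b (snd w)) * (l (snd w) * W w)) s"
    if a: "a \<in> {fst, snd}" and b: "b \<in> {fst, \<lambda>v. fst (snd v), \<lambda>v. snd (snd v)}"
      and l: "l \<in> {\<lambda>v. snd (snd v) - fst (snd v), \<lambda>v. fst v - snd (snd v), \<lambda>v. fst (snd v) - fst v,
        \<lambda>v. - (snd (snd v) - fst (snd v)), \<lambda>v. - (fst v - snd (snd v)), \<lambda>v. - (fst (snd v) - fst v)}" for a b l
  proof -
    have lm [measurable]: "l \<in> borel_measurable NNN" using l by auto
    have bd: "\<bar>l (snd w) * W w\<bar> \<le> 2 * n * indicator S (a (fst w), b (snd w))" for w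
    proof -
      obtain x0 x y1 y2 y3 where w: "w = ((x0, x), (y1, y2, y3))" by (metis surj_pair)
      show ?thesis
      proof (cases "G w = 0")
        case False
        then have s: "(x0, y1) \<in> S" "(x0, y2) \<in> S" "(x0, y3) \<in> S" "(x, y1) \<in> S" "(x, y2) \<in> S" "(x, y3) \<in> S"
          unfolding w G_eq by (auto simp: indicator_def split: if_splits)
        have G1: "G w = 1" unfolding w G_eq using s by simp
        have y: "\<bar>y1\<bar> \<le> n" "\<bar>y2\<bar> \<le> n" "\<bar>y3\<bar> \<le> n" using s by (auto simp: S_eq)
        have "\<bar>l (snd w)\<bar> \<le> 2 * n" using l y by (auto simp: w abs_le_iff)
        then have "\<bar>l (snd w)\<bar> * \<bar>c w\<bar> \<le> (2 * n) * 1" by (intro mult_mono c1) (use n0 in auto)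
        moreover have "(a (fst w), b (snd w)) \<in> S" using a b s by (auto simp: w)
        ultimately show ?thesis by (simp add: W_def G1 abs_mult)
      qed (use n0 in \<open>simp add: W_def\<close>)
    qed
    obtain s where s: "s \<in> borel_measurable R" "\<And>z. \<bar>s z\<bar> \<le> 2 * n * indicator S z"
      "\<And>\<phi>. \<phi> \<in> borel_measurable R \<Longrightarrow> integrable R (\<lambda>z. indicator S z * \<phi> z) \<Longrightarrow>
        integrable R (\<lambda>z. \<phi> z * s z) \<and> integrable PP (\<lambda>w. \<phi> (a (fst w), b (snd w)) * (l (snd w) * W w)) \<and>
        (\<integral>z. \<phi> z * s z \<partial>R) = (\<integral>w. \<phi> (a (fst w), b (snd w)) * (l (snd w) * W w) \<partial>PP)"
      by (rule pushforward_density[OF prob_products(4) R.prob_space_axioms distr_evaluation[OF a b],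
            where F="\<lambda>w. l (snd w) * W w" and S=S and C="2 * n"]) (use SR n0 bd in auto)
    have bR: "borel_measurable R = borel_measurable (borel \<Otimes>\<^sub>M borel)"
      by (rule measurable_cong_sets) (simp_all add: sets_R sets_borel_pair)
    show ?thesis
      unfolding Q_def using s unfolding bR by blast
  qed
  \<comment> \<open>One density per corner: the weights y3 - y2, y1 - y3, y2 - y1 at x and their
    negatives at x0, each multiplied by \<open>W\<close>.\<close>
  have "\<exists>s. Q (\<lambda>\<phi> w. \<phi> (snd (fst w), fst (snd w)) * ((snd (snd (snd w)) - fst (snd (snd w))) * W w)) s"
    by (rule push) auto
  then obtain s1 where s1: "Q (\<lambda>\<phi> w. \<phi> (snd (fst w), fst (snd w)) * ((snd (snd (snd w)) - fst (snd (snd w))) * W w)) s1" by blast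
  have "\<exists>s. Q (\<lambda>\<phi> w. \<phi> (fst (fst w), fst (snd w)) * (- (snd (snd (snd w)) - fst (snd (snd w))) * W w)) s"
    by (rule push) auto
  then obtain s2 where s2: "Q (\<lambda>\<phi> w. \<phi> (fst (fst w), fst (snd w)) * (- (snd (snd (snd w)) - fst (snd (snd w))) * W w)) s2" by blast
  have "\<exists>s. Q (\<lambda>\<phi> w. \<phi> (snd (fst w), fst (snd (snd w))) * ((fst (snd w) - snd (snd (snd w))) * W w)) s"
    by (rule push) auto
  then obtain s3 where s3: "Q (\<lambda>\<phi> w. \<phi> (snd (fst w), fst (snd (snd w))) * ((fst (snd w) - snd (snd (snd w))) * W w)) s3" by blast
  have "\<exists>s. Q (\<lambda>\<phi> w. \<phi> (fst (fst w), fst (snd (snd w))) * (- (fst (snd w) - snd (snd (snd w))) * W w)) s"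
    by (rule push) auto
  then obtain s4 where s4: "Q (\<lambda>\<phi> w. \<phi> (fst (fst w), fst (snd (snd w))) * (- (fst (snd w) - snd (snd (snd w))) * W w)) s4" by blast
  have "\<exists>s. Q (\<lambda>\<phi> w. \<phi> (snd (fst w), snd (snd (snd w))) * ((fst (snd (snd w)) - fst (snd w)) * W w)) s"
    by (rule push) auto
  then obtain s5 where s5: "Q (\<lambda>\<phi> w. \<phi> (snd (fst w), snd (snd (snd w))) * ((fst (snd (snd w)) - fst (snd w)) * W w)) s5" by blast
  have "\<exists>s. Q (\<lambda>\<phi> w. \<phi> (fst (fst w), snd (snd (snd w))) * (- (fst (snd (snd w)) - fst (snd w)) * W w)) s"
    by (rule push) auto
  then obtain s6 where s6: "Q (\<lambda>\<phi> w. \<phi> (fst (fst w), snd (snd (snd w))) * (- (fst (snd (snd w)) - fst (snd w)) * W w)) s6" by blast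
  note ss = s1 s2 s3 s4 s5 s6
  define s where "s z = s1 z + s2 z + s3 z + s4 z + s5 z + s6 z" for z
  have [measurable]: "s1 \<in> borel_measurable (borel \<Otimes>\<^sub>M borel)" "s2 \<in> borel_measurable (borel \<Otimes>\<^sub>M borel)"
     "s3 \<in> borel_measurable (borel \<Otimes>\<^sub>M borel)" "s4 \<in> borel_measurable (borel \<Otimes>\<^sub>M borel)"
     "s5 \<in> borel_measurable (borel \<Otimes>\<^sub>M borel)" "s6 \<in> borel_measurable (borel \<Otimes>\<^sub>M borel)"
    using ss unfolding Q_def by blast+
  have sm [measurable]: "s \<in> borel_measurable (borel \<Otimes>\<^sub>M borel)" unfolding s_def by measurable
  define J where "J \<phi> = (\<lambda>((x0, x), (y1, y2, y3)). ((y3 - y2) * (\<phi> (x, y1) - \<phi> (x0, y1))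
      + (y1 - y3) * (\<phi> (x, y2) - \<phi> (x0, y2)) + (y2 - y1) * (\<phi> (x, y3) - \<phi> (x0, y3))) * W ((x0, x), (y1, y2, y3)))"
    for \<phi> :: "real \<times> real \<Rightarrow> real"
  have main: "integrable PP (J \<phi>)" "(\<integral>z. \<phi> z * s z \<partial>R) = (\<integral>w. J \<phi> w \<partial>PP)"
    if \<phi>: "\<phi> \<in> borel_measurable (borel \<Otimes>\<^sub>M borel)" and K: "\<And>z. z \<in> S \<Longrightarrow> \<bar>\<phi> z\<bar> \<le> K" for \<phi> K
  proof -
    note [measurable] = \<phi>
    have "integrable R (\<lambda>z. indicator S z * \<phi> z)"
    proof (rule R.integrable_const_bound)
      show "AE z in R. norm (indicator S z * \<phi> z) \<le> \<bar>K\<bar>"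
      proof (rule AE_I2)
        fix z show "norm (indicator S z * \<phi> z) \<le> \<bar>K\<bar>"
          using K[of z] by (cases "z \<in> S") auto
      qed
    qed measurable
    with ss \<phi> have q: "integrable R (\<lambda>z. \<phi> z * s' z)"
        "integrable PP (J' \<phi>)" "(\<integral>z. \<phi> z * s' z \<partial>R) = (\<integral>w. J' \<phi> w \<partial>PP)" if "Q J' s'" for J' s'
      using that unfolding Q_def by blast+
    have J: "J \<phi> = (\<lambda>w. \<phi> (snd (fst w), fst (snd w)) * ((snd (snd (snd w)) - fst (snd (snd w))) * W w)
       + \<phi> (fst (fst w), fst (snd w)) * (- (snd (snd (snd w)) - fst (snd (snd w))) * W w)
       + \<phi> (snd (fst w), fst (snd (snd w))) * ((fst (snd w) - snd (snd (snd w))) * W w)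
       + \<phi> (fst (fst w), fst (snd (snd w))) * (- (fst (snd w) - snd (snd (snd w))) * W w)
       + \<phi> (snd (fst w), snd (snd (snd w))) * ((fst (snd (snd w)) - fst (snd w)) * W w)
       + \<phi> (fst (fst w), snd (snd (snd w))) * (- (fst (snd (snd w)) - fst (snd w)) * W w))"
      by (auto simp: J_def fun_eq_iff algebra_simps)
    note qs = q[OF s1] q[OF s2] q[OF s3] q[OF s4] q[OF s5] q[OF s6]
    show "integrable PP (J \<phi>)"
      unfolding J by (intro Bochner_Integration.integrable_add qs)
    show "(\<integral>z. \<phi> z * s z \<partial>R) = (\<integral>w. J \<phi> w \<partial>PP)"
      unfolding J s_def distrib_left
      by (simp only: qs Bochner_Integration.integral_add Bochner_Integration.integrable_add)
  qed
  \<comment> \<open>Six densities, each at most 2 n on \<open>S\<close>, and the indicator of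
    \<open>S\<close> is at most n Z.\<close>
  have bound: "\<bar>s z\<bar> \<le> (12 * n * n) * Z z" for z
  proof -
    have b: "\<bar>s' z\<bar> \<le> 2 * n * indicator S z" if "Q J' s'" for J' s'
      using that unfolding Q_def by blast
    have "\<bar>s z\<bar> \<le> \<bar>s1 z\<bar> + \<bar>s2 z\<bar> + \<bar>s3 z\<bar> + \<bar>s4 z\<bar> + \<bar>s5 z\<bar> + \<bar>s6 z\<bar>" unfolding s_def by linarith
    also have "\<dots> \<le> 12 * n * indicator S z"
      using b[OF s1] b[OF s2] b[OF s3] b[OF s4] b[OF s5] b[OF s6] by linarith
    also have "\<dots> \<le> 12 * n * (n * Z z)"
      using n0 mdens_nonneg[OF mZ, of z] by (intro mult_left_mono) (auto simp: indicator_def S_eq)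
    finally show ?thesis by (simp add: mult.assoc)
  qed
  \<comment> \<open>The first vanishes because the weights sum to 0, the second because x and x0
    carry opposite weights at each yi, the third because the weights and also their products with
    the yi sum to 0.\<close>
  have J0: "J (\<lambda>z. indicator A (fst z)) = (\<lambda>_. 0)" "J (\<lambda>z. indicator A (snd z)) = (\<lambda>_. 0)"
    "J (\<lambda>z. indicator A (fst z) * (snd z - fst z)) = (\<lambda>_. 0)" for A
    by (auto simp: J_def fun_eq_iff algebra_simps)
  have c1': "(\<integral>z. indicator A (fst z) * s z \<partial>R) = 0" if [measurable]: "A \<in> sets borel" for A
  proof -
    have "(\<integral>z. indicator A (fst z) * s z \<partial>R) = (\<integral>w. J (\<lambda>z. indicator A (fst z)) w \<partial>PP)"
      by (rule main(2)[of "\<lambda>z. indicator A (fst z)" 1]) (auto simp: indicator_def)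
    then show ?thesis by (simp only: J0 integral_zero)
  qed
  have c2': "(\<integral>z. indicator A (snd z) * s z \<partial>R) = 0" if [measurable]: "A \<in> sets borel" for A
  proof -
    have "(\<integral>z. indicator A (snd z) * s z \<partial>R) = (\<integral>w. J (\<lambda>z. indicator A (snd z)) w \<partial>PP)"
      by (rule main(2)[of "\<lambda>z. indicator A (snd z)" 1]) (auto simp: indicator_def)
    then show ?thesis by (simp only: J0 integral_zero)
  qed
  have c3': "(\<integral>z. indicator A (fst z) * ((snd z - fst z) * s z) \<partial>R) = 0" if [measurable]: "A \<in> sets borel" for A
  proof -
    have "(\<integral>z. indicator A (fst z) * (snd z - fst z) * s z \<partial>R)
        = (\<integral>w. J (\<lambda>z. indicator A (fst z) * (snd z - fst z)) w \<partial>PP)"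
      by (rule main(2)[of "\<lambda>z. indicator A (fst z) * (snd z - fst z)" "2 * n"]) (use n0 in \<open>auto simp: indicator_def S_eq abs_le_iff\<close>)
    then show ?thesis by (simp only: J0 integral_zero mult.assoc)
  qed
  have JL: "J L = (\<lambda>w. c w * G w * affine_defect (\<lambda>z. ln (Z z)) w)"
    by (auto simp: J_def affine_defect_def W_def L_def fun_eq_iff)
  have Lb: "\<bar>L z\<bar> \<le> ln n" if "z \<in> S" for z
  proof -
    have z: "1 \<le> n * Z z" "Z z \<le> n" using that by (auto simp: S_eq)
    have Z0: "0 < Z z" using z(1) n0 by (metis less_le_not_le mult_nonneg_nonpos not_le order.trans zero_less_one)
    have "ln (Z z) \<le> ln n" using z Z0 n by simp
    moreover have "0 \<le> ln (n * Z z)" using z by simp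
    then have "0 \<le> ln n + ln (Z z)" using Z0 n by (simp add: ln_mult)
    ultimately show ?thesis by (simp add: L_def abs_le_iff)
  qed
  show "integrable PP (\<lambda>w. c w * cutoff (good Z n) w * affine_defect (\<lambda>z. ln (Z z)) w)"
    using main(1)[OF Lm Lb] unfolding JL G_def S_def by blast
  have "0 \<le> (\<integral>z. s z * ln (Z z) \<partial>R)"
    by (rule ent_min_perturbation(2)[OF Z pos sm _ bound c1' c2' c3']) (use n in auto)
  also have "\<dots> = (\<integral>w. c w * G w * affine_defect (\<lambda>z. ln (Z z)) w \<partial>PP)"
    using main(2)[OF Lm Lb] unfolding JL by (simp add: L_def mult.commute)
  finally have "0 \<le> (\<integral>w. c w * G w * affine_defect (\<lambda>z. ln (Z z)) w \<partial>PP)" .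
  then show "0 \<le> (\<integral>w. c w * cutoff (good Z n) w * affine_defect (\<lambda>z. ln (Z z)) w \<partial>PP)"
    by (simp add: G_def S_def)
qed

lemma affine_defect_eq_0:
  assumes Z: "ent_min Z" and pos: "AE z in R. 0 < Z z"
  shows "AE w in PP. affine_defect (\<lambda>z. ln (Z z)) w = 0"
proof -
  have mZ: "mdens Z" using Z by (auto simp: ent_min_def fin_ent_def)
  note [measurable] = mdens_measurable[OF mZ]
  define D where "D = affine_defect (\<lambda>z. ln (Z z))"
  have [measurable]: "D \<in> borel_measurable PP"
    unfolding D_def affine_defect_def case_prod_unfold by measurable
  define S where "S n = good Z (real (Suc n))" for n
  define G where "G n = cutoff (S n)" for n
  have Gnn: "0 \<le> G n w" for n w by (auto simp: G_def cutoff_def split: prod.splits)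
  have "AE w in PP. \<bar>D w\<bar> * G n w = 0" for n
  proof -
    \<comment> \<open>Testing with minus the sign of the defect turns
      \<open>affine_defect_test\<close> into the statement that |D| has a nonpositive integral over
      the truncated region.\<close>
    have sgn: "(\<lambda>w. - sgn (D w)) \<in> borel_measurable PP" by measurable
    have "\<bar>- sgn (D w)\<bar> \<le> 1" for w by (simp add: sgn_if)
    note T = affine_defect_test[OF Z pos _ sgn this, of "real (Suc n)", folded S_def G_def D_def]
    have eq: "- sgn (D w) * G n w * D w = - (\<bar>D w\<bar> * G n w)" for w by (simp add: sgn_if)
    have i: "integrable PP (\<lambda>w. \<bar>D w\<bar> * G n w)"
      using T(1) unfolding eq by simp
    have "(\<integral>w. \<bar>D w\<bar> * G n w \<partial>PP) \<le> 0"
      using T(2) unfolding eq by simp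
    moreover have "0 \<le> (\<integral>w. \<bar>D w\<bar> * G n w \<partial>PP)"
      by (intro integral_nonneg_AE AE_I2 mult_nonneg_nonneg Gnn) simp
    ultimately show ?thesis
      by (subst integral_nonneg_eq_0_iff_AE[symmetric, OF i]) (auto intro!: AE_I2 mult_nonneg_nonneg Gnn)
  qed
  then have A: "AE w in PP. \<forall>n. \<bar>D w\<bar> * G n w = 0" unfolding AE_all_countable by blast
  have B: "AE w in PP. 0 < Z (a (fst w), b (snd w))"
    if "a \<in> {fst, snd}" "b \<in> {fst, \<lambda>v. fst (snd v), \<lambda>v. snd (snd v)}" for a b
    by (rule AE_distrD[OF distr_evaluation(1)[OF that], of "\<lambda>z. 0 < Z z",
          unfolded distr_evaluation(2)[OF that], OF pos])
  have "AE w in PP. 0 < Z (fst (fst w), fst (snd w))" "AE w in PP. 0 < Z (fst (fst w), fst (snd (snd w)))"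
    "AE w in PP. 0 < Z (fst (fst w), snd (snd (snd w)))" "AE w in PP. 0 < Z (snd (fst w), fst (snd w))"
    "AE w in PP. 0 < Z (snd (fst w), fst (snd (snd w)))" "AE w in PP. 0 < Z (snd (fst w), snd (snd (snd w)))"
    by (rule B; simp)+
  with A show ?thesis
  proof eventually_elim
    fix w assume D: "\<forall>n. \<bar>D w\<bar> * G n w = 0"
      and p: "0 < Z (fst (fst w), fst (snd w))" "0 < Z (fst (fst w), fst (snd (snd w)))"
        "0 < Z (fst (fst w), snd (snd (snd w)))" "0 < Z (snd (fst w), fst (snd w))"
        "0 < Z (snd (fst w), fst (snd (snd w)))" "0 < Z (snd (fst w), snd (snd (snd w)))"
    obtain x0 x y1 y2 y3 where w: "w = ((x0, x), (y1, y2, y3))" by (metis surj_pair)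
    define F where "F = {(x0, y1), (x0, y2), (x0, y3), (x, y1), (x, y2), (x, y3)}"
    have F: "finite F" "\<And>z. z \<in> F \<Longrightarrow> 0 < Z z" using p by (auto simp: F_def w)
    \<comment> \<open>A point with Z > 0 lies in \<open>S n\<close> for all large n, so finitely
      many such points lie in a common \<open>S n\<close>.\<close>
    have ev: "\<forall>\<^sub>F n in sequentially. z \<in> S n" if "0 < Z z" for z
    proof -
      obtain N where N: "max (max (1 / Z z) (Z z)) (max \<bar>fst z\<bar> \<bar>snd z\<bar>) < real N"
        using reals_Archimedean2 by blast
      have "z \<in> S n" if "N \<le> n" for n
      proof -
        have "max (max (1 / Z z) (Z z)) (max \<bar>fst z\<bar> \<bar>snd z\<bar>) \<le> real (Suc n)" using N that by simp
        then show ?thesis using \<open>0 < Z z\<close> by (simp add: S_def good_def field_simps)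
      qed
      then show ?thesis by (auto simp: eventually_sequentially)
    qed
    have "\<forall>\<^sub>F n in sequentially. \<forall>z\<in>F. z \<in> S n"
      using F by (intro eventually_ball_finite ballI ev)
    then obtain n where "\<forall>z\<in>F. z \<in> S n" by (auto simp: eventually_sequentially)
    then have "G n w = 1" by (simp add: G_def cutoff_def w F_def)
    with D have "D w = 0" by (metis abs_eq_0 mult_1_right)
    then show "affine_defect (\<lambda>z. ln (Z z)) w = 0" by (simp add: D_def)
  qed
qed

lemma log_density_decomposition:
  assumes Z: "ent_min Z" and pos: "AE z in R. 0 < Z z" and nd: "\<And>c. \<not> (AE y in \<nu>. y = c)"
  obtains f g h :: "real \<Rightarrow> real" where "f \<in> borel_measurable borel" "g \<in> borel_measurable borel"
    "h \<in> borel_measurable borel"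
    "AE z in R. ln (Z z) = f (fst z) + g (snd z) - h (fst z) * (snd z - fst z)"
proof -
  have mZ: "mdens Z" using Z by (auto simp: ent_min_def fin_ent_def)
  note [measurable] = mdens_measurable[OF mZ]
  define L where "L z = ln (Z z)" for z
  have Lm [measurable]: "L \<in> borel_measurable (borel \<Otimes>\<^sub>M borel)" unfolding L_def by measurable
  interpret NN: prob_space NN by (rule prob_products)
  interpret NNN: prob_space NNN by (rule prob_products)
  interpret MM: prob_space MM by (rule prob_products)
  interpret p1: pair_sigma_finite MM NNN ..
  interpret p2: pair_sigma_finite \<mu> \<mu> ..
  interpret p3: pair_sigma_finite \<mu> NNN ..
  interpret p4: pair_sigma_finite \<nu> NN ..
  interpret p5: pair_sigma_finite \<nu> \<nu> ..
  have ex: "\<exists>x. Q x" if "AE x in \<mu>. Q x" for Q using M.AE_False that by (metis eventually_mono)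
  have exN: "\<exists>x. Q x" if "AE x in \<nu>. Q x" for Q using N.AE_False that by (metis eventually_mono)
  have "AE w in PP. affine_defect L w = 0"
    using affine_defect_eq_0[OF Z pos] by (simp add: L_def[abs_def])
  \<comment> \<open>Fubini freezes x0; after an exchange of quantifiers y1 and y2 are frozen as
    well, which leaves the identity for almost every x and y3.\<close>
  from p2.AE_pair[OF p1.AE_pair[OF this]]
  obtain x0 where "AE x in \<mu>. AE v in NNN. affine_defect L ((x0, x), v) = 0"
    using ex by blast
  moreover have [measurable]: "(\<lambda>z. affine_defect L ((x0, fst z), snd z)) \<in> borel_measurable (borel \<Otimes>\<^sub>M (borel \<Otimes>\<^sub>M (borel \<Otimes>\<^sub>M borel)))"
    unfolding affine_defect_def case_prod_unfold fst_conv snd_conv by measurable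
  ultimately have "AE v in NNN. AE x in \<mu>. affine_defect L ((x0, x), v) = 0"
  proof (subst p3.AE_commute[symmetric])
    show "{z \<in> space (\<mu> \<Otimes>\<^sub>M NNN). affine_defect L ((x0, fst z), snd z) = 0} \<in> sets (\<mu> \<Otimes>\<^sub>M NNN)"
      by measurable
  qed
  from p4.AE_pair[OF this] obtain y1 where "AE v in NN. AE x in \<mu>. affine_defect L ((x0, x), (y1, v)) = 0"
    using exN by blast
  from p5.AE_pair[OF this] have ae2: "AE y2 in \<nu>. AE y3 in \<nu>. AE x in \<mu>. affine_defect L ((x0, x), (y1, y2, y3)) = 0" .
  \<comment> \<open>If only y2 = y1 were available, \<nu> would be concentrated at y1. The two
    points must differ because y2 - y1 becomes a denominator.\<close>
  obtain y2 where y12: "y2 \<noteq> y1" and "AE y3 in \<nu>. AE x in \<mu>. affine_defect L ((x0, x), (y1, y2, y3)) = 0"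
  proof (rule ccontr)
    assume "\<not> thesis"
    with that ae2 have "AE y in \<nu>. y = y1" by (metis (mono_tags, lifting) eventually_mono)
    with nd show False by blast
  qed
  moreover have [measurable]: "(\<lambda>z. affine_defect L ((x0, fst z), (y1, y2, snd z))) \<in> borel_measurable (borel \<Otimes>\<^sub>M borel)"
    unfolding affine_defect_def case_prod_unfold fst_conv snd_conv by measurable
  ultimately have "AE x in \<mu>. AE y in \<nu>. affine_defect L ((x0, x), (y1, y2, y)) = 0"
  proof (subst AE_commute)
    show "{z \<in> space R. affine_defect L ((x0, fst z), (y1, y2, snd z)) = 0} \<in> sets R"
      by measurable
  qed
  then have ae: "AE z in R. affine_defect L ((x0, fst z), (y1, y2, snd z)) = 0"
  proof (intro AE_pair_measure)
    show "{z \<in> space R. affine_defect L ((x0, fst z), (y1, y2, snd z)) = 0} \<in> sets R"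
      by measurable
  qed simp
  \<comment> \<open>\<open>a1\<close> and \<open>a2\<close> are the values of L (x, .) - L (x0, .)
    at y1 and y2. The line through them has slope - h x and takes the value f x at y = x.\<close>
  define a1 where "a1 x = L (x, y1) - L (x0, y1)" for x
  define a2 where "a2 x = L (x, y2) - L (x0, y2)" for x
  define h where "h x = (a1 x - a2 x) / (y2 - y1)" for x
  define f where "f x = (y2 * a1 x - y1 * a2 x) / (y2 - y1) - h x * x" for x
  define g where "g y = L (x0, y)" for y
  have [measurable]: "a1 \<in> borel_measurable borel" "a2 \<in> borel_measurable borel"
    unfolding a1_def a2_def by measurable
  have hm [measurable]: "h \<in> borel_measurable borel" unfolding h_def by measurable
  have fm: "f \<in> borel_measurable borel" unfolding f_def by measurable
  have gm: "g \<in> borel_measurable borel" unfolding g_def by measurable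
  have "AE z in R. ln (Z z) = f (fst z) + g (snd z) - h (fst z) * (snd z - fst z)"
    using ae
  proof eventually_elim
    fix z assume "affine_defect L ((x0, fst z), (y1, y2, snd z)) = 0"
    then have "(snd z - y2) * a1 (fst z) + (y1 - snd z) * a2 (fst z) + (y2 - y1) * (L z - g (snd z)) = 0"
      by (simp add: affine_defect_def a1_def a2_def g_def)
    then have "L z = g (snd z) + ((y2 * a1 (fst z) - y1 * a2 (fst z)) - (a1 (fst z) - a2 (fst z)) * snd z) / (y2 - y1)"
      using y12 by (simp add: field_simps)
    also have "\<dots> = f (fst z) + g (snd z) - h (fst z) * (snd z - fst z)"
      by (simp add: f_def h_def diff_divide_distrib add_divide_distrib algebra_simps)
    finally show "ln (Z z) = f (fst z) + g (snd z) - h (fst z) * (snd z - fst z)" by (simp add: L_def)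
  qed
  with fm gm hm show thesis by (rule that)
qed

end

section \<open>Integrability and uniqueness of the potentials\<close>

lemma AE_measure_support:
  fixes M :: "real measure"
  assumes sets: "sets M = sets borel"
  shows "AE x in M. x \<in> measure_support M"
proof -
  \<comment> \<open>A point off the support has a null ball around it, inside which a ball with
    rational centre and radius still covers the point; there are only countably many of
    these.\<close>
  define N where "N = (\<Union>q\<in>\<rat>. \<Union>r\<in>{r \<in> \<rat>. emeasure M (ball q r) = 0}. ball q (r :: real))"
  have "N \<in> null_sets M"
    unfolding N_def
  proof (intro null_sets_UN' countable_rat)
    fix q :: real
    show "countable {r \<in> \<rat>. emeasure M (ball q r) = 0}"
      by (rule countable_subset[OF _ countable_rat]) auto
  qed (auto simp: null_sets_def sets)
  moreover have "x \<in> N" if "x \<notin> measure_support M" for x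
  proof -
    have "\<exists>e>0. \<not> 0 < emeasure M (ball x e)"
      using that unfolding measure_support_def by blast
    then obtain e where e: "0 < e" "emeasure M (ball x e) = 0"
      unfolding not_gr_zero by blast
    obtain q where q: "q \<in> \<rat>" "x < q" "q < x + e / 2" using Rats_dense_in_real[of x "x + e / 2"] e by auto
    obtain r where r: "r \<in> \<rat>" "q - x < r" "r < e / 2" using Rats_dense_in_real[of "q - x" "e / 2"] q by auto
    have "ball q r \<subseteq> ball x e" using q r by (auto simp: dist_real_def)
    then have "emeasure M (ball q r) = 0"
      using e(2) emeasure_mono[of "ball q r" "ball x e" M] by (simp add: sets)
    moreover have "x \<in> ball q r" using q r by (auto simp: dist_real_def)
    ultimately show ?thesis using q r by (auto simp: N_def)
  qed
  ultimately show ?thesis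
    by (metis (mono_tags, lifting) AE_not_in eventually_mono)
qed

text \<open>A is the increasing union of its parts with u \<le> n, so these cannot all be
  null.\<close>

lemma positive_measure_bounded_part:
  fixes u :: "'a \<Rightarrow> real"
  assumes A [measurable]: "A \<in> sets M" and u [measurable]: "u \<in> borel_measurable M" and pos: "0 < emeasure M A"
  obtains n :: nat where "0 < emeasure M {x \<in> A. u x \<le> real n}" "{x \<in> A. u x \<le> real n} \<in> sets M"
proof -
  have B: "{x \<in> A. u x \<le> real n} \<in> sets M" for n
  proof -
    have "{x \<in> space M. x \<in> A \<and> u x \<le> real n} \<in> sets M" by measurable
    moreover have "{x \<in> space M. x \<in> A \<and> u x \<le> real n} = {x \<in> A. u x \<le> real n}"
      using sets.sets_into_space[OF A] by auto
    ultimately show ?thesis by simp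
  qed
  have "\<exists>n. 0 < emeasure M {x \<in> A. u x \<le> real n}"
  proof (rule ccontr)
    assume "\<not> ?thesis"
    then have "{x \<in> A. u x \<le> real n} \<in> null_sets M" for n
      using B by (auto simp: null_sets_def)
    then have "(\<Union>n. {x \<in> A. u x \<le> real n}) \<in> null_sets M" by (intro null_sets_UN) auto
    moreover have "(\<Union>n. {x \<in> A. u x \<le> real n}) = A" using real_arch_simple by auto
    ultimately show False using pos by (auto simp: null_sets_def)
  qed
  with B show thesis using that by blast
qed

lemma AE_eq_const_imp_return:
  fixes M :: "real measure"
  assumes "prob_space M" "sets M = sets borel" "AE x in M. x = c"
  shows "M = return borel c"
proof (rule measure_eqI)
  interpret prob_space M by fact
  fix A assume A: "A \<in> sets M"
  show "emeasure M A = emeasure (return borel c) A"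
  proof (cases "c \<in> A")
    case True
    then have "AE x in M. x \<in> A" using assms(3) by auto
    then have "prob A = 1" using A by (simp add: prob_eq_1)
    then show ?thesis using A True assms(2) by (simp add: emeasure_eq_measure)
  next
    case False
    then have "AE x in M. x \<notin> A" using assms(3) by auto
    then have "emeasure M A = 0" using A by (subst (asm) AE_iff_measurable[OF A]) (use sets.sets_into_space[OF A] in auto)
    then show ?thesis using A False assms(2) by simp
  qed
qed (use assms in simp)

context marginals
begin

section \<open>Null sets of couplings and almost everywhere changes of densities\<close>

lemma coupling_AE_fst:
  assumes cp: "coupling \<mu> \<nu> \<pi>" and P: "AE x in \<mu>. P x"
  shows "AE z in \<pi>. P (fst z)"
proof -
  have [measurable_cong]: "sets \<pi> = sets (borel \<Otimes>\<^sub>M borel)" and d: "distr \<pi> borel fst = \<mu>"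
    using cp by (auto simp: coupling_def sets_borel_pair)
  have "fst \<in> \<pi> \<rightarrow>\<^sub>M borel" by measurable
  from AE_distrD[OF this, unfolded d, OF P] show ?thesis .
qed

lemma coupling_AE_snd:
  assumes cp: "coupling \<mu> \<nu> \<pi>" and P: "AE y in \<nu>. P y"
  shows "AE z in \<pi>. P (snd z)"
proof -
  have [measurable_cong]: "sets \<pi> = sets (borel \<Otimes>\<^sub>M borel)" and d: "distr \<pi> borel snd = \<nu>"
    using cp by (auto simp: coupling_def sets_borel_pair)
  have "snd \<in> \<pi> \<rightarrow>\<^sub>M borel" by measurable
  from AE_distrD[OF this, unfolded d, OF P] show ?thesis .
qed

lemma coupling_product: "coupling \<mu> \<nu> R"
proof -
  have "distr R borel fst = distr R \<mu> fst" "distr R borel snd = distr R \<nu> snd"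
    by (auto intro!: distr_cong simp: sets_mu sets_nu)
  then show ?thesis
    using N.distr_pair_fst[of \<mu>] distr_pair_snd[OF prob_mu N.sigma_finite_measure_axioms]
    by (simp add: coupling_def sets_R)
qed

text \<open>Allows the optimal density to be replaced by its exponential form, which is then an
  exact formula at every point.\<close>

lemma fin_ent_cong_AE:
  assumes q: "fin_ent q" and [measurable]: "p \<in> borel_measurable (borel \<Otimes>\<^sub>M borel)" and nn: "\<And>z. 0 \<le> p z"
    and ae: "AE z in R. q z = p z"
  shows "fin_ent p" and "density R (\<lambda>z. ennreal (q z)) = density R (\<lambda>z. ennreal (p z))"
proof -
  have mq: "mdens q" and iq: "integrable R (\<lambda>z. q z * ln (q z))" using q by (auto simp: fin_ent_def)
  note [measurable] = mdens_measurable[OF mq]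
  show d: "density R (\<lambda>z. ennreal (q z)) = density R (\<lambda>z. ennreal (p z))"
    using ae by (intro density_cong) auto
  have int: "integrable R p"
    using mdens_integrable[OF mq] by (rule integrable_cong_AE_imp) (use ae in auto)
  have eq: "(\<integral>z. w z * p z \<partial>R) = (\<integral>z. w z * q z \<partial>R)"
    if [measurable]: "w \<in> borel_measurable (borel \<Otimes>\<^sub>M borel)" for w :: "_ \<Rightarrow> real"
    by (rule integral_cong_AE) (use ae in auto)
  have "mdens p"
    unfolding mdens_def
  proof (intro conjI ballI allI)
    fix A :: "real set" assume A [measurable]: "A \<in> sets borel"
    show "(\<integral>z. indicator A (fst z) * p z \<partial>R) = measure \<mu> A"
      by (subst eq) (simp_all add: mdens_fst_indicator[OF mq A])
    show "(\<integral>z. indicator A (snd z) * p z \<partial>R) = measure \<nu> A"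
      by (subst eq) (simp_all add: mdens_snd_indicator[OF mq A])
    show "(\<integral>z. indicator A (fst z) * ((snd z - fst z) * p z) \<partial>R) = 0"
      unfolding mult.assoc[symmetric]
      by (subst eq) (simp_all add: mult.assoc mdens_martingale_indicator[OF mq A])
  qed (use nn int in \<open>simp_all del: split_paired_All\<close>)
  moreover have "integrable R (\<lambda>z. p z * ln (p z))"
    using iq by (rule integrable_cong_AE_imp) (use ae in auto)
  ultimately show "fin_ent p" by (simp add: fin_ent_def)
qed

section \<open>One-sided bounds and integrability for exponential densities\<close>

definition gibbs :: "(real \<Rightarrow> real) \<Rightarrow> (real \<Rightarrow> real) \<Rightarrow> (real \<Rightarrow> real) \<Rightarrow> real \<times> real \<Rightarrow> real" where
  "gibbs f g h z = exp (f (fst z) + g (snd z) - h (fst z) * (snd z - fst z))"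

lemma gibbs_measurable:
  assumes [measurable]: "f \<in> borel_measurable borel" "g \<in> borel_measurable borel" "h \<in> borel_measurable borel"
  shows "gibbs f g h \<in> borel_measurable (borel \<Otimes>\<^sub>M borel)"
  unfolding gibbs_def by measurable

lemma gibbs_nonneg: "0 \<le> gibbs f g h z"
  by (simp add: gibbs_def)

text \<open>The conditional density has total mass 1, and it is bounded below in terms of f x on a
  set of positive \<nu>-measure where g is bounded below and h x (y - x) \<le> 0. As h x can have
  either sign, such a set is taken on each side of almost every x.\<close>

lemma gibbs_f_bounded_above:
  assumes [measurable]: "f \<in> borel_measurable borel" "g \<in> borel_measurable borel" "h \<in> borel_measurable borel"
    and m: "mdens (gibbs f g h)"
    and Lo [measurable]: "Lo \<in> sets borel" and Lo_pos: "0 < emeasure \<nu> Lo" and Lo_le: "AE x in \<mu>. \<forall>y\<in>Lo. y \<le> x"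
    and Up [measurable]: "Up \<in> sets borel" and Up_pos: "0 < emeasure \<nu> Up" and Up_ge: "AE x in \<mu>. \<forall>y\<in>Up. x \<le> y"
  obtains K where "AE x in \<mu>. f x \<le> K"
proof -
  have gm: "(\<lambda>y. - g y) \<in> borel_measurable \<nu>" by measurable
  obtain n1 :: nat where n1: "0 < emeasure \<nu> {y \<in> Lo. - g y \<le> real n1}" "{y \<in> Lo. - g y \<le> real n1} \<in> sets \<nu>"
    by (rule positive_measure_bounded_part[OF _ gm Lo_pos]) (simp add: sets_nu)
  obtain n2 :: nat where n2: "0 < emeasure \<nu> {y \<in> Up. - g y \<le> real n2}" "{y \<in> Up. - g y \<le> real n2} \<in> sets \<nu>"
    by (rule positive_measure_bounded_part[OF _ gm Up_pos]) (simp add: sets_nu)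
  define A where "A = {y \<in> Lo. - g y \<le> real n1}"
  define B where "B = {y \<in> Up. - g y \<le> real n2}"
  have AB [measurable]: "A \<in> sets borel" "B \<in> sets borel" using n1(2) n2(2) by (simp_all add: A_def B_def sets_nu)
  have pos: "0 < measure \<nu> A" "0 < measure \<nu> B"
    using n1(1) n2(1) by (simp_all add: A_def B_def N.emeasure_eq_measure)
  have bound: "f x \<le> real n - ln (measure \<nu> S)"
    if [measurable]: "S \<in> sets borel" and S: "0 < measure \<nu> S"
      and g: "\<And>y. y \<in> S \<Longrightarrow> - g y \<le> real n" and h: "\<And>y. y \<in> S \<Longrightarrow> h x * (y - x) \<le> 0"
      and i: "integrable \<nu> (\<lambda>y. gibbs f g h (x, y))" "(\<integral>y. gibbs f g h (x, y) \<partial>\<nu>) = 1" for x S n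
  proof -
    have "(\<integral>y. indicator S y * exp (f x - real n) \<partial>\<nu>) \<le> (\<integral>y. gibbs f g h (x, y) \<partial>\<nu>)"
    proof (rule integral_mono[OF _ i(1)])
      show "integrable \<nu> (\<lambda>y. indicator S y * exp (f x - real n))"
        by (rule N.integrable_const_bound[where B="exp (f x - real n)"]) (auto simp: indicator_def)
      show "indicator S y * exp (f x - real n) \<le> gibbs f g h (x, y)" for y
        using g[of y] h[of y] by (cases "y \<in> S") (auto simp: gibbs_def)
    qed
    then have "measure \<nu> S * exp (f x - real n) \<le> 1" by (simp add: i(2))
    then have "ln (measure \<nu> S * exp (f x - real n)) \<le> ln 1" using S by (subst ln_le_cancel_iff) auto
    then show ?thesis using S by (simp add: ln_mult)
  qed
  define K where "K = max (real n1 - ln (measure \<nu> A)) (real n2 - ln (measure \<nu> B))"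
  have "AE x in \<mu>. f x \<le> K"
    using mdens_AE_fst[OF m] Lo_le Up_ge
  proof eventually_elim
    fix x assume i: "integrable \<nu> (\<lambda>y. gibbs f g h (x, y)) \<and> (\<integral>y. gibbs f g h (x, y) \<partial>\<nu>) = 1"
      and x: "\<forall>y\<in>Lo. y \<le> x" "\<forall>y\<in>Up. x \<le> y"
    show "f x \<le> K"
    proof (cases "0 \<le> h x")
      case True
      have "f x \<le> real n1 - ln (measure \<nu> A)"
        by (rule bound[OF AB(1) pos(1)]) (use i x True in \<open>auto simp: A_def mult_le_0_iff\<close>)
      then show ?thesis by (simp add: K_def)
    next
      case False
      have "f x \<le> real n2 - ln (measure \<nu> B)"
        by (rule bound[OF AB(2) pos(2)]) (use i x False in \<open>auto simp: B_def mult_le_0_iff\<close>)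
      then show ?thesis by (simp add: K_def)
    qed
  qed
  then show thesis by (rule that)
qed

text \<open>The dual argument: on a set of positive \<mu>-measure |f|, |h| and |x| are at most k, so
  the exponent is at least g y - k - k (|y| + k), while the integral over x is 1.\<close>

lemma gibbs_g_linear_growth:
  assumes [measurable]: "f \<in> borel_measurable borel" "g \<in> borel_measurable borel" "h \<in> borel_measurable borel"
    and m: "mdens (gibbs f g h)"
  obtains C K where "AE y in \<nu>. g y \<le> C + K * \<bar>y\<bar>"
proof -
  have um: "(\<lambda>x. \<bar>f x\<bar> + \<bar>h x\<bar> + \<bar>x\<bar>) \<in> borel_measurable \<mu>" by measurable
  have "0 < emeasure \<mu> UNIV" using M.emeasure_space_1 by simp
  then have U: "UNIV \<in> sets \<mu>" "0 < emeasure \<mu> UNIV" by (simp_all add: sets_mu)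
  obtain n :: nat where n: "0 < emeasure \<mu> {x \<in> UNIV. \<bar>f x\<bar> + \<bar>h x\<bar> + \<bar>x\<bar> \<le> real n}"
      "{x \<in> UNIV. \<bar>f x\<bar> + \<bar>h x\<bar> + \<bar>x\<bar> \<le> real n} \<in> sets \<mu>"
    by (rule positive_measure_bounded_part[OF U(1) um U(2)])
  define B where "B = {x. \<bar>f x\<bar> + \<bar>h x\<bar> + \<bar>x\<bar> \<le> real n}"
  have [measurable]: "B \<in> sets borel" using n(2) by (simp add: B_def sets_mu)
  have b: "0 < measure \<mu> B" using n(1) by (simp add: B_def M.emeasure_eq_measure)
  define k where "k = real n"
  have "AE y in \<nu>. g y \<le> (k + k * k - ln (measure \<mu> B)) + k * \<bar>y\<bar>"
    using mdens_AE_snd[OF m]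
  proof eventually_elim
    fix y assume i: "integrable \<mu> (\<lambda>x. gibbs f g h (x, y)) \<and> (\<integral>x. gibbs f g h (x, y) \<partial>\<mu>) = 1"
    let ?c = "exp (g y - k - k * (\<bar>y\<bar> + k))"
    have "(\<integral>x. indicator B x * ?c \<partial>\<mu>) \<le> (\<integral>x. gibbs f g h (x, y) \<partial>\<mu>)"
    proof (rule integral_mono)
      show "integrable \<mu> (\<lambda>x. indicator B x * ?c)"
        by (rule M.integrable_const_bound[where B="?c"]) (auto simp: indicator_def)
      show "indicator B x * ?c \<le> gibbs f g h (x, y)" for x
      proof (cases "x \<in> B")
        case True
        then have x: "\<bar>f x\<bar> \<le> k" "\<bar>h x\<bar> \<le> k" "\<bar>x\<bar> \<le> k" by (auto simp: B_def k_def)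
        have "h x * (y - x) \<le> \<bar>h x\<bar> * \<bar>y - x\<bar>" by (simp add: abs_mult[symmetric])
        also have "\<dots> \<le> k * (\<bar>y\<bar> + k)" using x by (intro mult_mono) auto
        finally show ?thesis using True x by (simp add: gibbs_def)
      qed (simp add: gibbs_def)
    qed (use i in blast)
    then have "measure \<mu> B * ?c \<le> 1" using i by simp
    then have "ln (measure \<mu> B * ?c) \<le> ln 1" using b by (subst ln_le_cancel_iff) auto
    then show "g y \<le> (k + k * k - ln (measure \<mu> B)) + k * \<bar>y\<bar>"
      using b by (simp add: ln_mult algebra_simps)
  qed
  then show thesis by (rule that)
qed

text \<open>Integrating \<open>ln (gibbs f g h)\<close> against the conditional law of \<open>y\<close> given \<open>x\<close> removes \<open>h\<close>, since
  that law has barycenter \<open>x\<close>. What remains is \<open>f x\<close> plus the conditional mean of \<open>g\<close>: an upper bound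
  on each of \<open>f\<close> and \<open>g\<close> therefore gives a lower bound on the other.\<close>

lemma gibbs_integrable:
  assumes fm [measurable]: "f \<in> borel_measurable borel" and gm [measurable]: "g \<in> borel_measurable borel"
    and hm [measurable]: "h \<in> borel_measurable borel"
    and fe: "fin_ent (gibbs f g h)"
    and f_le: "AE x in \<mu>. f x \<le> K"
    and g_le: "AE y in \<nu>. g y \<le> C + D * \<bar>y\<bar>"
  shows "integrable \<mu> f" and "integrable \<nu> g"
proof -
  define E where "E = gibbs f g h"
  have m: "mdens E" and iE: "integrable R (\<lambda>z. E z * ln (E z))" using fe by (auto simp: fin_ent_def E_def)
  note [measurable] = mdens_measurable[OF m]
  note nn = mdens_nonneg[OF m]
  define G where "G y = C + D * \<bar>y\<bar>" for y
  have Gm [measurable]: "G \<in> borel_measurable borel" unfolding G_def by measurable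
  have iG: "integrable \<nu> G" unfolding G_def using integrable_nu by simp
  have iGE: "integrable R (\<lambda>z. G (snd z) * E z)" using iG mdens_snd(1)[OF m Gm] by simp
  define e where "e x = (\<integral>y. E (x, y) * ln (E (x, y)) \<partial>\<nu>)" for x
  define k where "k x = (\<integral>y. G y * E (x, y) \<partial>\<nu>)" for x
  have ie: "integrable \<mu> e" unfolding e_def by (rule integrable_fst'[OF iE])
  have ik: "integrable \<mu> k" unfolding k_def using integrable_fst'[OF iGE] by simp
  have cond: "AE x in \<mu>. integrable \<nu> (\<lambda>y. (G y - g y) * E (x, y)) \<and>
      (\<integral>y. (G y - g y) * E (x, y) \<partial>\<nu>) = k x - e x + f x"
    using mdens_AE_fst[OF m] mdens_AE_martingale[OF m] AE_integrable_fst'[OF iE] AE_integrable_fst'[OF iGE]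
  proof eventually_elim
    fix x assume a1: "integrable \<nu> (\<lambda>y. E (x, y)) \<and> (\<integral>y. E (x, y) \<partial>\<nu>) = 1"
      and a2: "integrable \<nu> (\<lambda>y. (y - x) * E (x, y)) \<and> (\<integral>y. (y - x) * E (x, y) \<partial>\<nu>) = 0"
      and a3: "integrable \<nu> (\<lambda>y. E (x, y) * ln (E (x, y)))"
      and a4: "integrable \<nu> (\<lambda>y. G (snd (x, y)) * E (x, y))"
    have eq: "(\<lambda>y. (G y - g y) * E (x, y)) = (\<lambda>y. G y * E (x, y) - E (x, y) * ln (E (x, y))
        + f x * E (x, y) - h x * ((y - x) * E (x, y)))"
      by (auto simp: E_def gibbs_def algebra_simps)
    show "integrable \<nu> (\<lambda>y. (G y - g y) * E (x, y)) \<and> (\<integral>y. (G y - g y) * E (x, y) \<partial>\<nu>) = k x - e x + f x"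
      unfolding eq using a1 a2 a3 a4 by (simp add: e_def k_def)
  qed
  have Gg: "AE y in \<nu>. 0 \<le> G y - g y" using g_le by eventually_elim (simp add: G_def)
  \<comment> \<open>As g \<le> G, the conditional mean of G - g is a conditional L1 norm: its
    nonnegativity bounds f from below, and its integrability in x gives joint integrability.\<close>
  have norm_eq: "AE x in \<mu>. (\<integral>y. norm ((G y - g y) * E (x, y)) \<partial>\<nu>) = k x - e x + f x"
    using cond
  proof eventually_elim
    fix x assume a: "integrable \<nu> (\<lambda>y. (G y - g y) * E (x, y)) \<and>
      (\<integral>y. (G y - g y) * E (x, y) \<partial>\<nu>) = k x - e x + f x"
    have "(\<integral>y. norm ((G y - g y) * E (x, y)) \<partial>\<nu>) = (\<integral>y. (G y - g y) * E (x, y) \<partial>\<nu>)"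
      by (rule integral_cong_AE) (use Gg in \<open>auto simp: abs_mult nn elim!: eventually_mono\<close>)
    with a show "(\<integral>y. norm ((G y - g y) * E (x, y)) \<partial>\<nu>) = k x - e x + f x" by simp
  qed
  have f_ge: "AE x in \<mu>. e x - k x \<le> f x"
    using norm_eq
  proof eventually_elim
    fix x assume "(\<integral>y. norm ((G y - g y) * E (x, y)) \<partial>\<nu>) = k x - e x + f x"
    moreover have "0 \<le> (\<integral>y. norm ((G y - g y) * E (x, y)) \<partial>\<nu>)" by simp
    ultimately show "e x - k x \<le> f x" by simp
  qed
  show intf: "integrable \<mu> f"
  proof (rule Bochner_Integration.integrable_bound)
    show "integrable \<mu> (\<lambda>x. \<bar>K\<bar> + \<bar>e x\<bar> + \<bar>k x\<bar>)" using ie ik by simp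
    show "AE x in \<mu>. norm (f x) \<le> norm (\<bar>K\<bar> + \<bar>e x\<bar> + \<bar>k x\<bar>)"
      using f_le f_ge by eventually_elim simp
  qed measurable
  have "integrable R (\<lambda>z. (G (snd z) - g (snd z)) * E z)"
  proof (rule Fubini_integrable)
    have i: "integrable \<mu> (\<lambda>x. k x - e x + f x)" using ie ik intf by simp
    have "integrable \<mu> (\<lambda>x. \<integral>y. norm ((G y - g y) * E (x, y)) \<partial>\<nu>)"
      using i by (rule integrable_cong_AE_imp) (use norm_eq in \<open>auto elim!: eventually_mono\<close>)
    then show "integrable \<mu> (\<lambda>x. \<integral>y. norm ((G (snd (x, y)) - g (snd (x, y))) * E (x, y)) \<partial>\<nu>)" by simp
    show "AE x in \<mu>. integrable \<nu> (\<lambda>y. (G (snd (x, y)) - g (snd (x, y))) * E (x, y))"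
      using cond by eventually_elim simp
  qed measurable
  moreover have "(\<lambda>y. G y - g y) \<in> borel_measurable borel" by measurable
  ultimately have "integrable \<nu> (\<lambda>y. G y - g y)" using mdens_snd(1)[OF m] by blast
  from Bochner_Integration.integrable_diff[OF iG this] show "integrable \<nu> g" by simp
qed

text \<open>Slicing at one x0 shows that g - g' agrees with an affine function \<nu>-almost
  everywhere, and almost every other slice gives an affine function too. Affine functions that agree
  \<nu>-almost everywhere coincide, because \<nu> is not a point mass.\<close>

lemma potentials_affine_unique:
  fixes f g h f' g' h' :: "real \<Rightarrow> real"
  assumes nd: "\<And>c. \<not> (AE y in \<nu>. y = c)"
    and ae: "AE z in R. f (fst z) + g (snd z) - h (fst z) * (snd z - fst z)
      = f' (fst z) + g' (snd z) - h' (fst z) * (snd z - fst z)"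
  shows "\<exists>\<alpha> \<beta>. (AE x in \<mu>. f' x - f x = \<alpha> * x + \<beta>) \<and> (AE y in \<nu>. g y - g' y = \<alpha> * y + \<beta>) \<and>
    (AE x in \<mu>. h x - h' x = \<alpha>)"
proof -
  have ae': "AE x in \<mu>. AE y in \<nu>. g y - g' y = (f' x - f x) + (h x - h' x) * (y - x)"
    using AE_pair[OF ae] by (auto simp: algebra_simps elim!: eventually_mono)
  then obtain x0 where x0: "AE y in \<nu>. g y - g' y = (f' x0 - f x0) + (h x0 - h' x0) * (y - x0)"
    using M.AE_False by (metis (mono_tags, lifting) eventually_mono)
  define \<alpha> where "\<alpha> = h x0 - h' x0"
  define \<beta> where "\<beta> = (f' x0 - f x0) - \<alpha> * x0"
  have g: "AE y in \<nu>. g y - g' y = \<alpha> * y + \<beta>"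
    using x0 by eventually_elim (simp add: \<alpha>_def \<beta>_def algebra_simps)
  have "AE x in \<mu>. f' x - f x = \<alpha> * x + \<beta> \<and> h x - h' x = \<alpha>"
    using ae'
  proof eventually_elim
    fix x assume "AE y in \<nu>. g y - g' y = (f' x - f x) + (h x - h' x) * (y - x)"
    with g have y: "AE y in \<nu>. ((h x - h' x) - \<alpha>) * y = \<beta> - (f' x - f x) + (h x - h' x) * x"
      by eventually_elim (simp add: algebra_simps)
    have h: "h x - h' x = \<alpha>"
    proof (rule ccontr)
      assume ne: "h x - h' x \<noteq> \<alpha>"
      from y have "AE y in \<nu>. y = (\<beta> - (f' x - f x) + (h x - h' x) * x) / ((h x - h' x) - \<alpha>)"
        by eventually_elim (use ne in \<open>simp add: field_simps\<close>)
      with nd show False by blast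
    qed
    from y have "AE y in \<nu>. f' x - f x = \<alpha> * x + \<beta>"
      by eventually_elim (use h in simp)
    then have "f' x - f x = \<alpha> * x + \<beta>" by simp
    with h show "f' x - f x = \<alpha> * x + \<beta> \<and> h x - h' x = \<alpha>" by blast
  qed
  with g show ?thesis by (intro exI[of _ \<alpha>] exI[of _ \<beta>]) auto
qed

section \<open>Optimal couplings and minimizing densities\<close>

lemma ent_min_optimizer:
  assumes "ent_min q"
  shows "optimizer \<mu> \<nu> (density R (\<lambda>z. ennreal (q z)))"
proof -
  have f: "fin_ent q" and m: "mdens q" using assms by (auto simp: ent_min_def fin_ent_def)
  show ?thesis
    unfolding optimizer_def
  proof (intro conjI allI impI mdens_martingale_coupling m)
    fix \<pi> assume \<pi>: "martingale_coupling \<mu> \<nu> \<pi>"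
    show "rel_entropy (density R (\<lambda>z. ennreal (q z))) R \<le> rel_entropy \<pi> R"
    proof (cases "rel_entropy \<pi> R < \<infinity>")
      case True
      with \<pi> obtain p where "fin_ent p" "rel_entropy \<pi> R = ereal (Ent p)" by (rule finite_entropy_mdens)
      with assms f m show ?thesis by (simp add: rel_entropy_density ent_min_def)
    qed simp
  qed
qed

text \<open>The competitor \<open>q0\<close> makes the optimal value finite, so the optimizer has a
  density; with infinite value every martingale coupling would be optimal.\<close>

lemma optimizer_ent_min:
  assumes opt: "optimizer \<mu> \<nu> \<pi>" and q0: "fin_ent q0"
  obtains q where "ent_min q" "\<pi> = density R (\<lambda>z. ennreal (q z))"
proof -
  have le: "rel_entropy \<pi> R \<le> ereal (Ent p)" if "fin_ent p" for p
  proof -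
    have "mdens p" using that by (simp add: fin_ent_def)
    with opt that show ?thesis
      unfolding optimizer_def by (metis mdens_martingale_coupling rel_entropy_density)
  qed
  have "rel_entropy \<pi> R < \<infinity>" using le[OF q0] by (auto intro: le_less_trans)
  moreover have "martingale_coupling \<mu> \<nu> \<pi>" using opt by (simp add: optimizer_def)
  ultimately obtain q where q: "fin_ent q" "\<pi> = density R (\<lambda>z. ennreal (q z))" "rel_entropy \<pi> R = ereal (Ent q)"
    using finite_entropy_mdens by blast
  with le show thesis by (intro that[of q]) (auto simp: ent_min_def)
qed

lemma Mfin_density:
  assumes "\<pi> \<in> Mfin \<mu> \<nu>"
  obtains q where "fin_ent q" "\<pi> = density R (\<lambda>z. ennreal (q z))"
  using assms finite_entropy_mdens unfolding Mfin_def by blast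

end

section \<open>From the minimizing density to the optimizer and its potentials\<close>

theorem mainTheorem1:
  fixes \<mu> \<nu> :: "real measure"
  assumes "prob_space \<mu>" and "prob_space \<nu>"
    and "sets \<mu> = sets borel" and "sets \<nu> = sets borel"
    and "integrable \<mu> (\<lambda>x. x)" and "integrable \<nu> (\<lambda>y. y)"
    and "convex_order \<mu> \<nu>"
    and "(\<integral>x. x \<partial>\<mu>) = 0" and "(\<integral>y. y \<partial>\<nu>) = 0"
    and "\<mu> \<noteq> return borel 0"
    and "assumptionA \<mu> \<nu>" and "assumptionB \<mu> \<nu>"
  shows "(\<exists>!\<pi>. optimizer \<mu> \<nu> \<pi>) \<and>
    (\<forall>\<pi>. optimizer \<mu> \<nu> \<pi> \<longrightarrow>
       (\<exists>f g h. potentials \<mu> \<nu> \<pi> f g h) \<and>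
       (\<forall>f g h. potentials \<mu> \<nu> \<pi> f g h \<longrightarrow>
          (\<forall>f' g' h'. f' \<in> borel_measurable borel \<and> integrable \<mu> f' \<and>
             g' \<in> borel_measurable borel \<and> integrable \<nu> g' \<and> h' \<in> borel_measurable borel \<longrightarrow>
             (potentials \<mu> \<nu> \<pi> f' g' h' \<longleftrightarrow>
               (\<exists>\<alpha> \<beta>::real. (AE x in \<mu>. f' x - f x = \<alpha> * x + \<beta>) \<and>
                  (AE y in \<nu>. g y - g' y = \<alpha> * y + \<beta>) \<and>
                  (AE x in \<mu>. h x - h' x = \<alpha>))))))"
proof -
  interpret marginals \<mu> \<nu> by (rule marginals.intro) (rule assms)+
  \<comment> \<open>If \<nu> were a point mass, centering would put it at 0, and convex order
    applied to |x| would force \<mu> to be the point mass at 0.\<close>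
  have nd: "\<not> (AE y in \<nu>. y = c)" for c
  proof
    assume c: "AE y in \<nu>. y = c"
    have "(\<integral>y. y \<partial>\<nu>) = (\<integral>y. c \<partial>\<nu>)" by (rule integral_cong_AE) (use c in auto)
    with assms(9) have "c = 0" by simp
    have "(\<integral>y. \<bar>y\<bar> \<partial>\<nu>) = (\<integral>y. 0 \<partial>\<nu>)" by (rule integral_cong_AE) (use c \<open>c = 0\<close> in auto)
    moreover have "convex_on UNIV (\<lambda>x :: real. \<bar>x\<bar>)" using convex_on_dist[OF convex_UNIV, of "0 :: real"] by (simp add: dist_real_def)
    ultimately have "(\<integral>x. \<bar>x\<bar> \<partial>\<mu>) \<le> 0"
      using assms(7) integrable_abs[OF integrable_nu] unfolding convex_order_def by fastforce
    moreover have "0 \<le> (\<integral>x. \<bar>x\<bar> \<partial>\<mu>)" by simp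
    ultimately have "(\<integral>x. \<bar>x\<bar> \<partial>\<mu>) = 0" by (rule order_antisym)
    then have "AE x in \<mu>. \<bar>x\<bar> = 0"
      using integral_nonneg_eq_0_iff_AE[OF integrable_abs[OF integrable_mu]] by simp
    then have "\<mu> = return borel 0" by (intro AE_eq_const_imp_return prob_mu sets_mu) auto
    with assms(10) show False by simp
  qed
  obtain \<pi>0 where \<pi>0: "martingale_coupling \<mu> \<nu> \<pi>0" "absolutely_continuous \<pi>0 R" "rel_entropy \<pi>0 R < \<infinity>"
    using assms(11) by (auto simp: assumptionA_def)
  obtain q0 where q0: "fin_ent q0" "\<pi>0 = density R (\<lambda>z. ennreal (q0 z))"
    using finite_entropy_mdens[OF \<pi>0(1,3)] by blast
  \<comment> \<open>\<open>q0\<close> is positive almost everywhere under its own measure, hence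
    under \<open>R\<close> by the equivalence in Assumption A.\<close>
  have q0_pos: "AE z in R. 0 < q0 z"
  proof (rule absolutely_continuous_AE[OF _ \<pi>0(2)])
    have "q0 \<in> borel_measurable (borel \<Otimes>\<^sub>M borel)" using q0(1) by (simp add: fin_ent_def mdens_measurable)
    then have [measurable]: "q0 \<in> borel_measurable R" by measurable
    show "sets R = sets \<pi>0" by (simp add: q0(2))
    show "AE z in \<pi>0. 0 < q0 z" unfolding q0(2) by (subst AE_density) auto
  qed
  have pos: "AE z in R. 0 < Z z" if "ent_min Z" for Z
    using ent_min_positive[OF that q0(1)] q0_pos by eventually_elim simp
  \<comment> \<open>\<open>Lo\<close> and \<open>Up\<close> are the sets of Assumption B at or
    beyond the two ends of the support of \<mu>; almost every x lies between them.\<close>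
  obtain Lo where Lo: "Lo \<in> sets borel" "0 < emeasure \<nu> Lo" "AE x in \<mu>. \<forall>y\<in>Lo. y \<le> x"
  proof
    show "{y. ereal y \<le> Inf (ereal ` measure_support \<mu>)} \<in> sets borel" by measurable
    show "0 < emeasure \<nu> {y. ereal y \<le> Inf (ereal ` measure_support \<mu>)}"
      using assms(12) by (simp add: assumptionB_def Let_def)
    show "AE x in \<mu>. \<forall>y\<in>{y. ereal y \<le> Inf (ereal ` measure_support \<mu>)}. y \<le> x"
      using AE_measure_support[OF sets_mu]
      by eventually_elim (metis (mono_tags, lifting) INF_lower ereal_less_eq(3) mem_Collect_eq order_trans)
  qed
  obtain Up where Up: "Up \<in> sets borel" "0 < emeasure \<nu> Up" "AE x in \<mu>. \<forall>y\<in>Up. x \<le> y"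
  proof
    show "{y. Sup (ereal ` measure_support \<mu>) \<le> ereal y} \<in> sets borel" by measurable
    show "0 < emeasure \<nu> {y. Sup (ereal ` measure_support \<mu>) \<le> ereal y}"
      using assms(12) by (simp add: assumptionB_def Let_def)
    show "AE x in \<mu>. \<forall>y\<in>{y. Sup (ereal ` measure_support \<mu>) \<le> ereal y}. x \<le> y"
      using AE_measure_support[OF sets_mu]
      by eventually_elim (metis (mono_tags, lifting) SUP_upper ereal_less_eq(3) mem_Collect_eq order_trans)
  qed
  have unique: "\<exists>!\<pi>. optimizer \<mu> \<nu> \<pi>"
  proof -
    obtain Z where Z: "ent_min Z" by (rule ent_min_exists[OF q0(1)])
    show ?thesis
    proof (rule ex1I)
      show "optimizer \<mu> \<nu> (density R (\<lambda>z. ennreal (Z z)))" by (rule ent_min_optimizer[OF Z])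
      fix \<pi> assume "optimizer \<mu> \<nu> \<pi>"
      then obtain q where q: "ent_min q" "\<pi> = density R (\<lambda>z. ennreal (q z))" by (rule optimizer_ent_min[OF _ q0(1)])
      have m: "mdens q" "mdens Z" using q Z by (auto simp: ent_min_def fin_ent_def)
      note [measurable] = mdens_measurable[OF m(1)] mdens_measurable[OF m(2)]
      show "\<pi> = density R (\<lambda>z. ennreal (Z z))"
        unfolding q(2) using ent_min_unique[OF q(1) Z] by (intro density_cong) auto
    qed
  qed
  have pot_eq: "potentials \<mu> \<nu> \<pi> f g h \<longleftrightarrow> f \<in> borel_measurable borel \<and> integrable \<mu> f \<and>
     g \<in> borel_measurable borel \<and> integrable \<nu> g \<and> h \<in> borel_measurable borel \<and>
     (\<forall>\<pi>'\<in>Mfin \<mu> \<nu>. integrable \<pi>' (\<lambda>z. h (fst z) * (snd z - fst z))) \<and>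
     \<pi> = density R (\<lambda>z. ennreal (gibbs f g h z))" for \<pi> f g h
    by (simp add: potentials_def gibbs_def case_prod_unfold)
  have exists: "\<exists>f g h. potentials \<mu> \<nu> \<pi> f g h" if opt: "optimizer \<mu> \<nu> \<pi>" for \<pi>
  proof -
    obtain Z where Z: "ent_min Z" and \<pi>: "\<pi> = density R (\<lambda>z. ennreal (Z z))"
      using opt by (rule optimizer_ent_min[OF _ q0(1)])
    obtain f g h where m: "f \<in> borel_measurable borel" "g \<in> borel_measurable borel" "h \<in> borel_measurable borel"
      and ln: "AE z in R. ln (Z z) = f (fst z) + g (snd z) - h (fst z) * (snd z - fst z)"
      by (rule log_density_decomposition[OF Z pos[OF Z] nd])
    note [measurable] = m
    have Zg: "AE z in R. Z z = gibbs f g h z"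
      using ln pos[OF Z] by eventually_elim (metis exp_ln gibbs_def)
    have fZ: "fin_ent Z" using Z by (simp add: ent_min_def)
    have fg: "fin_ent (gibbs f g h)" and d: "\<pi> = density R (\<lambda>z. ennreal (gibbs f g h z))"
      using fin_ent_cong_AE[OF fZ gibbs_measurable[OF m] gibbs_nonneg Zg] by (simp_all add: \<pi>)
    then have mg: "mdens (gibbs f g h)" by (simp add: fin_ent_def)
    obtain K where K: "AE x in \<mu>. f x \<le> K" by (rule gibbs_f_bounded_above[OF m mg Lo Up])
    obtain C D where CD: "AE y in \<nu>. g y \<le> C + D * \<bar>y\<bar>" by (rule gibbs_g_linear_growth[OF m mg])
    note i = gibbs_integrable[OF m fg K CD]
    have "integrable \<pi>' (\<lambda>z. h (fst z) * (snd z - fst z))" if "\<pi>' \<in> Mfin \<mu> \<nu>" for \<pi>'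
    proof -
      from that obtain q where q: "fin_ent q" and \<pi>': "\<pi>' = density R (\<lambda>z. ennreal (q z))" by (rule Mfin_density)
      have mq: "mdens q" using q by (simp add: fin_ent_def)
      note [measurable] = mdens_measurable[OF mq]
      \<comment> \<open>This combination equals h x (y - x) q almost everywhere; the first two terms
        are integrable through the marginals, the third by
        \<open>ent_min_log_integral\<close>.\<close>
      have "integrable R (\<lambda>z. f (fst z) * q z + g (snd z) * q z - q z * ln (Z z))"
        by (intro Bochner_Integration.integrable_diff Bochner_Integration.integrable_add
            iffD2[OF mdens_fst(1)[OF mq]] iffD2[OF mdens_snd(1)[OF mq]] i m ent_min_log_integral(1)[OF Z pos[OF Z] q])
      then have "integrable R (\<lambda>z. (h (fst z) * (snd z - fst z)) * q z)"
      proof (rule integrable_cong_AE_imp)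
        show "AE z in R. f (fst z) * q z + g (snd z) * q z - q z * ln (Z z) = (h (fst z) * (snd z - fst z)) * q z"
          using ln by eventually_elim (simp only:, simp add: algebra_simps)
      qed measurable
      then show ?thesis
        unfolding \<pi>' by (subst integrable_density_R) (auto simp: mdens_nonneg[OF mq] simp del: split_paired_All)
    qed
    then have "potentials \<mu> \<nu> \<pi> f g h" unfolding pot_eq using m i d by blast
    then show ?thesis by blast
  qed
  have shift: "potentials \<mu> \<nu> \<pi> f' g' h' \<longleftrightarrow>
      (\<exists>\<alpha> \<beta>::real. (AE x in \<mu>. f' x - f x = \<alpha> * x + \<beta>) \<and> (AE y in \<nu>. g y - g' y = \<alpha> * y + \<beta>) \<and>
        (AE x in \<mu>. h x - h' x = \<alpha>))"
    if p: "potentials \<mu> \<nu> \<pi> f g h"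
      and m': "f' \<in> borel_measurable borel \<and> integrable \<mu> f' \<and>
             g' \<in> borel_measurable borel \<and> integrable \<nu> g' \<and> h' \<in> borel_measurable borel"
    for \<pi> f g h f' g' h'
  proof
    have m: "f \<in> borel_measurable borel" "g \<in> borel_measurable borel" "h \<in> borel_measurable borel"
      using p by (auto simp: pot_eq)
    have [measurable]: "gibbs f g h \<in> borel_measurable (borel \<Otimes>\<^sub>M borel)"
      "gibbs f' g' h' \<in> borel_measurable (borel \<Otimes>\<^sub>M borel)"
      using m m' by (auto intro: gibbs_measurable)
    {
      assume "potentials \<mu> \<nu> \<pi> f' g' h'"
      with p have "density R (\<lambda>z. ennreal (gibbs f g h z)) = density R (\<lambda>z. ennreal (gibbs f' g' h' z))"
        by (simp add: pot_eq)
      then have "AE z in R. ennreal (gibbs f g h z) = ennreal (gibbs f' g' h' z)"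
        by (subst (asm) P.density_unique_iff) auto
      then have "AE z in R. f (fst z) + g (snd z) - h (fst z) * (snd z - fst z)
          = f' (fst z) + g' (snd z) - h' (fst z) * (snd z - fst z)"
        by eventually_elim (simp add: gibbs_def)
      then show "\<exists>\<alpha> \<beta>::real. (AE x in \<mu>. f' x - f x = \<alpha> * x + \<beta>) \<and> (AE y in \<nu>. g y - g' y = \<alpha> * y + \<beta>) \<and>
          (AE x in \<mu>. h x - h' x = \<alpha>)"
        by (rule potentials_affine_unique[OF nd])
    }
    {
      assume "\<exists>\<alpha> \<beta>::real. (AE x in \<mu>. f' x - f x = \<alpha> * x + \<beta>) \<and> (AE y in \<nu>. g y - g' y = \<alpha> * y + \<beta>) \<and>
          (AE x in \<mu>. h x - h' x = \<alpha>)"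
      then obtain \<alpha> \<beta> :: real where f: "AE x in \<mu>. f' x - f x = \<alpha> * x + \<beta>"
        and g: "AE y in \<nu>. g y - g' y = \<alpha> * y + \<beta>" and h: "AE x in \<mu>. h x - h' x = \<alpha>" by blast
      have "AE z in R. gibbs f g h z = gibbs f' g' h' z"
        using coupling_AE_fst[OF coupling_product f] coupling_AE_snd[OF coupling_product g]
          coupling_AE_fst[OF coupling_product h]
      proof eventually_elim
        fix z assume "f' (fst z) - f (fst z) = \<alpha> * fst z + \<beta>" "g (snd z) - g' (snd z) = \<alpha> * snd z + \<beta>"
          "h (fst z) - h' (fst z) = \<alpha>"
        then have eqs: "f' (fst z) = f (fst z) + \<alpha> * fst z + \<beta>" "g' (snd z) = g (snd z) - \<alpha> * snd z - \<beta>"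
          "h' (fst z) = h (fst z) - \<alpha>" by simp_all
        \<comment> \<open>The shifts change the exponent by \<alpha> x + \<beta> - \<alpha> y -
          \<beta> + \<alpha> (y - x) = 0.\<close>
        show "gibbs f g h z = gibbs f' g' h' z" unfolding gibbs_def eqs by (simp add: algebra_simps)
      qed
      then have "density R (\<lambda>z. ennreal (gibbs f g h z)) = density R (\<lambda>z. ennreal (gibbs f' g' h' z))"
        by (intro density_cong) auto
      moreover have "integrable \<pi>' (\<lambda>z. h' (fst z) * (snd z - fst z))" if \<pi>': "\<pi>' \<in> Mfin \<mu> \<nu>" for \<pi>'
      proof -
        have cp: "coupling \<mu> \<nu> \<pi>'" using \<pi>' by (simp add: Mfin_def martingale_coupling_def)
        then have [measurable_cong]: "sets \<pi>' = sets (borel \<Otimes>\<^sub>M borel)" by (simp add: coupling_def sets_borel_pair)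
        have [measurable]: "h \<in> borel_measurable borel" "h' \<in> borel_measurable borel" using m m' by auto
        have idm: "(\<lambda>x :: real. x) \<in> borel_measurable borel" by measurable
        \<comment> \<open>Under any coupling y - x is integrable, so changing h by a constant
          preserves integrability.\<close>
        have "integrable \<pi>' (\<lambda>z. h (fst z) * (snd z - fst z) - \<alpha> * (snd z - fst z))"
          by (intro Bochner_Integration.integrable_diff integrable_mult_right iffD2[OF coupling_fst(1)[OF cp idm]]
              iffD2[OF coupling_snd(1)[OF cp idm]] integrable_mu integrable_nu) (use p \<pi>' in \<open>auto simp: pot_eq\<close>)
        then show ?thesis
        proof (rule integrable_cong_AE_imp)
          show "AE z in \<pi>'. h (fst z) * (snd z - fst z) - \<alpha> * (snd z - fst z) = h' (fst z) * (snd z - fst z)"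
            using coupling_AE_fst[OF cp h] by eventually_elim (simp add: left_diff_distrib[symmetric])
        qed measurable
      qed
      ultimately show "potentials \<mu> \<nu> \<pi> f' g' h'"
        using p m' by (auto simp: pot_eq)
    }
  qed
  from unique exists shift show ?thesis by blast
qed

end
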